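(* Let $P:=\sum_{\lambda\in G}S_\lambda\in R$ be the sum of all Schubert classes, let $\operatorname{Ann}P=\{A\in R : A*P=0\}$, and put $\sigma_0:=1$. Then, as ideals of $R$, $$\operatorname{Ann}P=\bigl(\{\sigma_{k-i}-\sigma_i\}_{0\le i\le k}\bigr),$$ and the quotient ring $R_P:=R/\operatorname{Ann}P$ is, as a complex vector space, isomorphic to $G_S$.
   Context: Fix integers $1\le k<n$ and put $l:=n-k$. $R$ is the quantum cohomology ring (complex coefficients) of the Grassmannian $G(k,n)$ with deformation parameter $q$ set to $1$. It has the presentation $$R=\mathbb{C}[\sigma_1,\ldots,\sigma_k]/(Y_{n-k+1},\ldots,Y_{n-1},\,Y_n+(-1)^k),$$ where $Y_r=\det(\sigma_{1+j-i})_{1\le i,j\le r}$ (with $\sigma_0=1$ and $\sigma_m=0$ for $m<0$ or $m>k$). The product in $R$ is denoted $*$. $G$ is the set of Young diagrams $\lambda=(\lambda_1\ge\cdots\ge\lambda_l\ge 0)$ with $\lambda_1\le k$. The Schubert classes $S_\lambda=\det(\sigma_{\lambda_i+j-i})_{1\le i,j\le l}$, $\lambda\in G$, form a vector space basis of $R$; $\sigma_i$ is the Schubert class of the one-row diagram with $i$ boxes. $G_S$ is the subspace of $R$ spanned by the Schubert classes $S_\lambda$ whose diagram $\lambda$ has at most $[\frac{l}{2}]$ nonzero rows and satisfies $\lambda_1\le[\frac{k}{2}]$, where $[\,\cdot\,]$ means rounding down. *)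

theory Defs
  imports
    "HOL-Library.Poly_Mapping"
    "HOL-Algebra.QuotRing"
    "Jordan_Normal_Form.VS_Connect"
begin

section \<open>The polynomial ring in finitely many variables\<close>

text \<open>
  Polynomials with complex coefficients in variables indexed by \<open>nat\<close>: finitely supported maps
  from exponent vectors to coefficients.
\<close>

type_synonym cpoly = "(nat \<Rightarrow>\<^sub>0 nat) \<Rightarrow>\<^sub>0 complex"

definition const_poly :: "complex \<Rightarrow> cpoly" where
  "const_poly c = Poly_Mapping.single 0 c"

definition sigma_ring :: "nat \<Rightarrow> cpoly ring" where
  "sigma_ring k =
     \<lparr>carrier = {p. \<forall>m \<in> Poly_Mapping.keys p. Poly_Mapping.keys m \<subseteq> {1..k}},
      mult = (*), one = 1, zero = 0, add = (+)\<rparr>"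

text \<open>The index is an integer because \<open>\<sigma>\<^sub>m\<close> with negative \<open>m\<close> occurs in the determinants.\<close>

definition sigma_poly :: "nat \<Rightarrow> int \<Rightarrow> cpoly" where
  "sigma_poly k m =
     (if m = 0 then 1
      else if 1 \<le> m \<and> m \<le> int k
        then Poly_Mapping.single (Poly_Mapping.single (nat m) 1) 1
      else 0)"

definition Y_poly :: "nat \<Rightarrow> nat \<Rightarrow> cpoly" where
  "Y_poly k r = det (mat r r (\<lambda>(i, j). sigma_poly k (1 + int j - int i)))"

lemma cring_sigma_ring: "cring (sigma_ring k)"
proof (rule cringI)
  show "abelian_group (sigma_ring k)"
  proof (rule abelian_groupI)
    fix x y assume "x \<in> carrier (sigma_ring k)" "y \<in> carrier (sigma_ring k)"
    thus "x \<oplus>\<^bsub>sigma_ring k\<^esub> y \<in> carrier (sigma_ring k)"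
      using Poly_Mapping.keys_add[of x y] by (auto simp: sigma_ring_def)
  next
    fix x assume "x \<in> carrier (sigma_ring k)"
    thus "\<exists>y\<in>carrier (sigma_ring k). y \<oplus>\<^bsub>sigma_ring k\<^esub> x = \<zero>\<^bsub>sigma_ring k\<^esub>"
      by (intro bexI[of _ "- x"]) (auto simp: sigma_ring_def)
  qed (auto simp: sigma_ring_def add_ac)
  show "comm_monoid (sigma_ring k)"
  proof (rule comm_monoidI)
    fix x y assume xy: "x \<in> carrier (sigma_ring k)" "y \<in> carrier (sigma_ring k)"
    show "x \<otimes>\<^bsub>sigma_ring k\<^esub> y \<in> carrier (sigma_ring k)"
      unfolding sigma_ring_def
    proof (simp, intro ballI)
      fix m assume "m \<in> Poly_Mapping.keys (x * y)"
      then obtain a b where ab: "m = a + b" "a \<in> Poly_Mapping.keys x" "b \<in> Poly_Mapping.keys y"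
        using Poly_Mapping.keys_mult[of x y] by auto
      have "Poly_Mapping.keys m \<subseteq> Poly_Mapping.keys a \<union> Poly_Mapping.keys b"
        unfolding ab(1) by (rule Poly_Mapping.keys_add)
      thus "Poly_Mapping.keys m \<subseteq> {Suc 0..k}"
        using xy ab(2,3) by (fastforce simp: sigma_ring_def)
    qed
  qed (auto simp: sigma_ring_def mult_ac)
qed (auto simp: sigma_ring_def algebra_simps)

lemma sigma_poly_closed: "sigma_poly k m \<in> carrier (sigma_ring k)"
  by (auto simp: sigma_poly_def sigma_ring_def)

section \<open>The quantum cohomology ring of the Grassmannian at \<open>q = 1\<close>\<close>

definition qh_ideal :: "nat \<Rightarrow> nat \<Rightarrow> cpoly set" where
  "qh_ideal k n =
     Idl\<^bsub>sigma_ring k\<^esub> (Y_poly k ` {n - k + 1..n - 1} \<union> {Y_poly k n + (-1) ^ k})"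

definition qh_ring :: "nat \<Rightarrow> nat \<Rightarrow> cpoly set ring" where
  "qh_ring k n = sigma_ring k Quot qh_ideal k n"

definition qh_class :: "nat \<Rightarrow> nat \<Rightarrow> cpoly \<Rightarrow> cpoly set" where
  "qh_class k n p = qh_ideal k n +>\<^bsub>sigma_ring k\<^esub> p"

definition sigma_class :: "nat \<Rightarrow> nat \<Rightarrow> nat \<Rightarrow> cpoly set" where
  "sigma_class k n i = qh_class k n (sigma_poly k (int i))"

section \<open>Schubert classes\<close>

text \<open>
  A Young diagram in the \<open>l \<times> k\<close> rectangle is a list of exactly \<open>l\<close> row lengths, rows of length zero
  included. Rows and columns are numbered from \<open>0\<close>, which does not affect the entries of the
  determinants, as these depend on \<open>j - i\<close> only.
\<close>

definition young_diagrams :: "nat \<Rightarrow> nat \<Rightarrow> nat list set" where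
  "young_diagrams k l = {\<mu>. length \<mu> = l \<and> sorted_wrt (\<ge>) \<mu> \<and> (\<forall>x \<in> set \<mu>. x \<le> k)}"

definition schubert_poly :: "nat \<Rightarrow> nat list \<Rightarrow> cpoly" where
  "schubert_poly k \<mu> =
     det (mat (length \<mu>) (length \<mu>) (\<lambda>(i, j). sigma_poly k (int (\<mu> ! i) + int j - int i)))"

definition schubert_class :: "nat \<Rightarrow> nat \<Rightarrow> nat list \<Rightarrow> cpoly set" where
  "schubert_class k n \<mu> = qh_class k n (schubert_poly k \<mu>)"

definition schubert_sum :: "nat \<Rightarrow> nat \<Rightarrow> cpoly set" where
  "schubert_sum k n =
     (\<Oplus>\<^bsub>qh_ring k n\<^esub>\<mu> \<in> young_diagrams k (n - k). schubert_class k n \<mu>)"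

definition small_diagrams :: "nat \<Rightarrow> nat \<Rightarrow> nat list set" where
  "small_diagrams k l =
     {\<mu> \<in> young_diagrams k l. card {i. i < l \<and> \<mu> ! i \<noteq> 0} \<le> l div 2 \<and> \<mu> ! 0 \<le> k div 2}"

section \<open>Annihilators and complex vector spaces\<close>

definition annihilator :: "('a, 'b) ring_scheme \<Rightarrow> 'a \<Rightarrow> 'a set" where
  "annihilator R x = {a \<in> carrier R. a \<otimes>\<^bsub>R\<^esub> x = \<zero>\<^bsub>R\<^esub>}"

text \<open>A ring \<open>R\<close> with structure map \<open>\<iota> : \<complex> \<rightarrow> R\<close>, regarded as a complex vector space.\<close>

definition scalar_space :: "'a ring \<Rightarrow> (complex \<Rightarrow> 'a) \<Rightarrow> (complex, 'a) module" where
  "scalar_space R \<iota> =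
     \<lparr>carrier = carrier R, mult = monoid.mult R, one = one R, zero = zero R, add = add R,
      smult = (\<lambda>c x. \<iota> c \<otimes>\<^bsub>R\<^esub> x)\<rparr>"

definition qh_space :: "nat \<Rightarrow> nat \<Rightarrow> (complex, cpoly set) module" where
  "qh_space k n = scalar_space (qh_ring k n) (\<lambda>c. qh_class k n (const_poly c))"

definition qh_quot_space :: "nat \<Rightarrow> nat \<Rightarrow> cpoly set set \<Rightarrow> (complex, cpoly set set) module" where
  "qh_quot_space k n I =
     scalar_space (qh_ring k n Quot I)
       (\<lambda>c. I +>\<^bsub>qh_ring k n\<^esub> qh_class k n (const_poly c))"

definition G_S :: "nat \<Rightarrow> nat \<Rightarrow> cpoly set set" where
  "G_S k n =
     LinearCombinations.module.span class_ring (qh_space k n)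
       (schubert_class k n ` small_diagrams k (n - k))"

definition vs_isomorphic ::
    "('k, 'c) ring_scheme \<Rightarrow> ('k, 'a, 'd) module_scheme \<Rightarrow> ('k, 'b, 'e) module_scheme \<Rightarrow> bool"
  where
  "vs_isomorphic K V W \<longleftrightarrow>
     (\<exists>T. linear_map K V W T \<and> bij_betw T (carrier V) (carrier W))"

end

theory Submission
  imports Defs
begin

text \<open>
  The ring \<open>R\<close> is a ring of functions on a finite set of points, and both claims are read off from
  the values of \<open>P\<close> at these points.

  \<^bold>\<open>The points.\<close> Write \<open>\<sigma>\<^sub>i\<close> as the elementary symmetric functions of \<open>k\<close> variables; then \<open>Y\<^sub>r\<close> is the
  complete homogeneous function, and the relations say that \<open>f = \<Sum> (-1)\<^sup>i \<sigma>\<^sub>i t\<^sup>i\<close> and \<open>g = \<Sum> Y\<^sub>i t\<^sup>i\<close>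
  (summed up to \<open>k\<close> and \<open>l\<close>) satisfy \<open>f g = 1 - c t\<^sup>n\<close> with \<open>c = (-1)\<^sup>k\<^sup>+\<^sup>1\<close>. The right-hand side is separable. For
  a root \<open>x\<close> of \<open>x\<^sup>n = c\<close> the product \<open>f(1/x) g(1/x)\<close> is therefore \<open>0\<close>, while its two factors generate the
  unit ideal, because the derivative of \<open>1 - c t\<^sup>n\<close> is a unit at \<open>1/x\<close>. Splitting \<open>R\<close> at every root
  distributes the roots between \<open>f\<close> and \<open>g\<close>, and only the distributions that give \<open>k\<close> roots \<open>I\<close> to \<open>f\<close>
  survive; on that piece \<open>\<sigma>\<^sub>i\<close> is the constant \<open>e\<^sub>i(I)\<close>. So a polynomial lies in the defining ideal iff it
  vanishes at all \<open>k\<close>-subsets \<open>I\<close> of the roots (\<open>qh_ideal_mem_iff\<close>).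

  \<^bold>\<open>The Schubert classes.\<close> If \<open>ys\<close> lists the negatives of the \<open>l\<close> roots outside \<open>I\<close>, then \<open>e\<^sub>i(I)\<close> is the
  complete homogeneous function of \<open>ys\<close> for \<open>i < n\<close>. The determinant of a diagram is thus the Schur function of
  \<open>ys\<close>, that is, an alternant divided by a nonzero factor that is the same for all diagrams (\<open>jacobi_trudi\<close>).
  Alternants with different exponent sets below \<open>n\<close> are linearly independent as functions on lists of
  roots, hence so are the Schubert classes (\<open>schubert_independent\<close>).

  \<^bold>\<open>The values of \<open>P\<close>.\<close> Up to the nonzero factor, \<open>P(I)\<close> is the sum of all alternants with exponents below \<open>n\<close>. For
  an even number of variables this sum is a Pfaffian in the numbers \<open>\<Sum> sgn(a - b) y\<^sup>a z\<^sup>b\<close>, which vanish at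
  the roots in question unless \<open>y z = 1\<close>; an odd number of variables reduces to an even one by splitting off
  the variable \<open>1\<close>. It follows that \<open>P(I) \<noteq> 0\<close> iff \<open>I\<close> is closed under inversion and does not contain \<open>-1\<close>
  (\<open>ev_schubert_sum_nonzero_iff\<close>). Reversing the coefficients of \<open>\<Prod> (1 - x t)\<close> inverts the roots, so the same
  condition says that \<open>e\<^sub>k\<^sub>-\<^sub>i(I) = e\<^sub>i(I)\<close> for all \<open>i\<close> (\<open>palindromic_iff\<close>).

  \<^bold>\<open>Conclusion.\<close> The annihilator of \<open>P\<close> consists of the functions that vanish on these symmetric points, and so does
  the ideal of the \<open>\<sigma>\<^sub>k\<^sub>-\<^sub>i - \<sigma>\<^sub>i\<close>, since an ideal in a ring of functions on finitely many points is determined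
  by its common zeros. The quotient is the space of functions on the symmetric points. A symmetric
  point amounts to a choice of \<open>[k/2]\<close> among the \<open>[k/2] + [l/2]\<close> roots in the open upper half plane, and
  there are as many small diagrams (\<open>card_sym_points_small\<close>), which index a basis of \<open>G\<^sub>S\<close>.
\<close>

section \<open>Alternants and their sum over a box\<close>

definition del_nth :: "nat \<Rightarrow> 'a list \<Rightarrow> 'a list" where
  "del_nth j xs = take j xs @ drop (Suc j) xs"

lemma del_nth_Cons [simp]:
  "del_nth 0 (x # xs) = xs" "del_nth (Suc j) (x # xs) = x # del_nth j xs"
  by (simp_all add: del_nth_def)

lemma length_del_nth [simp]: "j < length xs \<Longrightarrow> length (del_nth j xs) = length xs - 1"
  by (simp add: del_nth_def)

lemma set_del_nth: "distinct xs \<Longrightarrow> j < length xs \<Longrightarrow> set (del_nth j xs) = set xs - {xs ! j}"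
proof (induction xs arbitrary: j)
  case (Cons x xs)
  thus ?case by (cases j) auto
qed auto

lemma distinct_del_nth: "distinct xs \<Longrightarrow> distinct (del_nth j xs)"
  unfolding del_nth_def by (auto simp: set_take_disj_set_drop_if_distinct)

lemma nth_del_nth:
  "i < length xs - 1 \<Longrightarrow> j < length xs \<Longrightarrow> del_nth j xs ! i = xs ! (if i < j then i else Suc i)"
  by (auto simp: del_nth_def nth_append)

definition rank_above :: "nat set \<Rightarrow> nat \<Rightarrow> nat" where
  "rank_above A a = card {b \<in> A. a < b}"

lemma rank_above_insert: "finite A \<Longrightarrow> b \<notin> A \<Longrightarrow> rank_above (insert b A) a = rank_above A a + of_bool (a < b)"
proof -
  assume A: "finite A" "b \<notin> A"
  have "{c \<in> insert b A. a < c} = (if a < b then insert b {c \<in> A. a < c} else {c \<in> A. a < c})"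
    by auto
  thus ?thesis using A by (simp add: rank_above_def)
qed

lemma rank_above_remove: "finite A \<Longrightarrow> b \<in> A \<Longrightarrow> rank_above A a = rank_above (A - {b}) a + of_bool (a < b)"
  using rank_above_insert[of "A - {b}" b a] by (simp add: insert_absorb)

text \<open>
  The determinant \<open>det (y\<^sub>j\<^sup>a)\<close> with one row for each exponent \<open>a \<in> A\<close>, in decreasing order, and one column for each
  variable. It is defined by Laplace expansion along the first column, in which the row of \<open>a\<close> has
  position \<open>rank_above A a\<close>; in this form inductions over the list of variables need no matrices.
\<close>

primrec alternant :: "'a :: comm_ring_1 list \<Rightarrow> nat set \<Rightarrow> 'a" where
  "alternant [] A = 1"
| "alternant (y # ys) A = (\<Sum>a\<in>A. (-1) ^ rank_above A a * y ^ a * alternant ys (A - {a}))"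

text \<open>
  The left-hand side is the Laplace expansion of the determinant with a row of exponent \<open>b\<close> placed
  above the rows of \<open>C\<close>. If \<open>b\<close> repeats an exponent of \<open>C\<close> two rows agree; otherwise moving the new row to
  its place passes the \<open>rank_above C b\<close> rows above that place.
\<close>

lemma alternant_insert_exponent:
  fixes ys :: "'a :: comm_ring_1 list"
  assumes "finite C" "length ys = Suc (card C)"
  shows "(\<Sum>j<length ys. (-1) ^ j * (ys ! j) ^ b * alternant (del_nth j ys) C)
           = (if b \<in> C then 0 else (-1) ^ rank_above C b * alternant ys (insert b C))"
  using assms
proof (induction ys arbitrary: C)
  case (Cons z zs)
  have fin: "finite C" by fact
  let ?S = "\<lambda>a. (-1) ^ rank_above C a * z ^ a *
      (if b \<in> C - {a} then 0 else (-1) ^ rank_above (C - {a}) b * alternant zs (insert b (C - {a})))"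
  have IH: "(\<Sum>j<length zs. (-1) ^ j * (zs ! j) ^ b * alternant (del_nth j zs) (C - {a}))
      = (if b \<in> C - {a} then 0 else (-1) ^ rank_above (C - {a}) b * alternant zs (insert b (C - {a})))"
    if "a \<in> C" for a
    using Cons.prems that by (intro Cons.IH) (auto simp: card_Suc_Diff1 simp del: card_Diff_insert)
  have "(\<Sum>j<length (z # zs). (-1) ^ j * ((z # zs) ! j) ^ b * alternant (del_nth j (z # zs)) C)
      = z ^ b * alternant zs C
        - (\<Sum>j<length zs. (-1) ^ j * (zs ! j) ^ b * alternant (z # del_nth j zs) C)"
    unfolding length_Cons by (subst sum.lessThan_Suc_shift) (simp add: sum_negf del: alternant.simps sum.lessThan_Suc)
  also have "(\<Sum>j<length zs. (-1) ^ j * (zs ! j) ^ b * alternant (z # del_nth j zs) C)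
      = (\<Sum>a\<in>C. (-1) ^ rank_above C a * z ^ a *
          (\<Sum>j<length zs. (-1) ^ j * (zs ! j) ^ b * alternant (del_nth j zs) (C - {a})))"
    by (simp add: sum_distrib_left, subst sum.swap) (simp add: mult_ac)
  also have "\<dots> = sum ?S C"
    by (intro sum.cong refl) (simp only: IH)
  finally have main: "(\<Sum>j<length (z # zs). (-1) ^ j * ((z # zs) ! j) ^ b
        * alternant (del_nth j (z # zs)) C) = z ^ b * alternant zs C - sum ?S C" .
  show ?case
  proof (cases "b \<in> C")
    case True
    have "sum ?S C = ?S b"
      using fin True by (subst sum.remove[of _ b]) (auto intro!: sum.neutral)
    also have "\<dots> = ((-1) ^ rank_above C b * (-1) ^ rank_above (C - {b}) b) * z ^ b * alternant zs C"
      using True by (simp add: insert_absorb)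
    also have "(-1) ^ rank_above C b * (-1) ^ rank_above (C - {b}) b = (1 :: 'a)"
      using rank_above_remove[OF fin True, of b] by (simp flip: power_add add: mult_2[symmetric])
    finally show ?thesis using True main by simp
  next
    case False
    have sgn: "(-1) ^ rank_above C b * (-1) ^ rank_above (insert b C) a
        = - ((-1) ^ rank_above C a * (-1) ^ rank_above (C - {a}) b :: 'a)" if "a \<in> C" for a
    proof -
      have "rank_above C b = rank_above (C - {a}) b + of_bool (b < a)"
        "rank_above (insert b C) a = rank_above C a + of_bool (a < b)" "a \<noteq> b"
        using rank_above_remove[OF fin that, of b] rank_above_insert[OF fin False, of a] False that by auto
      thus ?thesis by (auto simp: power_add)
    qed
    have "(-1) ^ rank_above C b * alternant (z # zs) (insert b C)
       = (\<Sum>a\<in>insert b C. ((-1) ^ rank_above C b * (-1) ^ rank_above (insert b C) a) * z ^ a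
            * alternant zs (insert b C - {a}))"
      by (simp add: sum_distrib_left mult_ac del: sum.insert)
    also have "\<dots> = z ^ b * alternant zs C
        + (\<Sum>a\<in>C. ((-1) ^ rank_above C b * (-1) ^ rank_above (insert b C) a) * z ^ a
            * alternant zs (insert b C - {a}))"
    proof -
      have "rank_above (insert b C) b = rank_above C b" using rank_above_insert[OF fin False, of b] by simp
      moreover have "insert b C - {b} = C" using False by auto
      ultimately show ?thesis
        using fin False by (simp flip: power_add add: mult_2[symmetric])
    qed
    also have "(\<Sum>a\<in>C. ((-1) ^ rank_above C b * (-1) ^ rank_above (insert b C) a) * z ^ a
            * alternant zs (insert b C - {a})) = (\<Sum>a\<in>C. - ?S a)"
    proof (intro sum.cong refl)
      fix a assume a: "a \<in> C"
      hence "insert b C - {a} = insert b (C - {a})" using False by auto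
      thus "((-1) ^ rank_above C b * (-1) ^ rank_above (insert b C) a) * z ^ a * alternant zs (insert b C - {a})
          = - ?S a"
        unfolding sgn[OF a] using False by (simp add: mult_ac)
    qed
    finally show ?thesis using False main by (simp add: sum_negf)
  qed
qed simp

definition alternant_sum :: "nat \<Rightarrow> 'a :: comm_ring_1 list \<Rightarrow> 'a" where
  "alternant_sum n ys = (\<Sum>A | A \<subseteq> {..<n} \<and> card A = length ys. alternant ys A)"

lemma sum_insert_reindex:
  fixes f :: "nat set \<Rightarrow> nat \<Rightarrow> 'b :: comm_monoid_add"
  shows "(\<Sum>B | B \<subseteq> {..<n} \<and> card B = Suc m. \<Sum>b\<in>B. f B b)
       = (\<Sum>C | C \<subseteq> {..<n} \<and> card C = m. \<Sum>b\<in>{..<n} - C. f (insert b C) b)"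
proof -
  have fin: "finite {C. C \<subseteq> {..<n} \<and> card C = m}" for m
    by (rule finite_subset[of _ "Pow {..<n}"]) auto
  have finB: "finite B" if "B \<subseteq> {..<n}" for B using that finite_subset by blast
  have "(\<Sum>B | B \<subseteq> {..<n} \<and> card B = Suc m. \<Sum>b\<in>B. f B b)
      = (\<Sum>(B,b)\<in>(SIGMA B:{B. B \<subseteq> {..<n} \<and> card B = Suc m}. B). f B b)"
    by (rule sum.Sigma) (use fin finB in auto)
  also have "\<dots> = (\<Sum>(C,b)\<in>(SIGMA C:{C. C \<subseteq> {..<n} \<and> card C = m}. {..<n} - C). f (insert b C) b)"
    by (rule sum.reindex_bij_witness[where j = "\<lambda>(B,b). (B - {b}, b)"
          and i = "\<lambda>(C,b). (insert b C, b)"])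
       (auto simp: insert_absorb finB)
  also have "\<dots> = (\<Sum>C | C \<subseteq> {..<n} \<and> card C = m. \<Sum>b\<in>{..<n} - C. f (insert b C) b)"
    by (rule sum.Sigma[symmetric]) (use fin in auto)
  finally show ?thesis .
qed

text \<open>
  Both sides are sums over an exponent \<open>b\<close> and a set \<open>C\<close> of further exponents. The pairs with \<open>b \<in> C\<close> cancel
  by the expansion along a row of exponent \<open>b\<close>, and the remaining ones are the pairs of a set \<open>B\<close> with an element \<open>b\<close> of it.
\<close>

lemma alternant_sum_contract:
  fixes ys :: "'a :: comm_ring_1 list"
  assumes "length ys = Suc m"
  shows "(\<Sum>j<length ys. (-1) ^ j * (\<Sum>b<n. u b * (ys ! j) ^ b) * alternant_sum n (del_nth j ys))
       = (\<Sum>B | B \<subseteq> {..<n} \<and> card B = Suc m. (\<Sum>b\<in>B. u b * (-1) ^ rank_above B b) * alternant ys B)"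
proof -
  have finB: "finite B" if "B \<subseteq> {..<n}" for B using that finite_subset by blast
  have "(\<Sum>j<length ys. (-1) ^ j * (\<Sum>b<n. u b * (ys ! j) ^ b) * alternant_sum n (del_nth j ys))
      = (\<Sum>j<length ys. \<Sum>C | C \<subseteq> {..<n} \<and> card C = m. \<Sum>b<n.
            u b * ((-1) ^ j * (ys ! j) ^ b * alternant (del_nth j ys) C))"
  proof (intro sum.cong refl)
    fix j assume "j \<in> {..<length ys}"
    hence "length (del_nth j ys) = m" using assms by simp
    hence "(-1) ^ j * (\<Sum>b<n. u b * (ys ! j) ^ b) * alternant_sum n (del_nth j ys)
        = (\<Sum>b<n. u b * ((-1) ^ j * (ys ! j) ^ b)) * (\<Sum>C | C \<subseteq> {..<n} \<and> card C = m. alternant (del_nth j ys) C)"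
      by (simp add: alternant_sum_def sum_distrib_left mult_ac)
    also have "\<dots> = (\<Sum>C | C \<subseteq> {..<n} \<and> card C = m. \<Sum>b<n.
            u b * ((-1) ^ j * (ys ! j) ^ b * alternant (del_nth j ys) C))"
      unfolding sum_product by (subst sum.swap) (simp add: mult_ac)
    finally show "(-1) ^ j * (\<Sum>b<n. u b * (ys ! j) ^ b) * alternant_sum n (del_nth j ys)
        = (\<Sum>C | C \<subseteq> {..<n} \<and> card C = m. \<Sum>b<n.
            u b * ((-1) ^ j * (ys ! j) ^ b * alternant (del_nth j ys) C))" .
  qed
  also have "\<dots> = (\<Sum>C | C \<subseteq> {..<n} \<and> card C = m. \<Sum>b<n. 
            u b * (\<Sum>j<length ys. ((-1) ^ j * (ys ! j) ^ b * alternant (del_nth j ys) C)))"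
  proof (subst sum.swap, rule sum.cong[OF refl])
    fix C
    show "(\<Sum>j<length ys. \<Sum>b<n. u b * ((-1) ^ j * (ys ! j) ^ b * alternant (del_nth j ys) C))
        = (\<Sum>b<n. u b * (\<Sum>j<length ys. (-1) ^ j * (ys ! j) ^ b * alternant (del_nth j ys) C))"
      unfolding sum_distrib_left by (rule sum.swap)
  qed
  also have "\<dots> = (\<Sum>C | C \<subseteq> {..<n} \<and> card C = m. \<Sum>b<n. 
            u b * (if b \<in> C then 0 else (-1) ^ rank_above C b * alternant ys (insert b C)))"
    using assms by (intro sum.cong refl, subst alternant_insert_exponent) (auto simp: finB)
  also have "\<dots> = (\<Sum>C | C \<subseteq> {..<n} \<and> card C = m. \<Sum>b\<in>{..<n} - C. 
            u b * (-1) ^ rank_above (insert b C) b * alternant ys (insert b C))"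
  proof (rule sum.cong[OF refl], rule sum.mono_neutral_cong_right)
    fix C b assume "C \<in> {C. C \<subseteq> {..<n} \<and> card C = m}" "b \<in> {..<n} - C"
    thus "u b * (if b \<in> C then 0 else (-1) ^ rank_above C b * alternant ys (insert b C)) =
           u b * (-1) ^ rank_above (insert b C) b * alternant ys (insert b C)"
      using rank_above_insert[of C b b] finB by auto
  qed auto
  also have "\<dots> = (\<Sum>B | B \<subseteq> {..<n} \<and> card B = Suc m. \<Sum>b\<in>B. u b * (-1) ^ rank_above B b * alternant ys B)"
    by (rule sum_insert_reindex[symmetric])
  finally show ?thesis by (simp add: sum_distrib_right)
qed

lemma sum_above:
  assumes "finite B"
  shows "(\<Sum>b\<in>B. (-1) ^ rank_above B b) = (of_bool (odd (card B)) :: 'a :: comm_ring_1)"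
  using assms
proof (induction B rule: finite_linorder_min_induct)
  case (insert b A)
  have "rank_above (insert b A) a = rank_above A a" if "a \<in> A" for a
    using insert that rank_above_insert[of A b a] by fastforce
  moreover have "rank_above (insert b A) b = card A"
    using insert rank_above_insert[of A b b] by (fastforce simp: rank_above_def intro!: arg_cong[of _ _ card])
  moreover have "b \<notin> A" using insert by auto
  ultimately show ?case using insert by auto
qed simp

text \<open>
  Along \<open>B\<close> the signs alternate, and the factor \<open>sgn (a - b)\<close> changes sign where \<open>a\<close> would be inserted. Each of
  the two alternating sums is \<open>0\<close> or \<open>\<plusminus>1\<close> according to the parity of its length, and the lengths add up to
  an odd number if \<open>a \<notin> B\<close> and to an even number otherwise.
\<close>

lemma sum_sgn_above:
  assumes "finite B" "odd (card B)"
  shows "(\<Sum>b\<in>B. (of_int (sgn (int a - int b)) :: 'a :: comm_ring_1) * (-1) ^ rank_above B b)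
      = (if a \<in> B then 0 else (-1) ^ rank_above B a)"
proof -
  define L U where "L = {b \<in> B. b < a}" and "U = {b \<in> B. a < b}"
  have fin: "finite L" "finite U" using assms by (auto simp: L_def U_def)
  have split: "(\<Sum>b\<in>B. (of_int (sgn (int a - int b)) :: 'a) * (-1) ^ rank_above B b)
     = (\<Sum>b\<in>L. (-1) ^ rank_above B b) - (\<Sum>b\<in>U. (-1) ^ rank_above B b)"
  proof -
    have "(\<Sum>b\<in>B. (of_int (sgn (int a - int b)) :: 'a) * (-1) ^ rank_above B b)
       = (\<Sum>b\<in>L \<union> U. (of_int (sgn (int a - int b)) :: 'a) * (-1) ^ rank_above B b)"
      using assms by (intro sum.mono_neutral_right) (auto simp: L_def U_def sgn_if)
    also have "\<dots> = (\<Sum>b\<in>L. (of_int (sgn (int a - int b)) :: 'a) * (-1) ^ rank_above B b)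
                 + (\<Sum>b\<in>U. (of_int (sgn (int a - int b)) :: 'a) * (-1) ^ rank_above B b)"
      using fin by (intro sum.union_disjoint) (auto simp: L_def U_def)
    also have "(\<Sum>b\<in>L. (of_int (sgn (int a - int b)) :: 'a) * (-1) ^ rank_above B b) = (\<Sum>b\<in>L. (-1) ^ rank_above B b)"
      by (intro sum.cong) (auto simp: L_def sgn_if)
    also have "(\<Sum>b\<in>U. (of_int (sgn (int a - int b)) :: 'a) * (-1) ^ rank_above B b) = (\<Sum>b\<in>U. - ((-1) ^ rank_above B b))"
      by (intro sum.cong) (auto simp: U_def sgn_if)
    finally show ?thesis by (simp add: sum_negf)
  qed
  have U: "rank_above B b = rank_above U b" if "b \<in> U" for b
    using that unfolding rank_above_def U_def by (intro arg_cong[of _ _ card]) auto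
  \<comment> \<open>Every element of the upper part and possibly \<open>a\<close> itself lie above \<open>b\<close>.\<close>
  have L: "rank_above B b = rank_above L b + (card U + of_bool (a \<in> B))" if "b \<in> L" for b
  proof -
    have "{c \<in> B. b < c} = {c \<in> L. b < c} \<union> (U \<union> (if a \<in> B then {a} else {}))"
      using that by (auto simp: L_def U_def) (metis linorder_neqE_nat)+
    also have "card \<dots> = rank_above L b + card (U \<union> (if a \<in> B then {a} else {}))"
      unfolding rank_above_def using fin by (intro card_Un_disjoint) (auto simp: L_def U_def)
    also have "card (U \<union> (if a \<in> B then {a} else {})) = card U + of_bool (a \<in> B)"
      using fin by (auto simp: U_def)
    finally show ?thesis by (simp add: rank_above_def)
  qed
  have "B = (L \<union> U) \<union> (if a \<in> B then {a} else {})" by (auto simp: L_def U_def) (metis linorder_neqE_nat)+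
  hence "card B = card ((L \<union> U) \<union> (if a \<in> B then {a} else {}))" by simp
  also have "\<dots> = card (L \<union> U) + of_bool (a \<in> B)"
    using fin by (auto simp: L_def U_def)
  also have "card (L \<union> U) = card L + card U"
    using fin by (intro card_Un_disjoint) (auto simp: L_def U_def)
  finally have cB: "card B = card L + card U + of_bool (a \<in> B)" .
  have sU: "(\<Sum>b\<in>U. (-1) ^ rank_above B b) = (of_bool (odd (card U)) :: 'a)"
    using sum_above[OF fin(2)] by (simp add: U)
  have sL: "(\<Sum>b\<in>L. (-1) ^ rank_above B b) = (-1) ^ (card U + of_bool (a \<in> B)) * (of_bool (odd (card L)) :: 'a)"
    using sum_above[OF fin(1), where ?'a = 'a] 
    by (simp add: L power_add flip: sum_distrib_right)
  have "rank_above B a = card U" by (simp add: rank_above_def U_def)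
  thus ?thesis unfolding split sU sL using cB assms(2) by (cases "a \<in> B"; cases "odd (card U)") auto
qed

text \<open>
  The expansion of a Pfaffian bordered by the row of the numbers \<open>\<Sum> z\<^sup>b\<close>: an odd number of variables is
  reduced by one.
\<close>

lemma alternant_sum_odd:
  fixes ys :: "'a :: comm_ring_1 list"
  assumes "odd (length ys)"
  shows "alternant_sum n ys
      = (\<Sum>j<length ys. (-1) ^ j * (\<Sum>b<n. (ys ! j) ^ b) * alternant_sum n (del_nth j ys))"
proof -
  obtain m where m: "length ys = Suc m" using assms by (cases "length ys") auto
  have finB: "finite B" if "B \<subseteq> {..<n}" for B using that finite_subset by blast
  show ?thesis
    using alternant_sum_contract[OF m, where n = n and u = "\<lambda>_. 1"] assms m finB
    by (simp add: alternant_sum_def sum_above)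
qed

text \<open>
  The expansion along the first row of the Pfaffian of the skew-symmetric matrix with entries
  \<open>\<Sum> sgn (a - b) y\<^sup>a z\<^sup>b\<close>. Only this recursion is used, so Pfaffians themselves are not introduced.
\<close>

lemma alternant_sum_even:
  fixes y :: "'a :: comm_ring_1"
  assumes "odd (length ys)"
  shows "alternant_sum n (y # ys)
      = (\<Sum>j<length ys. (-1) ^ j * (\<Sum>b<n. (\<Sum>a<n. of_int (sgn (int a - int b)) * y ^ a) * (ys ! j) ^ b)
            * alternant_sum n (del_nth j ys))"
proof -
  obtain m where m: "length ys = Suc m" using assms by (cases "length ys") auto
  have finB: "finite B" if "B \<subseteq> {..<n}" for B using that finite_subset by blast
  have "(\<Sum>j<length ys. (-1) ^ j * (\<Sum>b<n. (\<Sum>a<n. of_int (sgn (int a - int b)) * y ^ a) * (ys ! j) ^ b)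
            * alternant_sum n (del_nth j ys))
     = (\<Sum>B | B \<subseteq> {..<n} \<and> card B = Suc m.
          (\<Sum>b\<in>B. (\<Sum>a<n. of_int (sgn (int a - int b)) * y ^ a) * (-1) ^ rank_above B b) * alternant ys B)"
    by (rule alternant_sum_contract[OF m])
  also have "\<dots> = (\<Sum>B | B \<subseteq> {..<n} \<and> card B = Suc m.
          (\<Sum>a<n. y ^ a * (\<Sum>b\<in>B. of_int (sgn (int a - int b)) * (-1) ^ rank_above B b)) * alternant ys B)"
  proof (rule sum.cong[OF refl], rule arg_cong2[where f = "(*)", OF _ refl])
    fix B
    show "(\<Sum>b\<in>B. (\<Sum>a<n. of_int (sgn (int a - int b)) * y ^ a) * (-1) ^ rank_above B b)
        = (\<Sum>a<n. y ^ a * (\<Sum>b\<in>B. of_int (sgn (int a - int b)) * (-1) ^ rank_above B b))"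
      unfolding sum_distrib_left sum_distrib_right by (subst sum.swap) (simp add: mult_ac)
  qed
  also have "\<dots> = (\<Sum>B | B \<subseteq> {..<n} \<and> card B = Suc m.
          (\<Sum>a<n. y ^ a * (if a \<in> B then 0 else (-1) ^ rank_above B a)) * alternant ys B)"
    using assms m finB by (intro sum.cong refl, subst sum_sgn_above) auto
  also have "\<dots> = (\<Sum>B | B \<subseteq> {..<n} \<and> card B = Suc m. \<Sum>a\<in>{..<n} - B.
          (-1) ^ rank_above (insert a B) a * y ^ a * alternant ys (insert a B - {a}))"
  proof (intro sum.cong refl, subst sum_distrib_right, intro sum.mono_neutral_cong_right)
    fix B a assume *: "B \<in> {B. B \<subseteq> {..<n} \<and> card B = Suc m}" "a \<in> {..<n} - B"
    hence "insert a B - {a} = B" by auto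
    thus "y ^ a * (if a \<in> B then 0 else (-1) ^ rank_above B a) * alternant ys B =
          (-1) ^ rank_above (insert a B) a * y ^ a * alternant ys (insert a B - {a})"
      using rank_above_insert[of B a a] finB * by (auto simp: mult_ac)
  qed auto
  also have "\<dots> = (\<Sum>B | B \<subseteq> {..<n} \<and> card B = Suc (Suc m). \<Sum>a\<in>B.
          (-1) ^ rank_above B a * y ^ a * alternant ys (B - {a}))"
    by (rule sum_insert_reindex[symmetric])
  also have "\<dots> = alternant_sum n (y # ys)" using m by (simp add: alternant_sum_def)
  finally show ?thesis ..
qed

section \<open>Vanishing of the sum of alternants at roots of unity\<close>

text \<open>
  The entry of the skew-symmetric matrix for two roots \<open>y\<close>, \<open>z\<close> of \<open>\<pm>1\<close>. The inner sum is a combination of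
  \<open>1 + d\<close> and \<open>y\<^sup>b\<close>. The constant contributes \<open>(1 + d) \<Sum> z\<^sup>b = (1 + d) (d - 1) / (z - 1) = 0\<close>, and the power contributes
  the geometric sum of \<open>y z\<close>, an \<open>n\<close>-th root of unity.
\<close>

lemma sgn_kernel:
  fixes y z d :: complex
  assumes "y ^ n = d" "z ^ n = d" "d ^ 2 = 1" "y \<noteq> 1" "z \<noteq> 1"
  shows "(\<Sum>b<n. (\<Sum>a<n. of_int (sgn (int a - int b)) * y ^ a) * z ^ b)
       = (if y * z = 1 then of_nat n * (1 + y) / (1 - y) else 0)"
proof -
  have geo: "(\<Sum>a<m. x ^ a) = (x ^ m - 1) / (x - 1)" if "x \<noteq> 1" for x :: complex and m
    using that by (simp add: geometric_sum)
  have inner: "(\<Sum>a<n. of_int (sgn (int a - int b)) * y ^ a) = (1 + d - y ^ b * (1 + y)) / (y - 1)"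
    if "b < n" for b
  proof -
    have "{..<n} = {..<b} \<union> ({b} \<union> {Suc b..<n})" using that by auto
    hence "(\<Sum>a<n. of_int (sgn (int a - int b)) * y ^ a)
       = (\<Sum>a\<in>{..<b} \<union> ({b} \<union> {Suc b..<n}). of_int (sgn (int a - int b)) * y ^ a)" by simp
    also have "\<dots> = (\<Sum>a<b. of_int (sgn (int a - int b)) * y ^ a)
        + (\<Sum>a=Suc b..<n. of_int (sgn (int a - int b)) * y ^ a)"
      by (subst sum.union_disjoint) auto
    also have "(\<Sum>a<b. of_int (sgn (int a - int b)) * y ^ a) = - (\<Sum>a<b. y ^ a)"
      by (simp add: sgn_if flip: sum_negf)
    also have "(\<Sum>a=Suc b..<n. of_int (sgn (int a - int b)) * y ^ a) = (\<Sum>a=Suc b..<n. y ^ a)"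
      by (intro sum.cong) (auto simp: sgn_if)
    also have "\<dots> = (\<Sum>a<n. y ^ a) - (\<Sum>a<Suc b. y ^ a)"
      using that by (simp add: sum_diff_nat_ivl[of 0 "Suc b" n, symmetric] lessThan_atLeast0 del: sum.lessThan_Suc)
    also have "- (\<Sum>a<b. y ^ a) + ((\<Sum>a<n. y ^ a) - (\<Sum>a<Suc b. y ^ a)) = (1 + d - y ^ b * (1 + y)) / (y - 1)"
      unfolding geo[OF assms(4)] assms(1) diff_divide_distrib[symmetric] minus_divide_left add_divide_distrib[symmetric]
      by (rule arg_cong2[where f = "(/)", OF _ refl]) (simp add: algebra_simps)
    finally show ?thesis .
  qed
  have "(\<Sum>b<n. (\<Sum>a<n. of_int (sgn (int a - int b)) * y ^ a) * z ^ b)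
      = (\<Sum>b<n. ((1 + d) * z ^ b - (1 + y) * (y * z) ^ b) / (y - 1))"
    using inner by (intro sum.cong) (auto simp: field_simps power_mult_distrib)
  also have "\<dots> = ((1 + d) * (\<Sum>b<n. z ^ b) - (1 + y) * (\<Sum>b<n. (y * z) ^ b)) / (y - 1)"
    by (simp add: sum_subtractf sum_distrib_left flip: sum_divide_distrib)
  also have "(1 + d) * (\<Sum>b<n. z ^ b) = 0"
    using assms by (simp add: geo field_simps power2_eq_square)
  also have "(\<Sum>b<n. (y * z) ^ b) = (if y * z = 1 then of_nat n else 0)"
  proof (cases "y * z = 1")
    case False
    have "(y * z) ^ n = 1" using assms by (simp add: power_mult_distrib power2_eq_square)
    thus ?thesis using geo[OF False, of n] False by simp
  qed simp
  finally show ?thesis using assms(4) by (auto simp: divide_simps) (simp add: algebra_simps)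
qed

text \<open>
  In the expansion along the first variable \<open>y\<close> only the term that pairs \<open>y\<close> with its inverse can survive,
  and its coefficient is zero exactly for \<open>y = -1\<close>. Deleting the pair leaves a list with the same
  closure property.
\<close>

lemma alternant_sum_nonzero_even:
  fixes ys :: "complex list"
  assumes "distinct ys" "\<forall>y\<in>set ys. y ^ n = d" "d ^ 2 = 1" "1 \<notin> set ys" "even (length ys)" "n > 0"
  shows "alternant_sum n ys \<noteq> 0 \<longleftrightarrow> (\<forall>y\<in>set ys. inverse y \<in> set ys) \<and> -1 \<notin> set ys"
  using assms(1,2,4,5)
proof (induction "length ys" arbitrary: ys rule: less_induct)
  case less
  show ?case
  proof (cases ys)
    case Nil
    have "{A. A \<subseteq> {..<n} \<and> A = {}} = {{}}" by auto
    moreover have "{A. A \<subseteq> {..<n} \<and> card A = 0} = {A. A \<subseteq> {..<n} \<and> A = {}}"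
      using finite_subset by fastforce
    ultimately show ?thesis using Nil by (simp add: alternant_sum_def)
  next
    case (Cons y zs)
    have odd: "odd (length zs)" using less.prems Cons by simp
    have y: "y ^ n = d" "y \<noteq> 1" "y \<noteq> 0" "y \<notin> set zs" "distinct zs"
      using less.prems Cons \<open>d ^ 2 = 1\<close> \<open>n > 0\<close> by (auto simp: zero_power)
    have zs: "z ^ n = d" "z \<noteq> 1" if "z \<in> set zs" for z
      using less.prems Cons that by auto
    have expand: "alternant_sum n ys = (\<Sum>j<length zs. (-1) ^ j *
        (if y * zs ! j = 1 then of_nat n * (1 + y) / (1 - y) else 0) * alternant_sum n (del_nth j zs))"
      unfolding Cons alternant_sum_even[OF odd]
      by (intro sum.cong refl, subst sgn_kernel) (use y zs \<open>d ^ 2 = 1\<close> in auto)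
    show ?thesis
    proof (cases "y \<noteq> -1 \<and> inverse y \<in> set zs")
      case False
      have "alternant_sum n ys = 0" unfolding expand
      proof (intro sum.neutral ballI)
        fix j assume "j \<in> {..<length zs}"
        hence "zs ! j \<in> set zs" by simp
        hence "y * zs ! j \<noteq> 1 \<or> y = -1" using False by (metis inverse_unique)
        thus "(-1) ^ j * (if y * zs ! j = 1 then of_nat n * (1 + y) / (1 - y) else 0)
            * alternant_sum n (del_nth j zs) = 0" by auto
      qed
      moreover have "\<not> ((\<forall>y\<in>set ys. inverse y \<in> set ys) \<and> -1 \<notin> set ys)"
      proof
        assume *: "(\<forall>y\<in>set ys. inverse y \<in> set ys) \<and> -1 \<notin> set ys"
        hence "inverse y = y" "y \<noteq> -1" using False Cons by auto
        hence "y * y = 1" using y(3) by (metis right_inverse)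
        hence "(y - 1) * (y + 1) = 0" by (simp add: algebra_simps)
        thus False using y(2) \<open>y \<noteq> -1\<close> by (auto simp: eq_neg_iff_add_eq_0)
      qed
      ultimately show ?thesis by simp
    next
      case True
      then obtain i where i: "i < length zs" "zs ! i = inverse y" by (auto simp: in_set_conv_nth)
      let ?us = "del_nth i zs"
      have us: "set ?us = set zs - {inverse y}" "distinct ?us" "length ?us = length zs - 1"
        using i y(5) by (simp_all add: set_del_nth distinct_del_nth)
      have "alternant_sum n ys = (-1) ^ i * (of_nat n * (1 + y) / (1 - y)) * alternant_sum n ?us"
      proof -
        have "y * zs ! j \<noteq> 1" if "j < length zs" "j \<noteq> i" for j
          using that i y(5) by (metis inverse_unique nth_eq_iff_index_eq)
        thus ?thesis unfolding expand using i y(3)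
          by (subst sum.remove[of _ i]) (auto intro!: sum.neutral)
      qed
      moreover have "1 + y \<noteq> 0" "1 - y \<noteq> 0" "(of_nat n :: complex) \<noteq> 0"
        using True y(2) \<open>n > 0\<close> by (auto simp: add_eq_0_iff)
      ultimately have "alternant_sum n ys \<noteq> 0 \<longleftrightarrow> alternant_sum n ?us \<noteq> 0" by simp
      also have "\<dots> \<longleftrightarrow> (\<forall>z\<in>set ?us. inverse z \<in> set ?us) \<and> -1 \<notin> set ?us"
        using us zs less.prems Cons by (intro less.hyps) auto
      also have "\<dots> \<longleftrightarrow> (\<forall>z\<in>set ys. inverse z \<in> set ys) \<and> -1 \<notin> set ys"
      proof -
        have "inverse y \<noteq> -1" using True by (metis inverse_inverse_eq inverse_minus_eq inverse_1)
        moreover have S: "set ys = insert y (insert (inverse y) (set ?us))" "y \<notin> set ?us" "inverse y \<notin> set ?us"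
          using us(1) y True Cons by auto
        ultimately have "-1 \<notin> set ys \<longleftrightarrow> -1 \<notin> set ?us" using True by auto
        moreover have "(\<forall>z\<in>set ys. inverse z \<in> set ys) \<longleftrightarrow> (\<forall>z\<in>set ?us. inverse z \<in> set ?us)" (is "?A \<longleftrightarrow> ?B")
        proof
          assume ?B
          thus ?A unfolding S(1) by simp
        next
          assume A: ?A
          show ?B
          proof
            fix z assume z: "z \<in> set ?us"
            hence "inverse z \<in> set ys" using A S(1) by blast
            moreover have "inverse z \<noteq> y" "inverse z \<noteq> inverse y" using z S by auto
            ultimately show "inverse z \<in> set ?us" unfolding S(1) by blast
          qed
        qed
        ultimately show ?thesis by blast
      qed
      finally show ?thesis .
    qed
  qed
qed

text \<open>
  The geometric sum of an \<open>n\<close>-th root of unity vanishes unless the root is \<open>1\<close>, so only the term that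
  deletes the variable \<open>1\<close> remains.
\<close>

lemma alternant_sum_nonzero_odd:
  fixes ys :: "complex list"
  assumes "distinct ys" "\<forall>y\<in>set ys. y ^ n = 1" "odd (length ys)" "n > 0"
  shows "alternant_sum n ys \<noteq> 0 \<longleftrightarrow> (\<forall>y\<in>set ys. inverse y \<in> set ys) \<and> -1 \<notin> set ys \<and> 1 \<in> set ys"
proof -
  have geo: "(\<Sum>b<n. z ^ b) = (if z = 1 then of_nat n else 0)" if "z \<in> set ys" for z
    using that assms by (simp add: geometric_sum)
  have expand: "alternant_sum n ys = (\<Sum>j<length ys. (-1) ^ j * (if ys ! j = 1 then of_nat n else 0)
      * alternant_sum n (del_nth j ys))"
    unfolding alternant_sum_odd[OF assms(3)] by (intro sum.cong refl, subst geo) auto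
  show ?thesis
  proof (cases "1 \<in> set ys")
    case False
    hence "alternant_sum n ys = 0" unfolding expand
      by (intro sum.neutral) (auto simp: in_set_conv_nth)
    thus ?thesis using False by simp
  next
    case True
    then obtain i where i: "i < length ys" "ys ! i = 1" by (auto simp: in_set_conv_nth)
    let ?us = "del_nth i ys"
    have us: "set ?us = set ys - {1}" "distinct ?us" "length ?us = length ys - 1"
      using i assms(1) by (simp_all add: set_del_nth distinct_del_nth)
    have "alternant_sum n ys = (-1) ^ i * of_nat n * alternant_sum n ?us"
    proof -
      have "ys ! j \<noteq> 1" if "j < length ys" "j \<noteq> i" for j
        using that i assms(1) by (metis nth_eq_iff_index_eq)
      thus ?thesis unfolding expand using i
        by (subst sum.remove[of _ i]) (auto intro!: sum.neutral)
    qed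
    hence "alternant_sum n ys \<noteq> 0 \<longleftrightarrow> alternant_sum n ?us \<noteq> 0" using \<open>n > 0\<close> by simp
    also have "\<dots> \<longleftrightarrow> (\<forall>z\<in>set ?us. inverse z \<in> set ?us) \<and> -1 \<notin> set ?us"
      using us assms by (intro alternant_sum_nonzero_even[where d = 1]) auto
    also have "\<dots> \<longleftrightarrow> (\<forall>z\<in>set ys. inverse z \<in> set ys) \<and> -1 \<notin> set ys \<and> 1 \<in> set ys"
      using us(1) True by auto
    finally show ?thesis .
  qed
qed

section \<open>Alternants as determinants and their independence\<close>

lemma rank_above_nth:
  assumes "sorted_wrt (>) as" "i < length as"
  shows "rank_above (set as) (as ! i) = i"
proof -
  have desc: "as ! b < as ! a" if "a < b" "b < length as" for a b
    using assms(1) that by (simp add: sorted_wrt_iff_nth_less)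
  have "{b \<in> set as. as ! i < b} = (!) as ` {..<i}"
  proof (intro equalityI subsetI)
    fix b assume "b \<in> {b \<in> set as. as ! i < b}"
    then obtain j where j: "j < length as" "b = as ! j" "as ! i < as ! j" by (auto simp: in_set_conv_nth)
    have "j < i"
    proof (rule ccontr)
      assume "\<not> j < i"
      hence "i = j \<or> i < j" by auto
      thus False using desc[of i j] j by auto
    qed
    thus "b \<in> (!) as ` {..<i}" using j by auto
  next
    fix b assume "b \<in> (!) as ` {..<i}"
    thus "b \<in> {b \<in> set as. as ! i < b}" using assms(2) desc by auto
  qed
  moreover have "inj_on ((!) as) {..<i}"
  proof (rule inj_onI)
    fix a b assume "a \<in> {..<i}" "b \<in> {..<i}" "as ! a = as ! b"
    thus "a = b" using desc[of a b] desc[of b a] assms(2) by (cases a b rule: linorder_cases) auto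
  qed
  ultimately show ?thesis by (simp add: rank_above_def card_image)
qed

lemma sorted_wrt_greater_distinct: "sorted_wrt (>) (as :: nat list) \<Longrightarrow> distinct as"
  by (induction as) auto

lemma sorted_wrt_del_nth: "sorted_wrt P as \<Longrightarrow> sorted_wrt P (del_nth i as)"
proof (induction as arbitrary: i)
  case (Cons a as)
  have "set (del_nth j as) \<subseteq> set as" for j
    by (auto simp: del_nth_def dest: in_set_takeD in_set_dropD)
  hence "\<forall>b\<in>set (del_nth j as). P a b" for j using Cons.prems by auto
  thus ?case using Cons by (cases i) auto
qed (simp add: del_nth_def)

text \<open>
  Laplace expansion along the first column, where deleting a row deletes an exponent.
\<close>

lemma alternant_eq_det:
  fixes ys :: "'a :: comm_ring_1 list"
  assumes "sorted_wrt (>) as" "length as = length ys"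
  shows "alternant ys (set as) = det (mat (length ys) (length ys) (\<lambda>(i, j). ys ! j ^ (as ! i)))"
  using assms
proof (induction ys arbitrary: as)
  case Nil
  thus ?case by (simp add: det_dim_zero)
next
  case (Cons y ys)
  let ?m = "Suc (length ys)"
  let ?M = "mat ?m ?m (\<lambda>(i, j). (y # ys) ! j ^ (as ! i))"
  have dist: "distinct as" using Cons.prems(1) by (rule sorted_wrt_greater_distinct)
  have len: "length as = ?m" using Cons.prems by simp
  have minor: "mat_delete ?M i 0 = mat (length ys) (length ys) (\<lambda>(a, j). ys ! j ^ (del_nth i as ! a))"
    if "i < ?m" for i
    using that len by (intro eq_matI) (auto simp: mat_delete_def nth_del_nth)
  have "det ?M = (\<Sum>i<?m. ?M $$ (i, 0) * cofactor ?M i 0)"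
    by (rule laplace_expansion_column) auto
  also have "\<dots> = (\<Sum>i<?m. (-1) ^ i * y ^ (as ! i) * alternant ys (set as - {as ! i}))"
  proof (intro sum.cong refl)
    fix i assume i: "i \<in> {..<?m}"
    have "alternant ys (set as - {as ! i}) = alternant ys (set (del_nth i as))"
      using i len dist by (subst set_del_nth) auto
    also have "\<dots> = det (mat_delete ?M i 0)"
      using i len Cons.prems by (subst minor) (auto intro!: Cons.IH sorted_wrt_del_nth)
    finally show "?M $$ (i, 0) * cofactor ?M i 0
        = (-1) ^ i * y ^ (as ! i) * alternant ys (set as - {as ! i})"
      using i by (simp add: cofactor_def)
  qed
  also have "\<dots> = (\<Sum>i<length as. (-1) ^ rank_above (set as) (as ! i) * y ^ (as ! i) * alternant ys (set as - {as ! i}))"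
    using rank_above_nth[OF Cons.prems(1)] len by (intro sum.cong) auto
  also have "\<dots> = (\<Sum>a\<in>set as. (-1) ^ rank_above (set as) a * y ^ a * alternant ys (set as - {a}))"
    by (rule sum.reindex_bij_betw[OF bij_betw_nth[OF dist refl refl]])
  finally show ?case by simp
qed

lemma alternant_repeated:
  fixes ys :: "'a :: comm_ring_1 list"
  assumes "finite A" "card A = length ys" "\<not> distinct ys"
  shows "alternant ys A = 0"
proof -
  define as where "as = rev (sorted_list_of_set A)"
  have as: "sorted_wrt (>) as" "set as = A" "length as = length ys"
    using assms(1,2) by (simp_all add: as_def sorted_wrt_rev)
  obtain i j where ij: "i < length ys" "j < length ys" "i \<noteq> j" "ys ! i = ys ! j"
    using assms(3) by (auto simp: distinct_conv_nth)
  let ?M = "mat (length ys) (length ys) (\<lambda>(i, j). ys ! j ^ (as ! i))"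
  have "col ?M i = col ?M j" using ij by (intro eq_vecI) auto
  hence "det ?M = 0" using ij by (intro det_identical_columns[of _ "length ys" i j]) auto
  thus ?thesis using alternant_eq_det[OF as(1,3)] as(2) by simp
qed

text \<open>
  With all variables but the first fixed, the combination is a polynomial of degree less than \<open>n\<close> with \<open>n\<close>
  zeros. Its coefficients are combinations of alternants in one variable less and vanish too.
\<close>

lemma alternant_coeffs_zero:
  fixes Om :: "'a :: idom set"
  assumes "finite Om" "card Om \<ge> n"
    and "\<And>ys. length ys = m \<Longrightarrow> set ys \<subseteq> Om \<Longrightarrow>
           (\<Sum>A | A \<subseteq> {..<n} \<and> card A = m. c A * alternant ys A) = 0"
    and "A \<subseteq> {..<n}" "card A = m"
  shows "c A = 0"
  using assms(3-5)
proof (induction m arbitrary: c A)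
  case 0
  have "{A. A \<subseteq> {..<n} \<and> card A = 0} = {{}}" using finite_subset by fastforce
  moreover have "A = {}" using 0 finite_subset by fastforce
  ultimately show ?case using "0.prems"(1)[of "[]"] by simp
next
  case (Suc m)
  have finB: "finite B" if "B \<subseteq> {..<n}" for B using that finite_subset by blast
  \<comment> \<open>The coefficients of the combination of alternants that is the coefficient of \<open>y\<^sup>b\<close>.\<close>
  define c' where "c' b C = (if b \<in> C then 0 else c (insert b C) * (-1) ^ rank_above (insert b C) b)" for b C
  have c': "(\<Sum>C | C \<subseteq> {..<n} \<and> card C = m. c' b C * alternant ys C) = 0"
    if ys: "length ys = m" "set ys \<subseteq> Om" and b: "b < n" for b ys
  proof -
    define w where "w b = (\<Sum>C | C \<subseteq> {..<n} \<and> card C = m. c' b C * alternant ys C)" for b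
    define p where "p = (\<Sum>b<n. monom (w b) b)"
    have zero: "poly p y = 0" if "y \<in> Om" for y
    proof -
      have "0 = (\<Sum>A | A \<subseteq> {..<n} \<and> card A = Suc m. c A * alternant (y # ys) A)"
        using Suc.prems(1)[of "y # ys"] that ys by simp
      also have "\<dots> = (\<Sum>A | A \<subseteq> {..<n} \<and> card A = Suc m. \<Sum>a\<in>A.
          c A * ((-1) ^ rank_above A a * y ^ a * alternant ys (A - {a})))"
        by (simp add: sum_distrib_left)
      also have "\<dots> = (\<Sum>C | C \<subseteq> {..<n} \<and> card C = m. \<Sum>b\<in>{..<n} - C.
          c (insert b C) * ((-1) ^ rank_above (insert b C) b * y ^ b * alternant ys (insert b C - {b})))"
        by (rule sum_insert_reindex)
      also have "\<dots> = (\<Sum>C | C \<subseteq> {..<n} \<and> card C = m. \<Sum>b<n. y ^ b * (c' b C * alternant ys C))"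
        by (rule sum.cong[OF refl], rule sum.mono_neutral_cong_left) (auto simp: c'_def mult_ac)
      also have "\<dots> = (\<Sum>b<n. y ^ b * w b)"
        unfolding w_def sum_distrib_left by (rule sum.swap)
      also have "\<dots> = poly p y" by (simp add: p_def poly_sum poly_monom mult_ac)
      finally show ?thesis ..
    qed
    have "p = 0"
    proof (rule ccontr)
      assume "p \<noteq> 0"
      have "coeff p b = 0" if "b \<ge> n" for b
        using that by (auto simp: p_def coeff_sum intro!: sum.neutral)
      hence "degree p < n" using \<open>p \<noteq> 0\<close> by (metis leading_coeff_0_iff not_less)
      moreover have "card Om \<le> card {x. poly p x = 0}"
        using zero \<open>p \<noteq> 0\<close> poly_roots_finite by (intro card_mono) auto
      moreover have "card {x. poly p x = 0} \<le> degree p" using \<open>p \<noteq> 0\<close> by (rule card_poly_roots_bound)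
      ultimately show False using assms(2) by linarith
    qed
    hence "coeff p b = 0" by simp
    thus ?thesis using b by (simp add: p_def coeff_sum w_def)
  qed
  have "A \<noteq> {}" using Suc.prems(3) by auto
  then obtain a where a: "a \<in> A" by blast
  have "c' a (A - {a}) = 0"
  proof (rule Suc.IH)
    show "(\<Sum>C | C \<subseteq> {..<n} \<and> card C = m. c' a C * alternant ys C) = 0"
      if "length ys = m" "set ys \<subseteq> Om" for ys
      using that a Suc.prems(2) by (intro c') auto
    show "A - {a} \<subseteq> {..<n}" using Suc.prems(2) by auto
    show "card (A - {a}) = m" using a finB[OF Suc.prems(2)] Suc.prems(3) by simp
  qed
  thus ?case using a by (simp add: c'_def insert_absorb)
qed

section \<open>Young diagrams as sets of exponents\<close>

text \<open>
  The exponents \<open>\<mu>\<^sub>i + l - i\<close> (rows numbered from \<open>1\<close>) of the alternant that is the numerator of a Schur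
  function. They turn diagrams in the
  \<open>l \<times> k\<close> rectangle into \<open>l\<close>-element subsets of \<open>{0..<k + l}\<close>.
\<close>

definition beta_list :: "nat list \<Rightarrow> nat list" where
  "beta_list \<mu> = map (\<lambda>i. \<mu> ! i + (length \<mu> - Suc i)) [0..<length \<mu>]"

lemma length_beta_list [simp]: "length (beta_list \<mu>) = length \<mu>"
  by (simp add: beta_list_def)

lemma beta_list_nth: "i < length \<mu> \<Longrightarrow> beta_list \<mu> ! i = \<mu> ! i + (length \<mu> - Suc i)"
  by (simp add: beta_list_def)

lemma sorted_beta_list: "\<mu> \<in> young_diagrams k l \<Longrightarrow> sorted_wrt (>) (beta_list \<mu>)"
  unfolding sorted_wrt_iff_nth_less
proof (intro allI impI)
  fix i j assume *: "\<mu> \<in> young_diagrams k l" "i < j" "j < length (beta_list \<mu>)"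
  hence "\<mu> ! j \<le> \<mu> ! i" by (auto simp: young_diagrams_def sorted_wrt_iff_nth_less)
  thus "beta_list \<mu> ! i > beta_list \<mu> ! j" using * by (simp add: beta_list_nth)
qed

lemma desc_gap:
  assumes "sorted_wrt (>) (as :: nat list)" "i \<le> j" "j < length as"
  shows "as ! j + (j - i) \<le> as ! i"
  using assms(2,3)
proof (induction j rule: dec_induct)
  case (step j)
  have "as ! Suc j < as ! j" using assms(1) step by (simp add: sorted_wrt_iff_nth_less)
  thus ?case using step by simp
qed simp

lemma bij_betw_beta_list:
  "bij_betw (\<lambda>\<mu>. set (beta_list \<mu>)) (young_diagrams k l) {A. A \<subseteq> {..<k + l} \<and> card A = l}"
  unfolding bij_betw_def
proof
  show "inj_on (\<lambda>\<mu>. set (beta_list \<mu>)) (young_diagrams k l)"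
  proof (rule inj_onI)
    fix \<mu> \<nu> assume *: "\<mu> \<in> young_diagrams k l" "\<nu> \<in> young_diagrams k l" "set (beta_list \<mu>) = set (beta_list \<nu>)"
    have "rev (beta_list \<mu>) = rev (beta_list \<nu>)"
      using * sorted_beta_list[of \<mu>] sorted_beta_list[of \<nu>]
      by (intro strict_sorted_equal) (auto simp: sorted_wrt_rev)
    hence eq: "beta_list \<mu> = beta_list \<nu>" by simp
    have len: "length \<mu> = l" "length \<nu> = l" using * by (auto simp: young_diagrams_def)
    show "\<mu> = \<nu>"
    proof (rule nth_equalityI)
      fix i assume "i < length \<mu>"
      thus "\<mu> ! i = \<nu> ! i" using arg_cong[OF eq, of "\<lambda>xs. xs ! i"] len by (simp add: beta_list_nth)
    qed (use len in simp)
  qed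
  show "(\<lambda>\<mu>. set (beta_list \<mu>)) ` young_diagrams k l = {A. A \<subseteq> {..<k + l} \<and> card A = l}"
  proof (intro equalityI subsetI)
    fix A assume "A \<in> (\<lambda>\<mu>. set (beta_list \<mu>)) ` young_diagrams k l"
    then obtain \<mu> where \<mu>: "\<mu> \<in> young_diagrams k l" "A = set (beta_list \<mu>)" by auto
    hence len: "length \<mu> = l" and le: "\<And>i. i < l \<Longrightarrow> \<mu> ! i \<le> k" by (auto simp: young_diagrams_def)
    have "card A = l"
      using sorted_wrt_greater_distinct[OF sorted_beta_list[OF \<mu>(1)]] \<mu>(2) len by (simp add: distinct_card)
    moreover have "A \<subseteq> {..<k + l}"
    proof
      fix a assume "a \<in> A"
      then obtain i where "i < l" "a = \<mu> ! i + (l - Suc i)"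
        using \<mu>(2) len by (auto simp: beta_list_def)
      thus "a \<in> {..<k + l}" using le[of i] by auto
    qed
    ultimately show "A \<in> {A. A \<subseteq> {..<k + l} \<and> card A = l}" by simp
  next
    fix A assume A: "A \<in> {A. A \<subseteq> {..<k + l} \<and> card A = l}"
    hence fin: "finite A" using finite_subset by blast
    define as where "as = rev (sorted_list_of_set A)"
    have as: "sorted_wrt (>) as" "set as = A" "length as = l"
      using A fin by (simp_all add: as_def sorted_wrt_rev)
    define \<mu> where "\<mu> = map (\<lambda>i. as ! i - (l - Suc i)) [0..<l]"
    \<comment> \<open>Gaps of at least one between consecutive exponents bound each exponent from both sides.\<close>
    have low: "l - Suc i \<le> as ! i" if "i < l" for i
    proof -
      have "i \<le> l - 1" using that by simp
      thus ?thesis using desc_gap[OF as(1), of i "l - 1"] that as(3) by simp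
    qed
    have high: "as ! i + i < k + l" if "i < l" for i
    proof -
      have "as ! 0 \<in> A" using that as by (metis gr_implies_not0 neq0_conv nth_mem)
      thus ?thesis using desc_gap[OF as(1), of 0 i] that as(3) A by auto
    qed
    have "beta_list \<mu> = as"
    proof (rule nth_equalityI)
      fix i assume "i < length (beta_list \<mu>)"
      hence "i < l" by (simp add: \<mu>_def)
      thus "beta_list \<mu> ! i = as ! i" using low[of i] by (simp add: beta_list_nth \<mu>_def)
    qed (simp add: as(3) \<mu>_def)
    moreover have "\<mu> \<in> young_diagrams k l"
      unfolding young_diagrams_def
    proof (intro CollectI conjI ballI)
      show "length \<mu> = l" by (simp add: \<mu>_def)
      show "sorted_wrt (\<ge>) \<mu>" unfolding sorted_wrt_iff_nth_less
      proof (intro allI impI)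
        fix i j assume ij: "i < j" "j < length \<mu>"
        hence "as ! j + (j - i) \<le> as ! i" using desc_gap[OF as(1), of i j] as(3) by (simp add: \<mu>_def)
        thus "\<mu> ! i \<ge> \<mu> ! j" using ij by (auto simp: \<mu>_def)
      qed
      fix x assume "x \<in> set \<mu>"
      then obtain i where "i < l" "x = as ! i - (l - Suc i)" by (auto simp: \<mu>_def)
      thus "x \<le> k" using high[of i] by auto
    qed
    ultimately show "A \<in> (\<lambda>\<mu>. set (beta_list \<mu>)) ` young_diagrams k l" using as(2) by force
  qed
qed

lemma finite_young_diagrams: "finite (young_diagrams k l)"
  using bij_betw_finite[OF bij_betw_beta_list, of k l] finite_subset[of _ "Pow {..<k + l}"] by auto

lemma card_young_diagrams: "card (young_diagrams k l) = (k + l) choose l"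
  using bij_betw_same_card[OF bij_betw_beta_list, of k l] n_subsets[of "{..<k + l}" l] by simp

section \<open>Elementary symmetric functions of a set of complex numbers\<close>

text \<open>
  The reversed polynomial \<open>\<Prod> (1 - x t)\<close> is used instead of \<open>\<Prod> (t - x)\<close>: its coefficients are the signed elementary
  symmetric functions in ascending order, whatever the number of elements.
\<close>

definition rprod :: "complex set \<Rightarrow> complex poly" where
  "rprod I = (\<Prod>x\<in>I. [:1, - x:])"

definition esym :: "complex set \<Rightarrow> nat \<Rightarrow> complex" where
  "esym I i = (-1) ^ i * coeff (rprod I) i"

lemma coeff_rprod: "coeff (rprod I) i = (-1) ^ i * esym I i"
  by (simp add: esym_def flip: mult.assoc power_add)

lemma poly_rprod: "poly (rprod I) t = (\<Prod>x\<in>I. 1 - x * t)"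
  by (simp add: rprod_def poly_prod mult.commute)

lemma degree_rprod_le: "degree (rprod I) \<le> card I"
proof (cases "finite I")
  case True
  have "degree (rprod I) \<le> (\<Sum>x\<in>I. degree [:1, - x:])"
    unfolding rprod_def using degree_prod_sum_le[OF True, of "\<lambda>x. [:1, -x:]"] by (simp add: o_def)
  also have "\<dots> \<le> (\<Sum>x\<in>I. 1)" by (intro sum_mono) auto
  finally show ?thesis by simp
qed (simp add: rprod_def)

lemma esym_0 [simp]: "esym I 0 = 1"
proof -
  have "coeff (rprod I) 0 = poly (rprod I) 0" by (simp add: poly_0_coeff_0)
  thus ?thesis by (simp add: esym_def poly_rprod)
qed

lemma esym_eq_0: "i > card I \<Longrightarrow> esym I i = 0"
  using degree_rprod_le[of I] by (simp add: esym_def coeff_eq_0)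

lemma rprod_union: "finite I \<Longrightarrow> finite J \<Longrightarrow> I \<inter> J = {} \<Longrightarrow> rprod (I \<union> J) = rprod I * rprod J"
  by (simp add: rprod_def prod.union_disjoint)

lemma rprod_zero_iff: "finite I \<Longrightarrow> 0 \<notin> I \<Longrightarrow> poly (rprod I) t = 0 \<longleftrightarrow> inverse t \<in> I"
proof -
  assume I: "finite I" "0 \<notin> I"
  have "1 - x * t = 0 \<longleftrightarrow> x = inverse t" if "x \<in> I" for x
    using that I(2) by (cases "t = 0") (auto simp: field_simps)
  thus ?thesis using I(1) by (auto simp: poly_rprod)
qed

text \<open>
  Both sides have degree at most \<open>n\<close> and agree at \<open>0\<close> and at the inverses of the \<open>n\<close> roots.
\<close>

lemma rprod_all_roots:
  assumes "c \<noteq> 0" "n > 0"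
  shows "rprod {x. x ^ n = c} = 1 - monom c n"
proof -
  let ?Om = "{x :: complex. x ^ n = c}"
  have card: "card ?Om = n" using assms by (rule card_nth_roots)
  hence fin: "finite ?Om" using assms(2) card_ge_0_finite by metis
  have 0: "0 \<notin> ?Om" using assms by (auto simp: zero_power)
  show ?thesis
  proof (rule poly_eqI_degree)
    fix x assume "x \<in> insert 0 (inverse ` ?Om)"
    thus "poly (rprod ?Om) x = poly (1 - monom c n) x"
    proof
      assume "x = 0"
      thus ?thesis using assms by (simp add: poly_rprod poly_monom zero_power)
    next
      assume "x \<in> inverse ` ?Om"
      then obtain y where y: "y ^ n = c" "x = inverse y" by auto
      have "poly (rprod ?Om) x = 0" using y rprod_zero_iff[OF fin 0, of x] by simp
      thus ?thesis using y assms(1) by (simp add: poly_monom power_inverse)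
    qed
  next
    have "card (insert 0 (inverse ` ?Om)) = Suc n"
      using fin 0 card by (subst card_insert_disjoint) (auto simp: card_image inj_on_def)
    moreover have "degree (rprod ?Om) \<le> n" using degree_rprod_le[of ?Om] card by simp
    moreover have "degree (1 - monom c n) \<le> n" by (intro degree_diff_le) (auto simp: degree_monom_le)
    ultimately show "card (insert 0 (inverse ` ?Om)) > degree (rprod ?Om)"
      "card (insert 0 (inverse ` ?Om)) > degree (1 - monom c n)" by auto
  qed
qed

text \<open>
  Reversing the coefficients of \<open>1 - x t\<close> gives \<open>-x (1 - t / x)\<close>.
\<close>

lemma rprod_inverse:
  assumes "finite I" "0 \<notin> I" "i \<le> card I"
  shows "esym I (card I - i) = (\<Prod>I) * esym (inverse ` I) i"
proof -
  have refl: "reflect_poly (rprod I) = Polynomial.smult ((-1) ^ card I * \<Prod>I) (rprod (inverse ` I))"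
  proof -
    have "reflect_poly (rprod I) = (\<Prod>x\<in>I. reflect_poly [:1, -x:])"
      by (simp add: rprod_def reflect_poly_prod)
    also have "\<dots> = (\<Prod>x\<in>I. Polynomial.smult (-x) [:1, - inverse x:])"
    proof (intro prod.cong refl)
      fix x assume "x \<in> I"
      hence "x \<noteq> 0" using assms(2) by auto
      thus "reflect_poly [:1, -x:] = Polynomial.smult (-x) [:1, - inverse x:]"
        by (simp add: reflect_poly_def cCons_def)
    qed
    also have "\<dots> = Polynomial.smult (\<Prod>x\<in>I. -x) (\<Prod>x\<in>I. [:1, - inverse x:])"
      by (rule prod_smult)
    also have "(\<Prod>x\<in>I. [:1, - inverse x:]) = rprod (inverse ` I)"
      unfolding rprod_def by (subst prod.reindex) (auto simp: inj_on_def)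
    also have "(\<Prod>x\<in>I. -x) = (-1) ^ card I * \<Prod>I"
      using prod_uminus[of "\<lambda>x. x" I] by simp
    finally show ?thesis .
  qed
  have deg: "degree (rprod I) = card I"
  proof -
    have "degree (rprod I) = (\<Sum>x\<in>I. degree [:1, -x:])"
      unfolding rprod_def by (rule degree_prod_eq_sum_degree) auto
    also have "\<dots> = (\<Sum>x\<in>I. 1)" using assms by (intro sum.cong) auto
    finally show ?thesis by simp
  qed
  have "coeff (rprod I) (card I - i) = coeff (reflect_poly (rprod I)) i"
    using assms(3) by (simp add: coeff_reflect_poly deg)
  also have "\<dots> = (-1) ^ card I * \<Prod>I * coeff (rprod (inverse ` I)) i" by (simp add: refl)
  finally have "esym I (card I - i) = ((-1) ^ (card I - i) * (-1) ^ card I * (-1) ^ i) * \<Prod>I * esym (inverse ` I) i"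
    by (simp only: esym_def[of I "card I - i"] coeff_rprod[of "inverse ` I"] mult_ac)
  also have "(-1) ^ (card I - i) * (-1) ^ card I * (-1) ^ i = (1 :: complex)"
  proof -
    have "(-1) ^ (card I - i) * (-1) ^ card I * (-1) ^ i = ((-1) ^ (card I - i) * (-1) ^ i) * ((-1) ^ card I :: complex)"
      by (simp only: mult_ac)
    also have "(-1) ^ (card I - i) * (-1) ^ i = ((-1) ^ card I :: complex)"
      using assms(3) by (simp flip: power_add)
    also have "(-1) ^ card I * (-1) ^ card I = (1 :: complex)" by (simp flip: power_mult_distrib)
    finally show ?thesis .
  qed
  finally show ?thesis by simp
qed

text \<open>
  The factors different from \<open>\<pm>1\<close> cancel in pairs.
\<close>

lemma prod_inverse_closed:
  fixes I :: "complex set"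
  assumes "finite I" "0 \<notin> I" "\<forall>x\<in>I. inverse x \<in> I"
  shows "\<Prod>I = (if -1 \<in> I then -1 else 1)"
  using assms
proof (induction "card I" arbitrary: I rule: less_induct)
  case less
  show ?case
  proof (cases "I \<subseteq> {1, -1}")
    case True
    hence "I = {} \<or> I = {1} \<or> I = {-1} \<or> I = {1, -1}" by auto
    thus ?thesis by (auto simp: one_neq_neg_one)
  next
    case False
    then obtain x where x: "x \<in> I" "x \<noteq> 1" "x \<noteq> -1" by auto
    have ne: "inverse x \<noteq> x"
    proof
      assume "inverse x = x"
      hence "x * x = 1" using x less.prems by (metis right_inverse)
      hence "(x - 1) * (x + 1) = 0" by (simp add: algebra_simps)
      thus False using x by (auto simp: eq_neg_iff_add_eq_0)
    qed
    let ?J = "I - {x, inverse x}"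
    have x0: "x \<noteq> 0" "inverse x \<in> I" using x less.prems by auto
    have I: "I = insert x (insert (inverse x) ?J)" using x x0 by auto
    have "\<Prod>?J = (if -1 \<in> ?J then -1 else 1)"
    proof (rule less.hyps)
      show "card ?J < card I" using less.prems x by (intro psubset_card_mono) auto
      show "\<forall>y\<in>?J. inverse y \<in> ?J" using less.prems(3) by auto
    qed (use less.prems in auto)
    moreover have "\<Prod>I = \<Prod>?J"
      using ne x0 less.prems(1) by (subst I, subst prod.insert, simp, simp, subst prod.insert) auto
    moreover have "inverse x \<noteq> -1"
      using x(3) by (metis inverse_inverse_eq inverse_minus_eq inverse_1)
    hence "-1 \<in> ?J \<longleftrightarrow> -1 \<in> I" using x by auto
    ultimately show ?thesis by simp
  qed
qed

text \<open>
  For \<open>i = 0\<close> the symmetry says that the product of the elements is \<open>1\<close>; then all the coefficients of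
  \<open>\<Prod> (1 - x t)\<close> for \<open>I\<close> and for the set of inverses agree, and so do the two sets. In an inversion-closed set
  the product is \<open>1\<close> exactly if \<open>-1\<close> does not occur.
\<close>

lemma palindromic_iff:
  assumes "finite I" "0 \<notin> I"
  shows "(\<forall>i\<le>card I. esym I (card I - i) = esym I i) \<longleftrightarrow> (\<forall>x\<in>I. inverse x \<in> I) \<and> -1 \<notin> I"
proof
  assume *: "\<forall>i\<le>card I. esym I (card I - i) = esym I i"
  have prod: "\<Prod>I = 1"
    using * rprod_inverse[OF assms, of 0] by auto
  have card: "card (inverse ` I) = card I" by (auto intro!: card_image simp: inj_on_def)
  have "esym (inverse ` I) i = esym I i" for i
    using * rprod_inverse[OF assms, of i] esym_eq_0[of I i] esym_eq_0[of "inverse ` I" i] card prod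
    by (cases "i \<le> card I") auto
  hence eq: "rprod (inverse ` I) = rprod I" by (intro poly_eqI) (simp add: coeff_rprod)
  have "0 \<notin> inverse ` I" "finite (inverse ` I)" using assms by auto
  hence "x \<in> inverse ` I \<longleftrightarrow> x \<in> I" for x
    using rprod_zero_iff[of I "inverse x"] rprod_zero_iff[of "inverse ` I" "inverse x"] assms eq
    unfolding inverse_inverse_eq by metis
  hence closed: "\<forall>x\<in>I. inverse x \<in> I" by blast
  thus "(\<forall>x\<in>I. inverse x \<in> I) \<and> -1 \<notin> I"
    using prod_inverse_closed[OF assms closed] prod by (auto simp: one_neq_neg_one split: if_splits)
next
  assume *: "(\<forall>x\<in>I. inverse x \<in> I) \<and> -1 \<notin> I"
  hence "inverse ` I = I" by auto (metis image_eqI inverse_inverse_eq)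
  thus "\<forall>i\<le>card I. esym I (card I - i) = esym I i"
    using rprod_inverse[OF assms] prod_inverse_closed[OF assms] * by auto
qed

section \<open>From Schubert determinants to alternants\<close>

definition esym_int :: "complex set \<Rightarrow> int \<Rightarrow> complex" where
  "esym_int I m = (if m < 0 then 0 else esym I (nat m))"

text \<open>
  The product \<open>\<Prod> (1 - x t)\<close> over \<open>J - {z}\<close> and over \<open>I\<close> is \<open>(1 - z\<^sup>n t\<^sup>n) / (1 - z t)\<close>, a geometric sum. Comparing the
  coefficients of \<open>t\<^sup>a\<close> expresses \<open>z\<^sup>a\<close> by the elementary symmetric functions of \<open>I\<close>; the sign of \<open>z\<close>
  absorbs the signs in them.
\<close>

lemma root_power_esym:
  assumes "z ^ n = c" "c \<noteq> 0" "n > 0" "finite J" "z \<in> J" "rprod J * rprod I = 1 - monom c n" "a < n"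
  shows "(\<Sum>r<card J. esym_int I (int a - int r) * ((-1) ^ r * coeff (rprod (J - {z})) r)) = (- z) ^ a"
proof -
  let ?q = "rprod (J - {z})"
  have J: "rprod J = [:1, -z:] * ?q"
    unfolding rprod_def using assms(4,5) by (simp add: prod.remove)
  have "(\<Sum>m<n. monom (z ^ m) m) * [:1, -z:] = 1 - monom c n"
  proof -
    have "(\<Sum>m<n. monom (z ^ m) m) * [:1, -z:] = (\<Sum>m<n. monom (z ^ m) m - monom (z ^ Suc m) (Suc m))"
      unfolding sum_distrib_right by (intro sum.cong refl poly_eqI) (auto simp: coeff_pCons split: nat.splits)
    also have "\<dots> = monom (z ^ 0) 0 - monom (z ^ n) n" by (rule sum_lessThan_telescope')
    finally show ?thesis using assms(1) by simp
  qed
  hence "[:1, -z:] * (?q * rprod I) = [:1, -z:] * (\<Sum>m<n. monom (z ^ m) m)"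
    using assms(6) J by (simp add: mult_ac)
  hence eq: "?q * rprod I = (\<Sum>m<n. monom (z ^ m) m)" by (subst (asm) mult_left_cancel) auto
  have deg: "degree ?q < card J"
    using degree_rprod_le[of "J - {z}"] assms(4,5) by (metis card_Diff1_less le_less_trans)
  have "z ^ a = coeff (?q * rprod I) a" unfolding eq using assms(7) by (simp add: coeff_sum)
  also have "\<dots> = (\<Sum>r\<le>a. coeff ?q r * coeff (rprod I) (a - r))" by (rule coeff_mult)
  also have "\<dots> = (\<Sum>r\<le>a. (-1) ^ a * (esym_int I (int a - int r) * ((-1) ^ r * coeff ?q r)))"
  proof (intro sum.cong refl)
    fix r assume "r \<in> {..a}"
    hence r: "r \<le> a" "nat (int a - int r) = a - r" by auto
    have "(-1) ^ (a - r) = ((-1) ^ a * (-1) ^ r :: complex)"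
    proof -
      have "(-1) ^ (a - r) = (-1) ^ (a - r) * ((-1) ^ r * (-1) ^ r :: complex)" by (simp flip: power_mult_distrib)
      also have "\<dots> = (-1) ^ (a - r) * (-1) ^ r * (-1) ^ r" by (simp only: mult.assoc)
      also have "(-1) ^ (a - r) * (-1) ^ r = ((-1) ^ a :: complex)" using r(1) by (simp flip: power_add)
      finally show ?thesis .
    qed
    thus "coeff ?q r * coeff (rprod I) (a - r) = (-1) ^ a * (esym_int I (int a - int r) * ((-1) ^ r * coeff ?q r))"
      using r by (simp add: coeff_rprod esym_int_def)
  qed
  also have "\<dots> = (-1) ^ a * (\<Sum>r\<le>a. esym_int I (int a - int r) * ((-1) ^ r * coeff ?q r))"
    by (simp add: sum_distrib_left)
  also have "(\<Sum>r\<le>a. esym_int I (int a - int r) * ((-1) ^ r * coeff ?q r))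
      = (\<Sum>r<card J. esym_int I (int a - int r) * ((-1) ^ r * coeff ?q r))"
    using deg by (intro sum.mono_neutral_cong) (auto simp: esym_int_def coeff_eq_0)
  finally have "(-1) ^ a * z ^ a = ((-1) ^ a * (-1) ^ a) *
      (\<Sum>r<card J. esym_int I (int a - int r) * ((-1) ^ r * coeff ?q r))" by (simp add: mult.assoc)
  moreover have "(-1) ^ a * (-1) ^ a = (1 :: complex)" by (simp flip: power_mult_distrib)
  ultimately show ?thesis by (simp only: mult_1_left power_minus[of z])
qed

text \<open>
  The matrix of the coefficients in the preceding identity: it carries the determinantal matrix of
  every diagram to the matrix of the corresponding alternant.
\<close>

definition trans_mat :: "complex list \<Rightarrow> complex mat" where
  "trans_mat zs = mat (length zs) (length zs)
     (\<lambda>(s, j). (-1) ^ (length zs - Suc s) * coeff (rprod (set zs - {zs ! j})) (length zs - Suc s))"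

text \<open>
  Multiplication by the matrix of the powers of the \<open>- 1 / z\<^sub>i\<close> evaluates \<open>\<Prod> (1 - x t)\<close> over the nodes other than \<open>z\<^sub>j\<close>
  at \<open>1 / z\<^sub>i\<close>. The result is a diagonal matrix without zeros on the diagonal.
\<close>

lemma det_trans_mat_nonzero:
  assumes "distinct zs" "0 \<notin> set zs"
  shows "det (trans_mat zs) \<noteq> 0"
proof -
  let ?l = "length zs"
  define W where "W = mat ?l ?l (\<lambda>(i, s). (- inverse (zs ! i)) ^ (?l - Suc s))"
  have entry: "(W * trans_mat zs) $$ (i, j) = poly (rprod (set zs - {zs ! j})) (inverse (zs ! i))"
    if "i < ?l" "j < ?l" for i j
  proof -
    let ?q = "rprod (set zs - {zs ! j})"
    have deg: "degree ?q < ?l"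
      using degree_rprod_le[of "set zs - {zs ! j}"] that assms(1) distinct_card[OF assms(1)]
      by (metis card_Diff1_less finite_set le_less_trans nth_mem)
    have "(W * trans_mat zs) $$ (i, j) = (\<Sum>s<?l. (- inverse (zs ! i)) ^ (?l - Suc s) * ((-1) ^ (?l - Suc s) * coeff ?q (?l - Suc s)))"
      using that by (simp add: W_def trans_mat_def scalar_prod_def lessThan_atLeast0)
    also have "\<dots> = (\<Sum>s<?l. (- inverse (zs ! i)) ^ s * ((-1) ^ s * coeff ?q s))"
      by (rule sum.nat_diff_reindex)
    also have "\<dots> = (\<Sum>s<?l. coeff ?q s * inverse (zs ! i) ^ s)"
      by (intro sum.cong refl) (simp add: mult_ac flip: power_mult_distrib mult.assoc)
    also have "\<dots> = (\<Sum>s\<le>degree ?q. coeff ?q s * inverse (zs ! i) ^ s)"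
      using deg by (intro sum.mono_neutral_right) (auto simp: coeff_eq_0)
    finally show ?thesis by (simp add: poly_altdef)
  qed
  have carr: "W \<in> carrier_mat ?l ?l" "trans_mat zs \<in> carrier_mat ?l ?l" by (auto simp: W_def trans_mat_def)
  have root: "poly (rprod (set zs - {zs ! j})) (inverse (zs ! i)) = 0 \<longleftrightarrow> i \<noteq> j" if "i < ?l" "j < ?l" for i j
    using that assms by (subst rprod_zero_iff) (auto simp: nth_eq_iff_index_eq)
  have "det (W * trans_mat zs) = (\<Prod>i = 0..<?l. (W * trans_mat zs) $$ (i, i))"
    using carr entry root
    by (subst det_lower_triangular[of ?l]) (auto simp: prod_list_diag_prod)
  hence "det (W * trans_mat zs) \<noteq> 0" using entry root by simp
  thus ?thesis using det_mult[OF carr] by auto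
qed

text \<open>
  The elementary symmetric functions of \<open>I\<close> are the complete homogeneous functions of the negated
  complementary roots, so this is the formula for a Schur function as a quotient of alternants.
\<close>

lemma jacobi_trudi:
  assumes "c \<noteq> 0" "n > 0" "I \<subseteq> {x. x ^ n = c}" "card I = k" "k < n"
    and "distinct zs" "set zs = {x. x ^ n = c} - I" "\<mu> \<in> young_diagrams k (n - k)"
  shows "det (mat (n - k) (n - k) (\<lambda>(i, j). esym_int I (int (\<mu> ! i) + int j - int i))) * det (trans_mat zs)
      = alternant (map uminus zs) (set (beta_list \<mu>))"
proof -
  let ?Om = "{x. x ^ n = c}" and ?l = "n - k"
  have cOm: "card ?Om = n" using assms(1,2) by (rule card_nth_roots)
  hence fin: "finite ?Om" using assms(2) card_ge_0_finite by metis
  have len: "length zs = ?l"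
    using distinct_card[OF assms(6)] assms(3,4,7) cOm fin by (simp add: card_Diff_subset finite_subset)
  have Q: "rprod (set zs) * rprod I = 1 - monom c n"
  proof -
    have "rprod ?Om = rprod (set zs \<union> I)" using assms(3,7) by (intro arg_cong[of _ _ rprod]) auto
    also have "\<dots> = rprod (set zs) * rprod I"
      using assms(3,7) fin finite_subset by (intro rprod_union) auto
    finally show ?thesis using rprod_all_roots[OF assms(1,2)] by simp
  qed
  have \<mu>: "length \<mu> = ?l" "\<And>i. i < ?l \<Longrightarrow> \<mu> ! i \<le> k" using assms(8) by (auto simp: young_diagrams_def)
  let ?S = "mat ?l ?l (\<lambda>(i, j). esym_int I (int (\<mu> ! i) + int j - int i))"
  have "?S * trans_mat zs = mat ?l ?l (\<lambda>(i, j). map uminus zs ! j ^ (beta_list \<mu> ! i))"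
  proof (rule eq_matI)
    fix i j assume "i < dim_row (mat ?l ?l (\<lambda>(i, j). map uminus zs ! j ^ (beta_list \<mu> ! i)))"
      "j < dim_col (mat ?l ?l (\<lambda>(i, j). map uminus zs ! j ^ (beta_list \<mu> ! i)))"
    hence ij: "i < ?l" "j < ?l" by auto
    let ?a = "\<mu> ! i + (?l - Suc i)"
    let ?q = "rprod (set zs - {zs ! j})"
    have "(?S * trans_mat zs) $$ (i, j)
      = (\<Sum>s<?l. esym_int I (int (\<mu> ! i) + int s - int i) * ((-1) ^ (?l - Suc s) * coeff ?q (?l - Suc s)))"
      using ij len by (simp add: trans_mat_def scalar_prod_def lessThan_atLeast0)
    also have "\<dots> = (\<Sum>s<?l. esym_int I (int ?a - int (?l - Suc s)) * ((-1) ^ (?l - Suc s) * coeff ?q (?l - Suc s)))"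
      using ij by (intro sum.cong refl arg_cong2[where f = "(*)"] arg_cong[where f = "esym_int I"]) auto
    also have "\<dots> = (\<Sum>r<?l. esym_int I (int ?a - int r) * ((-1) ^ r * coeff ?q r))"
      by (rule sum.nat_diff_reindex)
    also have "\<dots> = (\<Sum>r<card (set zs). esym_int I (int ?a - int r) * ((-1) ^ r * coeff ?q r))"
      using distinct_card[OF assms(6)] len by simp
    also have "\<dots> = (- (zs ! j)) ^ ?a"
    proof (rule root_power_esym[OF _ assms(1,2) _ _ Q])
      show mem: "zs ! j \<in> set zs" using ij len by simp
      show "zs ! j ^ n = c" using mem assms(7) by auto
      show "?a < n" using \<mu>(2)[OF ij(1)] ij assms(5) by linarith
    qed simp
    finally show "(?S * trans_mat zs) $$ (i, j) = mat ?l ?l (\<lambda>(i, j). map uminus zs ! j ^ (beta_list \<mu> ! i)) $$ (i, j)"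
      using ij len \<mu>(1) by (simp add: beta_list_nth)
  qed (use len in \<open>simp_all add: trans_mat_def\<close>)
  moreover have "det (?S * trans_mat zs) = det ?S * det (trans_mat zs)"
    using len by (intro det_mult) (auto simp: trans_mat_def)
  moreover have "alternant (map uminus zs) (set (beta_list \<mu>))
      = det (mat ?l ?l (\<lambda>(i, j). map uminus zs ! j ^ (beta_list \<mu> ! i)))"
    using alternant_eq_det[OF sorted_beta_list[OF assms(8)], of "map uminus zs"] len \<mu>(1) by simp
  ultimately show ?thesis by simp
qed

section \<open>Evaluation of polynomials in the special classes\<close>

definition mon_value :: "(nat \<Rightarrow> 'a :: comm_ring_1) \<Rightarrow> (nat \<Rightarrow>\<^sub>0 nat) \<Rightarrow> 'a" where
  "mon_value v m = (\<Prod>i\<in>Poly_Mapping.keys m. v i ^ Poly_Mapping.lookup m i)"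

definition poly_value :: "(complex \<Rightarrow> 'a :: comm_ring_1) \<Rightarrow> (nat \<Rightarrow> 'a) \<Rightarrow> cpoly \<Rightarrow> 'a" where
  "poly_value h v p = (\<Sum>m\<in>Poly_Mapping.keys p. h (Poly_Mapping.lookup p m) * mon_value v m)"

lemma mon_value_superset:
  assumes "finite S" "Poly_Mapping.keys m \<subseteq> S"
  shows "mon_value v m = (\<Prod>i\<in>S. v i ^ Poly_Mapping.lookup m i)"
  unfolding mon_value_def using assms
  by (intro prod.mono_neutral_left) (auto simp: in_keys_iff)

lemma mon_value_add: "mon_value v (a + b) = mon_value v a * mon_value v b"
proof -
  let ?S = "Poly_Mapping.keys a \<union> Poly_Mapping.keys b"
  have "Poly_Mapping.keys (a + b) \<subseteq> ?S" by (rule Poly_Mapping.keys_add)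
  thus ?thesis
    by (simp add: mon_value_superset[of ?S] Poly_Mapping.lookup_add power_add prod.distrib)
qed

lemma mon_value_0 [simp]: "mon_value v 0 = 1"
  by (simp add: mon_value_def)

lemma mon_value_single: "mon_value v (Poly_Mapping.single i a) = v i ^ a"
  by (cases "a = 0") (simp_all add: mon_value_def)

lemma sum_singles: "(\<Sum>m\<in>Poly_Mapping.keys p. Poly_Mapping.single m (Poly_Mapping.lookup p m)) = p"
proof (rule poly_mapping_eqI)
  fix m
  show "Poly_Mapping.lookup (\<Sum>m\<in>Poly_Mapping.keys p. Poly_Mapping.single m (Poly_Mapping.lookup p m)) m
      = Poly_Mapping.lookup p m"
    by (cases "m \<in> Poly_Mapping.keys p")
       (auto simp: Poly_Mapping.lookup_sum lookup_single when_def in_keys_iff)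
qed

lemma poly_value_superset:
  assumes "h 0 = 0" "finite S" "Poly_Mapping.keys p \<subseteq> S"
  shows "poly_value h v p = (\<Sum>m\<in>S. h (Poly_Mapping.lookup p m) * mon_value v m)"
  unfolding poly_value_def using assms
  by (intro sum.mono_neutral_left) (auto simp: in_keys_iff)

lemma poly_value_hom:
  assumes "comm_ring_hom (h :: complex \<Rightarrow> 'a :: comm_ring_1)"
  shows "comm_ring_hom (poly_value h v)"
proof -
  interpret h: comm_ring_hom h by fact
  have add: "poly_value h v (p + q) = poly_value h v p + poly_value h v q" for p q
  proof -
    let ?S = "Poly_Mapping.keys p \<union> Poly_Mapping.keys q"
    have "Poly_Mapping.keys (p + q) \<subseteq> ?S" by (rule Poly_Mapping.keys_add)
    thus ?thesis
      by (simp add: poly_value_superset[where S = ?S] Poly_Mapping.lookup_add h.hom_add distrib_right sum.distrib)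
  qed
  have zero: "poly_value h v 0 = 0" by (simp add: poly_value_def)
  have sum: "poly_value h v (sum f A) = (\<Sum>a\<in>A. poly_value h v (f a))" for f and A :: "(nat \<Rightarrow>\<^sub>0 nat) set"
    by (induction A rule: infinite_finite_induct) (simp_all add: zero add)
  have single: "poly_value h v (Poly_Mapping.single m a) = h a * mon_value v m" for m a
    by (subst poly_value_superset[where S = "{m}"]) auto
  have mult: "poly_value h v (p * q) = poly_value h v p * poly_value h v q" for p q
  proof -
    let ?s = "\<lambda>p m. Poly_Mapping.single m (Poly_Mapping.lookup p m) :: cpoly"
    have "p * q = (\<Sum>m\<in>Poly_Mapping.keys p. ?s p m) * (\<Sum>m\<in>Poly_Mapping.keys q. ?s q m)"
      by (simp only: sum_singles)
    also have "\<dots> = (\<Sum>m\<in>Poly_Mapping.keys p. \<Sum>m'\<in>Poly_Mapping.keys q. ?s p m * ?s q m')"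
      by (rule sum_product)
    finally have "poly_value h v (p * q) = (\<Sum>m\<in>Poly_Mapping.keys p. \<Sum>m'\<in>Poly_Mapping.keys q.
        (h (Poly_Mapping.lookup p m) * mon_value v m) * (h (Poly_Mapping.lookup q m') * mon_value v m'))"
      by (simp add: sum mult_single single h.hom_mult mon_value_add mult_ac)
    also have "\<dots> = poly_value h v p * poly_value h v q"
      unfolding poly_value_def by (rule sum_product[symmetric])
    finally show ?thesis .
  qed
  have one: "poly_value h v 1 = 1"
    using single[of 0 1] by (simp add: h.hom_one)
  show ?thesis
    by unfold_locales (simp_all add: zero one add mult)
qed

lemma comm_ring_hom_const_poly: "comm_ring_hom const_poly"
  by unfold_locales (simp_all add: const_poly_def mult_single Poly_Mapping.single_add)

lemma comm_ring_hom_id: "comm_ring_hom (\<lambda>c :: complex. c)"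
  by unfold_locales simp_all

lemma poly_value_single:
  assumes "comm_ring_hom h"
  shows "poly_value h v (Poly_Mapping.single m a) = h a * mon_value v m"
proof -
  interpret h: comm_ring_hom h by fact
  show ?thesis by (subst poly_value_superset[where S = "{m}"]) auto
qed

lemma poly_value_const: "comm_ring_hom h \<Longrightarrow> poly_value h v (const_poly c) = h c"
  by (simp add: const_poly_def poly_value_single)

lemma poly_value_sigma:
  assumes "comm_ring_hom h" "1 \<le> i" "i \<le> k"
  shows "poly_value h v (sigma_poly k (int i)) = v i"
proof -
  interpret h: comm_ring_hom h by fact
  show ?thesis using assms by (simp add: sigma_poly_def poly_value_single mon_value_single h.hom_one)
qed

definition sigma_var :: "nat \<Rightarrow> nat \<Rightarrow> cpoly" where
  "sigma_var k i = (if i = 0 then 0 else sigma_poly k (int i))"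

text \<open>
  Setting the variables outside \<open>1..k\<close> to zero is a projection of the full polynomial type onto the
  polynomial ring in \<open>\<sigma>\<^sub>1, \<dots>, \<sigma>\<^sub>k\<close>. An ideal of the latter is the trace of its preimage, which is an
  ideal of the full type; calculations can thus be done in a type class instead of a carrier.
\<close>

definition retract :: "nat \<Rightarrow> cpoly \<Rightarrow> cpoly" where
  "retract k = poly_value const_poly (sigma_var k)"

interpretation retract: comm_ring_hom "retract k" for k
  unfolding retract_def by (rule poly_value_hom[OF comm_ring_hom_const_poly])

lemma single_eq_mon_value:
  assumes "Poly_Mapping.keys m \<subseteq> {1..k}"
  shows "Poly_Mapping.single m 1 = mon_value (sigma_var k) m"
proof -
  have pow: "Poly_Mapping.single (Poly_Mapping.single i a) (1 :: complex) = sigma_var k i ^ a"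
    if "i \<in> {1..k}" for i a
  proof (induction a)
    case (Suc a)
    have "Poly_Mapping.single (Poly_Mapping.single i (Suc a)) (1 :: complex)
        = Poly_Mapping.single (Poly_Mapping.single i 1) 1 * Poly_Mapping.single (Poly_Mapping.single i a) 1"
      by (simp add: mult_single flip: Poly_Mapping.single_add)
    also have "Poly_Mapping.single (Poly_Mapping.single i 1) (1 :: complex) = sigma_var k i"
      using that by (simp add: sigma_var_def sigma_poly_def)
    finally show ?case by (simp add: Suc)
  qed simp
  have prod: "Poly_Mapping.single (\<Sum>i\<in>A. Poly_Mapping.single i (f i)) (1 :: complex) = (\<Prod>i\<in>A. sigma_var k i ^ f i)"
    if "finite A" "A \<subseteq> {1..k}" for A f
    using that
  proof (induction A rule: finite_induct)
    case (insert i A)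
    hence "Poly_Mapping.single (\<Sum>i\<in>insert i A. Poly_Mapping.single i (f i)) (1 :: complex)
        = Poly_Mapping.single (Poly_Mapping.single i (f i)) 1 * Poly_Mapping.single (\<Sum>i\<in>A. Poly_Mapping.single i (f i)) 1"
      by (simp only: sum.insert mult_single) simp
    thus ?case using insert pow[of i "f i"] by simp
  qed simp
  have "m = (\<Sum>i\<in>Poly_Mapping.keys m. Poly_Mapping.single i (Poly_Mapping.lookup m i))"
    by (rule poly_mapping_eqI) (auto simp: Poly_Mapping.lookup_sum lookup_single when_def in_keys_iff)
  thus ?thesis using prod[OF finite_keys assms, of "Poly_Mapping.lookup m"]
    unfolding mon_value_def by metis
qed

lemma retract_id:
  assumes "p \<in> carrier (sigma_ring k)"
  shows "retract k p = p"
proof -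
  have "retract k p = (\<Sum>m\<in>Poly_Mapping.keys p. const_poly (Poly_Mapping.lookup p m) * mon_value (sigma_var k) m)"
    by (simp add: retract_def poly_value_def)
  also have "\<dots> = (\<Sum>m\<in>Poly_Mapping.keys p. Poly_Mapping.single m (Poly_Mapping.lookup p m))"
  proof (intro sum.cong refl)
    fix m assume "m \<in> Poly_Mapping.keys p"
    hence "Poly_Mapping.keys m \<subseteq> {1..k}" using assms by (auto simp: sigma_ring_def)
    from single_eq_mon_value[OF this, symmetric] show "const_poly (Poly_Mapping.lookup p m) * mon_value (sigma_var k) m
        = Poly_Mapping.single m (Poly_Mapping.lookup p m)"
      by (simp add: const_poly_def mult_single)
  qed
  finally show ?thesis by (simp add: sum_singles)
qed

section \<open>The carrier of the polynomial ring\<close>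

lemma sigma_ring_sel [simp]:
  "mult (sigma_ring k) = (*)" "one (sigma_ring k) = 1" "zero (sigma_ring k) = 0" "add (sigma_ring k) = (+)"
  by (simp_all add: sigma_ring_def)

context
  fixes k :: nat
begin

interpretation S: cring "sigma_ring k" by (rule cring_sigma_ring)

lemma sigma_add_closed: "p \<in> carrier (sigma_ring k) \<Longrightarrow> q \<in> carrier (sigma_ring k) \<Longrightarrow> p + q \<in> carrier (sigma_ring k)"
  using S.a_closed by simp

lemma sigma_mult_closed: "p \<in> carrier (sigma_ring k) \<Longrightarrow> q \<in> carrier (sigma_ring k) \<Longrightarrow> p * q \<in> carrier (sigma_ring k)"
  using S.m_closed by simp

lemma sigma_0_closed: "0 \<in> carrier (sigma_ring k)" using S.zero_closed by simp
lemma sigma_1_closed: "1 \<in> carrier (sigma_ring k)" using S.one_closed by simp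

lemma sigma_a_inv: "p \<in> carrier (sigma_ring k) \<Longrightarrow> \<ominus>\<^bsub>sigma_ring k\<^esub> p = - p"
proof -
  assume p: "p \<in> carrier (sigma_ring k)"
  hence "- p \<in> carrier (sigma_ring k)" by (simp add: sigma_ring_def)
  thus ?thesis using p S.minus_equality[of "- p" p] by simp
qed

lemma sigma_uminus_closed: "p \<in> carrier (sigma_ring k) \<Longrightarrow> - p \<in> carrier (sigma_ring k)"
  by (simp add: sigma_ring_def)

lemma sigma_diff_closed: "p \<in> carrier (sigma_ring k) \<Longrightarrow> q \<in> carrier (sigma_ring k) \<Longrightarrow> p - q \<in> carrier (sigma_ring k)"
  using sigma_add_closed[of p "- q"] sigma_uminus_closed[of q] by simp

lemma sigma_a_minus: "p \<in> carrier (sigma_ring k) \<Longrightarrow> q \<in> carrier (sigma_ring k) \<Longrightarrow> p \<ominus>\<^bsub>sigma_ring k\<^esub> q = p - q"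
  by (simp add: a_minus_def sigma_a_inv)

lemma sigma_sum_closed: "(\<And>a. a \<in> A \<Longrightarrow> f a \<in> carrier (sigma_ring k)) \<Longrightarrow> sum f A \<in> carrier (sigma_ring k)"
  by (induction A rule: infinite_finite_induct) (auto simp: sigma_0_closed sigma_add_closed)

lemma sigma_prod_closed: "(\<And>a. a \<in> A \<Longrightarrow> f a \<in> carrier (sigma_ring k)) \<Longrightarrow> prod f A \<in> carrier (sigma_ring k)"
  by (induction A rule: infinite_finite_induct) (auto simp: sigma_1_closed sigma_mult_closed)

lemma sigma_const_closed: "const_poly c \<in> carrier (sigma_ring k)"
  by (simp add: const_poly_def sigma_ring_def)

lemma sigma_power_closed: "p \<in> carrier (sigma_ring k) \<Longrightarrow> p ^ i \<in> carrier (sigma_ring k)"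
  by (induction i) (auto simp: sigma_1_closed sigma_mult_closed)

lemma sigma_det_closed:
  assumes "\<And>i j. i < r \<Longrightarrow> j < r \<Longrightarrow> f i j \<in> carrier (sigma_ring k)"
  shows "det (mat r r (\<lambda>(i, j). f i j)) \<in> carrier (sigma_ring k)"
proof -
  have sgn: "(signof p :: cpoly) \<in> carrier (sigma_ring k)" for p :: "nat \<Rightarrow> nat"
    by (cases "sign p = 1") (auto simp: sign_def sigma_1_closed intro!: sigma_uminus_closed sigma_1_closed)
  show ?thesis
  proof (subst det_def'[of _ r], simp, intro sigma_sum_closed sigma_mult_closed sgn sigma_prod_closed)
    fix p i assume "p \<in> {p. p permutes {0..<r}}" "i \<in> {0..<r}"
    moreover from this have "p i < r" using permutes_in_image[of p "{0..<r}" i] by auto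
    ultimately show "mat r r (\<lambda>(i, j). f i j) $$ (i, p i) \<in> carrier (sigma_ring k)"
      using assms by simp
  qed
qed

end

lemmas sigma_closed = sigma_add_closed sigma_mult_closed sigma_0_closed sigma_1_closed
  sigma_uminus_closed sigma_diff_closed sigma_sum_closed sigma_prod_closed sigma_const_closed
  sigma_power_closed sigma_poly_closed

lemma Y_poly_closed: "Y_poly k r \<in> carrier (sigma_ring k)"
  unfolding Y_poly_def by (rule sigma_det_closed) (rule sigma_poly_closed)

lemma schubert_poly_closed: "schubert_poly k \<mu> \<in> carrier (sigma_ring k)"
  unfolding schubert_poly_def by (rule sigma_det_closed) (rule sigma_poly_closed)

lemma retract_closed: "retract k p \<in> carrier (sigma_ring k)"
proof -
  have "sigma_var k i \<in> carrier (sigma_ring k)" for i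
    by (simp add: sigma_var_def sigma_closed)
  thus ?thesis unfolding retract_def poly_value_def mon_value_def
    by (intro sigma_closed)
qed

section \<open>The recurrence for the determinants of the presentation\<close>

text \<open>
  The first column has only two nonzero entries, \<open>u 0\<close> and the \<open>1\<close> below it. Deleting the second row instead
  of the first leaves a matrix of the same kind with a shifted first row, which is why the first row
  is left arbitrary.
\<close>

lemma det_hessenberg:
  fixes s :: "int \<Rightarrow> 'a :: comm_ring_1"
  assumes "s 0 = 1" "\<And>m. m < 0 \<Longrightarrow> s m = 0"
  shows "det (mat (Suc r) (Suc r) (\<lambda>(i, j). if i = 0 then u j else s (1 + int j - int i)))
      = (\<Sum>j\<le>r. (-1) ^ j * u j * det (mat (r - j) (r - j) (\<lambda>(i, j). s (1 + int j - int i))))"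
proof (induction r arbitrary: u)
  case 0
  show ?case by (subst det_single[of _]) (auto simp: det_dim_zero)
next
  case (Suc r)
  let ?M = "mat (Suc (Suc r)) (Suc (Suc r)) (\<lambda>(i, j). if i = 0 then u j else s (1 + int j - int i))"
  let ?Y = "\<lambda>r. det (mat r r (\<lambda>(i, j). s (1 + int j - int i)))"
  have zero: "?M $$ (i, 0) = 0" if "i \<in> {2..<Suc (Suc r)}" for i
    using that assms(2) by simp
  have m0: "mat_delete ?M 0 0 = mat (Suc r) (Suc r) (\<lambda>(i, j). s (1 + int j - int i))"
    by (rule eq_matI) (auto simp: mat_delete_def algebra_simps)
  have m1: "mat_delete ?M 1 0 = mat (Suc r) (Suc r) (\<lambda>(i, j). if i = 0 then u (Suc j) else s (1 + int j - int i))"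
    by (rule eq_matI) (auto simp: mat_delete_def algebra_simps)
  have "det ?M = (\<Sum>i<Suc (Suc r). ?M $$ (i, 0) * cofactor ?M i 0)"
    by (rule laplace_expansion_column) auto
  also have "{..<Suc (Suc r)} = {0, 1} \<union> {2..<Suc (Suc r)}" by auto
  also have "(\<Sum>i\<in>{0, 1} \<union> {2..<Suc (Suc r)}. ?M $$ (i, 0) * cofactor ?M i 0)
     = (\<Sum>i\<in>{0, 1}. ?M $$ (i, 0) * cofactor ?M i 0) + (\<Sum>i\<in>{2..<Suc (Suc r)}. ?M $$ (i, 0) * cofactor ?M i 0)"
    by (rule sum.union_disjoint) auto
  also have "(\<Sum>i\<in>{2..<Suc (Suc r)}. ?M $$ (i, 0) * cofactor ?M i 0) = 0"
    using zero by (intro sum.neutral) auto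
  also have "(\<Sum>i\<in>{0, 1}. ?M $$ (i, 0) * cofactor ?M i 0) = u 0 * ?Y (Suc r) - det (mat_delete ?M 1 0)"
    using assms(1) m0 by (simp add: cofactor_def)
  also have "det (mat_delete ?M 1 0) = (\<Sum>j\<le>r. (-1) ^ j * u (Suc j) * ?Y (r - j))"
    unfolding m1 by (rule Suc.IH)
  also have "u 0 * ?Y (Suc r) - \<dots> = (\<Sum>j\<le>Suc r. (-1) ^ j * u j * ?Y (Suc r - j))"
    by (subst sum.atMost_Suc_shift) (simp add: sum_negf)
  finally show ?case by simp
qed

lemma Y_poly_recurrence:
  assumes "r > 0"
  shows "(\<Sum>i\<le>r. (-1) ^ i * sigma_poly k (int i) * Y_poly k (r - i)) = 0"
proof -
  obtain m where r: "r = Suc m" using assms by (cases r) auto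
  have "Y_poly k r = det (mat (Suc m) (Suc m) (\<lambda>(i, j). if i = 0 then sigma_poly k (1 + int j)
      else sigma_poly k (1 + int j - int i)))"
    unfolding Y_poly_def r by (intro arg_cong[of _ _ det] eq_matI) auto
  also have "\<dots> = (\<Sum>j\<le>m. (-1) ^ j * sigma_poly k (1 + int j) * Y_poly k (m - j))"
    unfolding Y_poly_def by (rule det_hessenberg) (auto simp: sigma_poly_def)
  finally have *: "Y_poly k r = (\<Sum>j\<le>m. (-1) ^ j * sigma_poly k (1 + int j) * Y_poly k (m - j))" .
  have "(\<Sum>i\<le>r. (-1) ^ i * sigma_poly k (int i) * Y_poly k (r - i))
     = sigma_poly k 0 * Y_poly k r - (\<Sum>j\<le>m. (-1) ^ j * sigma_poly k (1 + int j) * Y_poly k (m - j))"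
    unfolding r by (subst sum.atMost_Suc_shift) (simp add: sum_negf)
  thus ?thesis using * by (simp add: sigma_poly_def)
qed

section \<open>Splitting a factorisation of a separable polynomial\<close>

locale algebra_ideal = h: comm_ring_hom h for h :: "complex \<Rightarrow> 'a :: idom" +
  fixes J :: "'a set"
  assumes zero_mem: "0 \<in> J"
    and add_mem: "a \<in> J \<Longrightarrow> b \<in> J \<Longrightarrow> a + b \<in> J"
    and mult_mem: "a \<in> J \<Longrightarrow> r * a \<in> J"
begin

lemma uminus_mem: "a \<in> J \<Longrightarrow> - a \<in> J"
  using mult_mem[of a "-1"] by simp

lemma diff_mem: "a \<in> J \<Longrightarrow> b \<in> J \<Longrightarrow> a - b \<in> J"
  using add_mem[of a "- b"] uminus_mem[of b] by simp

lemma mult_mem': "a \<in> J \<Longrightarrow> a * r \<in> J"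
  using mult_mem[of a r] by (simp add: mult.commute)

lemma sum_mem: "(\<And>x. x \<in> A \<Longrightarrow> f x \<in> J) \<Longrightarrow> sum f A \<in> J"
  by (induction A rule: infinite_finite_induct) (auto simp: zero_mem add_mem)

lemma cancel_const: "c \<noteq> 0 \<Longrightarrow> h c * a \<in> J \<Longrightarrow> a \<in> J"
proof -
  assume "c \<noteq> 0" and "h c * a \<in> J"
  from this(2) have "h (inverse c) * (h c * a) \<in> J" by (rule mult_mem)
  moreover have "h (inverse c) * (h c * a) = h (inverse c * c) * a" by (simp only: h.hom_mult mult.assoc)
  moreover have "h (inverse c * c) = 1" using \<open>c \<noteq> 0\<close> by simp
  ultimately show ?thesis by simp
qed

lemma poly_mem: "(\<And>i. coeff P i \<in> J) \<Longrightarrow> poly P t \<in> J"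
  unfolding poly_altdef by (intro sum_mem mult_mem')

text \<open>
  The usual bound for the number of roots, modulo \<open>J\<close>. It holds although the quotient may have zero
  divisors, because the difference of two roots is a nonzero constant and hence invertible.
\<close>

lemma coeffs_mem_of_roots:
  assumes "degree P \<le> d" "finite T" "card T > d" "\<And>t. t \<in> T \<Longrightarrow> poly P (h t) \<in> J"
  shows "coeff P i \<in> J"
  using assms
proof (induction d arbitrary: P T i)
  case 0
  then obtain t where "t \<in> T" by fastforce
  moreover obtain a where "P = [:a:]" using 0 by (metis degree_eq_zeroE le_zero_eq)
  ultimately show ?case using "0.prems"(4) by (cases i) (auto simp: zero_mem)
next
  case (Suc d)
  have "T \<noteq> {}" using Suc.prems(3) by auto
  then obtain t where t: "t \<in> T" by blast
  define Q where "Q = synthetic_div P (h t)"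
  have P: "P = [:- h t, 1:] * Q + [:poly P (h t):]" unfolding Q_def by (simp only: synthetic_div_correct')
  have Q: "coeff Q i \<in> J" for i
  proof (rule Suc.IH)
    show "degree Q \<le> d" using Suc.prems(1) by (simp add: Q_def degree_synthetic_div)
    show "finite (T - {t})" "card (T - {t}) > d" using Suc.prems t by auto
    fix t' assume t': "t' \<in> T - {t}"
    have "poly P (h t') = h (t' - t) * poly Q (h t') + poly P (h t)"
      by (subst P) (simp add: h.hom_minus algebra_simps)
    hence "h (t' - t) * poly Q (h t') = poly P (h t') - poly P (h t)" by simp
    also have "\<dots> \<in> J" using Suc.prems(4) t t' by (intro diff_mem) auto
    finally have mem: "h (t' - t) * poly Q (h t') \<in> J" .
    show "poly Q (h t') \<in> J" by (rule cancel_const[OF _ mem]) (use t' in auto)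
  qed
  show ?case by (subst P) (use Q Suc.prems(4)[OF t] in
    \<open>cases i; auto simp: coeff_pCons intro!: add_mem diff_mem uminus_mem mult_mem split: nat.splits\<close>)
qed

text \<open>
  Multiplying out \<open>\<Prod> (u a x + v b x)\<close> writes \<open>1\<close> modulo \<open>J\<close> as a combination of the products over all ways to choose \<open>a\<close>
  or \<open>b\<close> at every \<open>x\<close>.
\<close>

lemma mem_of_split:
  assumes "finite S" "\<And>x. x \<in> S \<Longrightarrow> \<exists>u v. u * a x + v * b x - 1 \<in> J"
    and "\<And>I. I \<subseteq> S \<Longrightarrow> p * (\<Prod>x\<in>I. b x) * (\<Prod>x\<in>S - I. a x) \<in> J"
  shows "p \<in> J"
  using assms
proof (induction S arbitrary: p rule: finite_induct)
  case empty
  have "p * prod b {} * prod a ({} - {}) \<in> J" by (rule empty.prems(2)) simp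
  thus ?case by (simp only: prod.empty Diff_empty mult_1_right)
next
  case (insert x S)
  have fin: "finite S" "x \<notin> S" and comax: "\<And>z. z \<in> insert x S \<Longrightarrow> \<exists>u v. u * a z + v * b z - 1 \<in> J"
    by fact+
  have "p * a x \<in> J"
  proof (rule insert.IH)
    fix I assume I: "I \<subseteq> S"
    have "p * prod b I * prod a (insert x S - I) \<in> J" by (rule insert.prems(2)) (use I in auto)
    also have "insert x S - I = insert x (S - I)" using fin I by auto
    also have "prod a (insert x (S - I)) = a x * prod a (S - I)" using fin by (intro prod.insert) auto
    finally show "p * a x * prod b I * prod a (S - I) \<in> J" by (simp only: mult_ac)
  qed (rule comax, simp)
  moreover have "p * b x \<in> J"
  proof (rule insert.IH)
    fix I assume I: "I \<subseteq> S"
    have "p * prod b (insert x I) * prod a (insert x S - insert x I) \<in> J"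
      by (rule insert.prems(2)) (use I in auto)
    also have "insert x S - insert x I = S - I" using fin I by auto
    also have "prod b (insert x I) = b x * prod b I"
      using fin I finite_subset by (intro prod.insert) auto
    finally show "p * b x * prod b I * prod a (S - I) \<in> J" by (simp only: mult_ac)
  qed (rule comax, simp)
  moreover obtain u v where "u * a x + v * b x - 1 \<in> J" using comax[of x] by auto
  ultimately have "u * (p * a x) + v * (p * b x) - p * (u * a x + v * b x - 1) \<in> J"
    by (rule diff_mem[OF add_mem[OF mult_mem mult_mem] mult_mem])
  moreover have "u * (p * a x) + v * (p * b x) - p * (u * a x + v * b x - 1) = p"
    by (simp add: algebra_simps)
  ultimately show ?case by simp
qed

end

text \<open>
  The relations of the quantum cohomology ring, stated for an ideal of an arbitrary complex
  algebra without zero divisors: \<open>e\<close> stands for the special classes and \<open>y\<close> for the determinants formed from them.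
\<close>

locale factor_ideal = algebra_ideal h J for h :: "complex \<Rightarrow> 'a :: idom" and J +
  fixes k n :: nat and e y :: "nat \<Rightarrow> 'a" and c :: complex
  assumes k: "1 \<le> k" and kn: "k < n" and c: "c = (-1) ^ (k + 1)"
    and e0: "e 0 = 1" and y0: "y 0 = 1" and ek: "\<And>i. i > k \<Longrightarrow> e i = 0"
    and rec: "\<And>r. r > 0 \<Longrightarrow> (\<Sum>i\<le>r. (-1) ^ i * e i * y (r - i)) = 0"
    and y_mem: "\<And>r. n - k < r \<Longrightarrow> r < n \<Longrightarrow> y r \<in> J"
    and yn_mem: "y n + (-1) ^ k \<in> J"
begin

definition F where "F = (\<Sum>i\<le>k. monom ((-1) ^ i * e i) i)"
definition G where "G = (\<Sum>i\<le>n - k. monom (y i) i)"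

lemma coeff_F: "coeff F i = (-1) ^ i * e i"
proof (cases "i \<le> k")
  case True
  thus ?thesis by (simp add: F_def coeff_sum)
next
  case False
  thus ?thesis using ek[of i] by (simp add: F_def coeff_sum)
qed

lemma coeff_G: "coeff G i = (if i \<le> n - k then y i else 0)"
  by (simp add: G_def coeff_sum)

lemma degree_F: "degree F \<le> k" by (intro degree_le) (simp add: coeff_F ek)
lemma degree_G: "degree G \<le> n - k" by (intro degree_le) (simp add: coeff_G)

lemma c_simps: "c \<noteq> 0" "c * c = 1" "h c = (-1) ^ (k + 1)"
  by (simp_all add: c h.hom_mult h.hom_uminus h.hom_power flip: power_mult_distrib)

text \<open>
  Without truncation the product of the two generating functions is \<open>1\<close>. Dropping the terms \<open>y r\<close> with \<open>r > n - k\<close>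
  from \<open>G\<close> changes nothing modulo \<open>J\<close> below degree \<open>n\<close>, and in degree \<open>n\<close> it removes \<open>y n\<close>, which is \<open>- (-1)\<^sup>k\<close>
  modulo \<open>J\<close>.
\<close>

lemma FG_coeff_mem: "coeff (F * G - (1 - monom (h c) n)) r \<in> J"
proof -
  have FG: "coeff (F * G) r = (\<Sum>i\<le>r. (-1) ^ i * e i * (if r - i \<le> n - k then y (r - i) else 0))"
    by (simp add: coeff_mult coeff_F coeff_G)
  consider "r = 0" | "0 < r" "r < n" | "r = n" "r > 0" | "r > n" using kn by linarith
  thus ?thesis
  proof cases
    case 1
    thus ?thesis using FG kn by (simp add: e0 y0 zero_mem)
  next
    case 2
    have "coeff (F * G) r = (\<Sum>i\<le>r. (-1) ^ i * e i * (if r - i \<le> n - k then y (r - i) else 0))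
        - (\<Sum>i\<le>r. (-1) ^ i * e i * y (r - i))"
      using rec[OF 2(1)] FG by simp
    also have "\<dots> = (\<Sum>i\<le>r. (-1) ^ i * e i * (if r - i \<le> n - k then 0 else - y (r - i)))"
      unfolding sum_subtractf[symmetric] by (intro sum.cong) auto
    also have "\<dots> \<in> J"
      using 2 by (intro sum_mem mult_mem) (auto simp: zero_mem intro!: uminus_mem y_mem)
    finally show ?thesis using 2 by simp
  next
    case 3
    have "coeff (F * G) r = (\<Sum>i\<le>r. (-1) ^ i * e i * (if r - i \<le> n - k then y (r - i) else 0))
        - (\<Sum>i\<le>r. (-1) ^ i * e i * y (r - i))"
      using rec[OF 3(2)] FG by simp
    also have "\<dots> = (\<Sum>i\<le>r. (-1) ^ i * e i * (if r - i \<le> n - k then 0 else - y (r - i)))"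
      unfolding sum_subtractf[symmetric] by (intro sum.cong) auto
    also have "{..r} = insert 0 {1..r}" by auto
    also have "(\<Sum>i\<in>insert 0 {1..r}. (-1) ^ i * e i * (if r - i \<le> n - k then 0 else - y (r - i)))
        = (- y n) + (\<Sum>i\<in>{1..r}. (-1) ^ i * e i * (if r - i \<le> n - k then 0 else - y (r - i)))"
      using 3 k kn by (simp add: e0)
    finally have eq: "coeff (F * G) r = \<dots>" .
    have "(\<Sum>i\<in>{1..r}. (-1) ^ i * e i * (if r - i \<le> n - k then 0 else - y (r - i))) \<in> J"
      using 3 by (intro sum_mem mult_mem) (auto simp: zero_mem intro!: uminus_mem y_mem)
    hence "- (y n + (-1) ^ k) + (\<Sum>i\<in>{1..r}. (-1) ^ i * e i * (if r - i \<le> n - k then 0 else - y (r - i))) \<in> J"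
      by (rule add_mem[OF uminus_mem[OF yn_mem]])
    also have "- (y n + (-1) ^ k) + (\<Sum>i\<in>{1..r}. (-1) ^ i * e i * (if r - i \<le> n - k then 0 else - y (r - i)))
        = coeff (F * G) r - (-1) ^ k"
      unfolding eq by (simp only: minus_add_distrib diff_conv_add_uminus add_ac)
    finally have "coeff (F * G) r - (-1) ^ k \<in> J" .
    moreover have "coeff (F * G - (1 - monom (h c) n)) r = coeff (F * G) r - (-1) ^ k"
      using 3 by (simp add: c_simps)
    ultimately show ?thesis by (simp only:)
  next
    case 4
    have "degree (F * G) \<le> k + (n - k)"
      using degree_mult_le[of F G] degree_F degree_G by linarith
    hence "coeff (F * G) r = 0" using 4 kn by (intro coeff_eq_0) simp
    thus ?thesis using 4 by (simp add: zero_mem)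
  qed
qed

definition Om where "Om = {x :: complex. x ^ n = c}"

lemma finite_Om: "finite Om" and card_Om: "card Om = n" and zero_Om: "0 \<notin> Om"
proof -
  show "card Om = n" unfolding Om_def using c_simps kn by (intro card_nth_roots) auto
  thus "finite Om" using kn card_ge_0_finite by force
  show "0 \<notin> Om" using c_simps kn by (auto simp: Om_def zero_power)
qed

definition A where "A x = poly F (h (inverse x))"
definition B where "B x = poly G (h (inverse x))"

lemma AB_mem: assumes "x \<in> Om" shows "A x * B x \<in> J"
proof -
  have x: "x ^ n = c" using assms by (simp add: Om_def)
  have "c * inverse x ^ n = 1" using c_simps by (simp add: power_inverse x)
  have "poly (1 - monom (h c) n) (h (inverse x)) = h (1 - c * inverse x ^ n)"
    by (simp add: poly_monom h.hom_minus h.hom_mult h.hom_power)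
  hence "poly (1 - monom (h c) n) (h (inverse x)) = 0"
    using \<open>c * inverse x ^ n = 1\<close> by simp
  moreover have "poly (F * G - (1 - monom (h c) n)) (h (inverse x)) \<in> J"
    by (rule poly_mem[OF FG_coeff_mem])
  ultimately show ?thesis by (simp add: A_def B_def)
qed

text \<open>
  Separability: modulo \<open>J\<close> the derivative of \<open>F G\<close> is \<open>- n c t\<^sup>n\<^sup>-\<^sup>1\<close>, whose value at \<open>1 / x\<close> is a nonzero constant, and by
  the product rule this value is a combination of \<open>A x\<close> and \<open>B x\<close>.
\<close>

lemma AB_comaximal: assumes "x \<in> Om" shows "\<exists>u v. u * A x + v * B x - 1 \<in> J"
proof -
  \<comment> \<open>The number \<open>d\<close> below is the value of the derivative of \<open>1 - c t\<^sup>n\<close> at \<open>w\<close>.\<close>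
  define w where "w = inverse x"
  have x: "x ^ n = c" "x \<noteq> 0" using assms zero_Om by (auto simp: Om_def)
  define d where "d = - of_nat n * c * w ^ (n - 1)"
  have "d \<noteq> 0" using kn c_simps x by (simp add: d_def w_def)
  have "pderiv (1 - monom (h c) n) = monom (- of_nat n * h c) (n - 1)"
    by (simp add: pderiv_diff pderiv_monom minus_monom)
  hence E: "poly (pderiv (1 - monom (h c) n)) (h w) = h d"
    by (simp add: poly_monom d_def h.hom_mult h.hom_power h.hom_uminus h.hom_of_nat)
  have "coeff (pderiv (F * G - (1 - monom (h c) n))) i \<in> J" for i
    unfolding coeff_pderiv using FG_coeff_mem by (rule mult_mem)
  hence "poly (pderiv (F * G - (1 - monom (h c) n))) (h w) \<in> J" by (rule poly_mem)
  moreover have "poly (pderiv (F * G - (1 - monom (h c) n))) (h w)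
      = poly (pderiv G) (h w) * A x + poly (pderiv F) (h w) * B x - h d"
    unfolding pderiv_diff[of "F * G"] poly_diff E pderiv_mult by (simp add: A_def B_def w_def algebra_simps)
  ultimately have "h (inverse d) * (poly (pderiv G) (h w) * A x + poly (pderiv F) (h w) * B x - h d) \<in> J"
    by (metis mult_mem)
  moreover have "h (inverse d) * (poly (pderiv G) (h w) * A x + poly (pderiv F) (h w) * B x - h d)
     = (h (inverse d) * poly (pderiv G) (h w)) * A x + (h (inverse d) * poly (pderiv F) (h w)) * B x - h (inverse d * d)"
    by (simp add: h.hom_mult algebra_simps)
  ultimately show ?thesis using \<open>d \<noteq> 0\<close> by auto
qed

text \<open>
  Up to a unit, the idempotent of the piece of the quotient on which exactly the elements of \<open>I\<close> are
  inverse roots of \<open>F\<close> and the others are inverse roots of \<open>G\<close>.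
\<close>

definition delta where "delta I = (\<Prod>x\<in>I. B x) * (\<Prod>x\<in>Om - I. A x)"

lemma delta_A_mem: assumes "I \<subseteq> Om" "x \<in> I" shows "delta I * A x \<in> J"
proof -
  have "finite I" using assms finite_Om finite_subset by blast
  hence eq: "delta I * A x = (A x * B x) * ((\<Prod>x\<in>I - {x}. B x) * (\<Prod>x\<in>Om - I. A x))"
    using assms by (simp add: delta_def prod.remove[of I x] mult_ac)
  show ?thesis unfolding eq using assms by (intro mult_mem' AB_mem) auto
qed

lemma delta_B_mem: assumes "I \<subseteq> Om" "x \<in> Om - I" shows "delta I * B x \<in> J"
proof -
  have "finite (Om - I)" using finite_Om by blast
  hence eq: "delta I * B x = (A x * B x) * ((\<Prod>x\<in>I. B x) * (\<Prod>x\<in>(Om - I) - {x}. A x))"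
    using assms by (simp add: delta_def prod.remove[of "Om - I" x] mult_ac)
  show ?thesis unfolding eq using assms by (intro mult_mem' AB_mem) auto
qed

lemma delta_mem_of_roots:
  assumes "coeff P 0 = 1" "degree P \<le> d" "T \<subseteq> Om" "card T > d" "\<And>x. x \<in> T \<Longrightarrow> a * poly P (h (inverse x)) \<in> J"
  shows "a \<in> J"
proof -
  have "coeff (Polynomial.smult a P) 0 \<in> J"
  proof (rule coeffs_mem_of_roots)
    show "degree (Polynomial.smult a P) \<le> d" using assms(2) degree_smult_le order_trans by blast
    show "finite (inverse ` T)" using assms(3) finite_Om finite_subset by blast
    show "card (inverse ` T) > d" using assms(4) by (subst card_image) (auto simp: inj_on_def)
  qed (use assms in auto)
  thus ?thesis using assms(1) by simp
qed

text \<open>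
  If \<open>I\<close> has the wrong size, \<open>F\<close> or \<open>G\<close> has more roots on this piece than its degree permits, although its
  constant coefficient is \<open>1\<close>; so the piece is zero.
\<close>

lemma delta_mem: assumes "I \<subseteq> Om" "card I \<noteq> k" shows "delta I \<in> J"
proof (cases "card I > k")
  case True
  show ?thesis
    by (rule delta_mem_of_roots[of F k I])
       (use assms True degree_F delta_A_mem in \<open>auto simp: coeff_F e0 A_def\<close>)
next
  case False
  have "finite I" using assms(1) finite_Om by (rule finite_subset)
  hence "card (Om - I) = n - card I" using assms(1) card_Om by (simp add: card_Diff_subset)
  hence "card (Om - I) > n - k" using assms(2) False kn by linarith
  show ?thesis
    by (rule delta_mem_of_roots[of G "n - k" "Om - I"])
       (use assms \<open>card (Om - I) > n - k\<close> degree_G delta_B_mem in \<open>auto simp: coeff_G y0 B_def\<close>)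
qed

text \<open>
  On this piece \<open>F\<close> and \<open>\<Prod> (1 - x t)\<close> both have degree at most \<open>k\<close> and agree at \<open>k + 1\<close> places, the inverses of
  the elements of \<open>I\<close> and \<open>0\<close>.
\<close>

lemma delta_e_mem: assumes "I \<subseteq> Om" "card I = k" shows "delta I * (e i - h (esym I i)) \<in> J"
proof -
  have fin: "finite I" using assms finite_Om finite_subset by blast
  define R where "R = (\<Sum>i\<le>k. monom (h (coeff (rprod I) i)) i)"
  have degI: "degree (rprod I) \<le> k" using degree_rprod_le[of I] assms by simp
  hence coeff_R: "coeff R i = h (coeff (rprod I) i)" for i
    by (simp add: R_def coeff_sum coeff_eq_0)
  have poly_R: "poly R (h t) = h (poly (rprod I) t)" for t
  proof -
    have "poly (rprod I) t = (\<Sum>i\<le>k. coeff (rprod I) i * t ^ i)"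
      unfolding poly_altdef using degI by (intro sum.mono_neutral_left) (auto simp: coeff_eq_0)
    thus ?thesis by (simp add: R_def poly_sum poly_monom h.hom_sum h.hom_mult h.hom_power)
  qed
  define P where "P = Polynomial.smult (delta I) (F - R)"
  have "coeff P i \<in> J"
  proof (rule coeffs_mem_of_roots)
    have "degree R \<le> k" using degI by (intro degree_le) (simp add: coeff_R coeff_eq_0)
    thus "degree P \<le> k" unfolding P_def
      using degree_F degree_diff_le degree_smult_le order_trans by metis
    show "finite (insert 0 (inverse ` I))" using fin by simp
    have "0 \<notin> inverse ` I" using assms zero_Om by auto
    thus "card (insert 0 (inverse ` I)) > k"
      using fin assms by (simp add: card_image inj_on_def)
    fix t assume "t \<in> insert 0 (inverse ` I)"
    then consider "t = 0" | x where "x \<in> I" "t = inverse x" by auto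
    thus "poly P (h t) \<in> J"
    proof cases
      case 1
      have "coeff (rprod I) 0 = 1" using esym_0[of I] by (simp add: esym_def)
      thus ?thesis using 1 by (simp add: P_def poly_0_coeff_0 coeff_F coeff_R e0 zero_mem)
    next
      case 2
      have "poly (rprod I) t = 0"
        using 2 fin assms zero_Om by (subst rprod_zero_iff) auto
      hence "poly R (h t) = 0" by (simp add: poly_R)
      thus ?thesis using delta_A_mem[OF assms(1) 2(1)] 2 by (simp add: P_def A_def)
    qed
  qed
  also have "coeff P i = (-1) ^ i * (delta I * (e i - h (esym I i)))"
    by (simp add: P_def coeff_F coeff_R coeff_rprod h.hom_mult h.hom_power h.hom_uminus algebra_simps)
  finally have "(-1) ^ i * ((-1) ^ i * (delta I * (e i - h (esym I i)))) \<in> J" by (rule mult_mem)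
  thus ?thesis by (simp flip: mult.assoc power_mult_distrib)
qed

text \<open>
  An element belongs to \<open>J\<close> if it does so on every piece, and on the piece of a \<open>k\<close>-subset \<open>I\<close> the \<open>e i\<close> may be
  replaced by their values at \<open>I\<close>.
\<close>

theorem mem_of_local:
  assumes "\<And>I d. I \<subseteq> Om \<Longrightarrow> card I = k \<Longrightarrow> (\<And>i. d * (e i - h (esym I i)) \<in> J) \<Longrightarrow> d * p \<in> J"
  shows "p \<in> J"
proof (rule mem_of_split[OF finite_Om AB_comaximal])
  fix I assume I: "I \<subseteq> Om"
  have "p * prod B I * prod A (Om - I) = delta I * p" by (simp add: delta_def mult_ac)
  moreover have "delta I * p \<in> J"
  proof (cases "card I = k")
    case True
    thus ?thesis using assms[OF I] delta_e_mem[OF I] by auto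
  next
    case False
    thus ?thesis using delta_mem[OF I] by (intro mult_mem')
  qed
  ultimately show "p * prod B I * prod A (Om - I) \<in> J" by (simp only:)
qed auto

end

section \<open>The points of the quantum cohomology ring\<close>

definition roots :: "nat \<Rightarrow> nat \<Rightarrow> complex set" where
  "roots k n = {x. x ^ n = (-1) ^ (k + 1)}"

definition points :: "nat \<Rightarrow> nat \<Rightarrow> complex set set" where
  "points k n = {I. I \<subseteq> roots k n \<and> card I = k}"

definition ev :: "complex set \<Rightarrow> cpoly \<Rightarrow> complex" where
  "ev I = poly_value (\<lambda>c. c) (esym I)"

interpretation ev: comm_ring_hom "ev I" for I
  unfolding ev_def by (rule poly_value_hom[OF comm_ring_hom_id])

lemma ev_const [simp]: "ev I (const_poly c) = c"
  unfolding ev_def by (rule poly_value_const[OF comm_ring_hom_id])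

lemma ev_sigma: "card I = k \<Longrightarrow> ev I (sigma_poly k m) = esym_int I m"
proof -
  assume k: "card I = k"
  consider "m < 0" | "m = 0" | "1 \<le> m" "m \<le> int k" | "m > int k" by linarith
  thus ?thesis
  proof cases
    case 3
    hence "ev I (sigma_poly k (int (nat m))) = esym I (nat m)"
      unfolding ev_def by (intro poly_value_sigma[OF comm_ring_hom_id]) auto
    thus ?thesis using 3 by (simp add: esym_int_def)
  next
    case 4
    thus ?thesis using k by (simp add: sigma_poly_def esym_int_def esym_eq_0)
  qed (simp_all add: sigma_poly_def esym_int_def)
qed

lemma ev_det: "ev I (det (mat r r (\<lambda>(i, j). f i j))) = det (mat r r (\<lambda>(i, j). ev I (f i j)))"
proof -
  have "ev I (det (mat r r (\<lambda>(i, j). f i j))) = det (map_mat (ev I) (mat r r (\<lambda>(i, j). f i j)))"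
    by (rule ev.hom_det[symmetric])
  also have "map_mat (ev I) (mat r r (\<lambda>(i, j). f i j)) = mat r r (\<lambda>(i, j). ev I (f i j))"
    by (rule eq_matI) auto
  finally show ?thesis .
qed

locale grassmannian =
  fixes k n :: nat
  assumes k1: "1 \<le> k" and kn: "k < n"
begin

lemma finite_roots: "finite (roots k n)" and card_roots: "card (roots k n) = n" and zero_roots: "0 \<notin> roots k n"
proof -
  show "card (roots k n) = n" unfolding roots_def using kn by (intro card_nth_roots) auto
  thus "finite (roots k n)" using kn card_ge_0_finite by force
  show "0 \<notin> roots k n" using kn by (auto simp: roots_def zero_power)
qed

lemma pointsD: assumes "I \<in> points k n"
  shows "I \<subseteq> roots k n" "card I = k" "finite I" "0 \<notin> I"
  using assms finite_roots zero_roots finite_subset by (auto simp: points_def)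

lemma finite_points: "finite (points k n)"
  by (rule finite_subset[of _ "Pow (roots k n)"]) (auto simp: points_def finite_roots)

lemma rprod_compl: assumes "I \<in> points k n"
  shows "rprod I * rprod (roots k n - I) = 1 - monom ((-1) ^ (k + 1)) n"
proof -
  note I = pointsD[OF assms]
  have "rprod I * rprod (roots k n - I) = rprod (I \<union> (roots k n - I))"
    using I finite_roots by (intro rprod_union[symmetric]) auto
  also have "I \<union> (roots k n - I) = roots k n" using I by auto
  also have "rprod (roots k n) = 1 - monom ((-1) ^ (k + 1)) n"
    unfolding roots_def using kn by (intro rprod_all_roots) auto
  finally show ?thesis .
qed

lemma ev_sum: "ev I (sum f S) = (\<Sum>x\<in>S. ev I (f x))"
  by (rule ev.hom_sum)

lemma ev_Y_recurrence:
  assumes "I \<in> points k n" "r > 0"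
  shows "(\<Sum>i\<le>r. coeff (rprod I) i * ev I (Y_poly k (r - i))) = 0"
proof -
  have "(\<Sum>i\<le>r. coeff (rprod I) i * ev I (Y_poly k (r - i)))
     = ev I (\<Sum>i\<le>r. (-1) ^ i * sigma_poly k (int i) * Y_poly k (r - i))"
    using pointsD[OF assms(1)]
    by (simp add: ev_sum ev.hom_mult ev.hom_power ev.hom_uminus ev_sigma esym_int_def coeff_rprod)
  thus ?thesis using Y_poly_recurrence[OF assms(2)] by simp
qed

lemma Y_poly_0: "Y_poly k 0 = 1"
  by (simp add: Y_poly_def det_dim_zero)

lemma compl_coeff_recurrence:
  assumes "I \<in> points k n"
  shows "(\<Sum>i\<le>r. coeff (rprod I) i * coeff (rprod (roots k n - I)) (r - i))
      = (if r = 0 then 1 else 0) - (if r = n then (-1) ^ (k + 1) else 0)"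
proof -
  have "(\<Sum>i\<le>r. coeff (rprod I) i * coeff (rprod (roots k n - I)) (r - i))
     = coeff (1 - monom ((-1) ^ (k + 1)) n) r"
    unfolding rprod_compl[OF assms, symmetric] by (rule coeff_mult[symmetric])
  thus ?thesis by (simp add: coeff_1)
qed

lemma coeff_rprod_0: "coeff (rprod I) 0 = 1"
  using esym_0[of I] by (simp add: esym_def)

text \<open>
  The values of the determinants and the coefficients of \<open>\<Prod> (1 - x t)\<close> over the complementary roots satisfy the
  same recurrence below degree \<open>n\<close>: in both cases the product with \<open>\<Prod> (1 - x t)\<close> over \<open>I\<close> has no terms in the
  degrees from \<open>1\<close> to \<open>n - 1\<close>.
\<close>

lemma ev_Y:
  assumes I: "I \<in> points k n"
  shows "r < n \<Longrightarrow> ev I (Y_poly k r) = coeff (rprod (roots k n - I)) r"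
proof (induction r rule: less_induct)
  case (less r)
  show ?case
  proof (cases "r = 0")
    case False
    let ?q = "\<lambda>r. coeff (rprod (roots k n - I)) r"
    have "(\<Sum>i\<le>r. coeff (rprod I) i * (ev I (Y_poly k (r - i)) - ?q (r - i))) = 0"
      using ev_Y_recurrence[OF I, of r] compl_coeff_recurrence[OF I, of r] False less.prems
      by (simp add: right_diff_distrib sum_subtractf)
    also have "(\<Sum>i\<le>r. coeff (rprod I) i * (ev I (Y_poly k (r - i)) - ?q (r - i)))
       = (\<Sum>i\<in>{0}. coeff (rprod I) i * (ev I (Y_poly k (r - i)) - ?q (r - i)))"
      using less False by (intro sum.mono_neutral_right) auto
    finally show ?thesis by (simp add: coeff_rprod_0)
  qed (simp add: Y_poly_0 coeff_rprod_0)
qed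

lemma degree_compl: "I \<in> points k n \<Longrightarrow> degree (rprod (roots k n - I)) \<le> n - k"
  using degree_rprod_le[of "roots k n - I"] pointsD[of I] card_roots by (simp add: card_Diff_subset)

lemma ev_Y_eq_0:
  assumes I: "I \<in> points k n" and "n - k < r" "r < n"
  shows "ev I (Y_poly k r) = 0"
  using ev_Y[OF I assms(3)] degree_compl[OF I] assms(2) by (simp add: coeff_eq_0)

text \<open>
  In degree \<open>n\<close> the two recurrences differ: one has right-hand side \<open>0\<close>, the other one \<open>- (-1)\<^sup>k\<^sup>+\<^sup>1\<close>.
\<close>

lemma ev_Y_n:
  assumes I: "I \<in> points k n"
  shows "ev I (Y_poly k n) = (-1) ^ (k + 1)"
proof -
  let ?q = "\<lambda>r. coeff (rprod (roots k n - I)) r"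
  have qn: "?q n = 0" using degree_compl[OF I] k1 kn by (intro coeff_eq_0) linarith
  have "(\<Sum>i\<le>n. coeff (rprod I) i * (ev I (Y_poly k (n - i)) - ?q (n - i))) = (-1) ^ (k + 1)"
    using ev_Y_recurrence[OF I, of n] compl_coeff_recurrence[OF I, of n] kn
    by (simp add: right_diff_distrib sum_subtractf)
  also have "(\<Sum>i\<le>n. coeff (rprod I) i * (ev I (Y_poly k (n - i)) - ?q (n - i)))
     = (\<Sum>i\<in>{0}. coeff (rprod I) i * (ev I (Y_poly k (n - i)) - ?q (n - i)))"
    using ev_Y[OF I] by (intro sum.mono_neutral_right) auto
  finally show ?thesis using qn by (simp add: coeff_rprod_0)
qed

sublocale S: cring "sigma_ring k" by (rule cring_sigma_ring)

abbreviation "gens \<equiv> Y_poly k ` {n - k + 1..n - 1} \<union> {Y_poly k n + (-1) ^ k}"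

lemma gens_closed: "gens \<subseteq> carrier (sigma_ring k)"
  using Y_poly_closed by (auto intro!: sigma_closed)

lemma qh_ideal_ideal: "ideal (qh_ideal k n) (sigma_ring k)"
  unfolding qh_ideal_def by (rule S.genideal_ideal[OF gens_closed])

lemma qh_ideal_subset: "qh_ideal k n \<subseteq> carrier (sigma_ring k)"
  using ideal.Icarr[OF qh_ideal_ideal] by blast

lemma ev_qh_ideal:
  assumes I: "I \<in> points k n" and "p \<in> qh_ideal k n"
  shows "ev I p = 0"
proof -
  let ?K = "{p \<in> carrier (sigma_ring k). ev I p = 0}"
  have "ideal ?K (sigma_ring k)"
  proof (rule idealI)
    show "ring (sigma_ring k)" by (rule S.ring_axioms)
    show "subgroup ?K (add_monoid (sigma_ring k))"
    proof (rule S.add.subgroupI)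
      show "?K \<noteq> {}" using sigma_0_closed by auto
    next
      fix a assume "a \<in> ?K"
      thus "\<ominus>\<^bsub>sigma_ring k\<^esub> a \<in> ?K"
        by (simp add: sigma_a_inv sigma_uminus_closed ev.hom_uminus)
    qed (auto simp: sigma_add_closed ev.hom_add)
  qed (auto simp: sigma_mult_closed ev.hom_mult)
  moreover have "gens \<subseteq> ?K"
    using ev_Y_eq_0[OF I] ev_Y_n[OF I] gens_closed
    by (auto simp: ev.hom_add ev.hom_power ev.hom_uminus)
  ultimately have "qh_ideal k n \<subseteq> ?K"
    unfolding qh_ideal_def by (rule S.genideal_minimal)
  thus ?thesis using assms(2) by auto
qed

text \<open>
  The defining ideal is radical and its zeros are the points. The substantial direction is the
  splitting of the previous section, applied to the preimage of the ideal under the retraction; modulo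
  an element that identifies the special classes with their values at \<open>I\<close>, every polynomial is
  identified with its value at \<open>I\<close>.
\<close>

lemma qh_ideal_mem_iff:
  "p \<in> qh_ideal k n \<longleftrightarrow> p \<in> carrier (sigma_ring k) \<and> (\<forall>I\<in>points k n. ev I p = 0)"
proof
  assume "p \<in> qh_ideal k n"
  thus "p \<in> carrier (sigma_ring k) \<and> (\<forall>I\<in>points k n. ev I p = 0)"
    using qh_ideal_subset ev_qh_ideal by auto
next
  assume p: "p \<in> carrier (sigma_ring k) \<and> (\<forall>I\<in>points k n. ev I p = 0)"
  define J where "J = {q. retract k q \<in> qh_ideal k n}"
  interpret Q: ideal "qh_ideal k n" "sigma_ring k" by (rule qh_ideal_ideal)
  interpret cp: comm_ring_hom const_poly by (rule comm_ring_hom_const_poly)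
  have gens_mem: "g \<in> J" if "g \<in> gens" for g
  proof -
    have "g \<in> qh_ideal k n" unfolding qh_ideal_def using S.genideal_self[OF gens_closed] that by blast
    moreover have "retract k g = g" using that gens_closed by (intro retract_id) blast
    ultimately show ?thesis by (simp add: J_def)
  qed
  interpret factor_ideal const_poly J k n "\<lambda>i. sigma_poly k (int i)" "Y_poly k" "(-1) ^ (k + 1)"
  proof unfold_locales
    show "0 \<in> J" using Q.zero_closed by (simp add: J_def)
    show "a + b \<in> J" if "a \<in> J" "b \<in> J" for a b
      using that Q.a_closed by (simp add: J_def retract.hom_add)
    show "r * a \<in> J" if "a \<in> J" for r a
      using that Q.I_l_closed[of "retract k a" "retract k r"] retract_closed[of k r]
      by (simp add: J_def retract.hom_mult)
    show "1 \<le> k" "k < n" by (rule k1, rule kn)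
    show "Y_poly k 0 = 1" by (rule Y_poly_0)
    show "(\<Sum>i\<le>r. (-1) ^ i * sigma_poly k (int i) * Y_poly k (r - i)) = 0" if "r > 0" for r
      using that by (rule Y_poly_recurrence)
    show "Y_poly k r \<in> J" if "n - k < r" "r < n" for r
      using that by (intro gens_mem) auto
    show "Y_poly k n + (-1) ^ k \<in> J" by (intro gens_mem) auto
  qed (auto simp: sigma_poly_def)
  have "p \<in> J"
  proof (rule mem_of_local)
    fix I d assume I: "I \<subseteq> Om" "card I = k" and d: "\<And>i. d * (sigma_poly k (int i) - const_poly (esym I i)) \<in> J"
    have I': "I \<in> points k n" using I unfolding points_def roots_def Om_def by simp
    \<comment> \<open>The polynomials that \<open>d\<close> identifies with their value at \<open>I\<close> form a subalgebra containing the variables.\<close>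
    define C where "C = {q. d * (q - const_poly (ev I q)) \<in> J}"
    have C_const: "const_poly c \<in> C" for c by (simp add: C_def zero_mem)
    have C_add: "a + b \<in> C" if "a \<in> C" "b \<in> C" for a b
    proof -
      have "d * (a + b - const_poly (ev I (a + b))) = d * (a - const_poly (ev I a)) + d * (b - const_poly (ev I b))"
        by (simp add: ev.hom_add cp.hom_add algebra_simps)
      thus ?thesis using that add_mem by (simp add: C_def)
    qed
    have C_mult: "a * b \<in> C" if "a \<in> C" "b \<in> C" for a b
    proof -
      have "d * (a * b - const_poly (ev I (a * b)))
          = b * (d * (a - const_poly (ev I a))) + const_poly (ev I a) * (d * (b - const_poly (ev I b)))"
        by (simp add: ev.hom_mult cp.hom_mult algebra_simps)
      moreover have "b * (d * (a - const_poly (ev I a))) + const_poly (ev I a) * (d * (b - const_poly (ev I b))) \<in> J"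
        using that by (intro add_mem mult_mem[of "d * _"]) (simp_all add: C_def)
      ultimately show ?thesis by (simp add: C_def)
    qed
    have C_var: "sigma_var k i \<in> C" for i
    proof (cases "i = 0")
      case False
      thus ?thesis using d[of i] I(2) by (simp add: C_def sigma_var_def ev_sigma esym_int_def)
    qed (simp add: C_def sigma_var_def zero_mem)
    have C_1: "1 \<in> C" and C_0: "0 \<in> C" using C_const[of 1] C_const[of 0] by simp_all
    have C_sum: "sum f A \<in> C" if "\<And>x. x \<in> A \<Longrightarrow> f x \<in> C" for f :: "(nat \<Rightarrow>\<^sub>0 nat) \<Rightarrow> cpoly" and A
      using that by (induction A rule: infinite_finite_induct) (auto simp: C_0 C_add)
    have C_prod: "prod f A \<in> C" if "\<And>x. x \<in> A \<Longrightarrow> f x \<in> C" for f :: "nat \<Rightarrow> cpoly" and A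
      using that by (induction A rule: infinite_finite_induct) (auto simp: C_1 C_mult)
    have C_power: "q ^ i \<in> C" if "q \<in> C" for q i
      using that by (induction i) (auto simp: C_1 C_mult)
    have "retract k p \<in> C"
      unfolding retract_def poly_value_def mon_value_def
      by (intro C_sum C_mult C_const C_prod C_power C_var)
    hence "p \<in> C" using p retract_id by simp
    thus "d * p \<in> J" using p I' by (simp add: C_def)
  qed
  thus "p \<in> qh_ideal k n" using p retract_id by (simp add: J_def)
qed

end

section \<open>Schubert classes at the points\<close>

context grassmannian
begin

definition nodes :: "complex set \<Rightarrow> complex list" where
  "nodes I = (SOME zs. distinct zs \<and> set zs = roots k n - I)"

lemma nodes: "distinct (nodes I)" "set (nodes I) = roots k n - I"
proof -
  have "\<exists>zs. distinct zs \<and> set zs = roots k n - I"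
    using finite_distinct_list[of "roots k n - I"] finite_roots by auto
  from someI_ex[OF this] show "distinct (nodes I)" "set (nodes I) = roots k n - I"
    by (auto simp: nodes_def)
qed

lemma length_nodes: "I \<in> points k n \<Longrightarrow> length (nodes I) = n - k"
  using distinct_card[OF nodes(1), of I] pointsD[of I] card_roots by (simp add: nodes card_Diff_subset)

lemma ev_schubert:
  assumes "I \<in> points k n" "distinct zs" "set zs = roots k n - I" "\<mu> \<in> young_diagrams k (n - k)"
  shows "ev I (schubert_poly k \<mu>) * det (trans_mat zs) = alternant (map uminus zs) (set (beta_list \<mu>))"
proof -
  have len: "length \<mu> = n - k" using assms(4) by (simp add: young_diagrams_def)
  have "ev I (schubert_poly k \<mu>)
      = det (mat (n - k) (n - k) (\<lambda>(i, j). esym_int I (int (\<mu> ! i) + int j - int i)))"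
    unfolding schubert_poly_def ev_det len using pointsD(2)[OF assms(1)] by (simp add: ev_sigma)
  also have "\<dots> * det (trans_mat zs) = alternant (map uminus zs) (set (beta_list \<mu>))"
    using assms pointsD[OF assms(1)] kn by (intro jacobi_trudi) (auto simp: roots_def)
  finally show ?thesis .
qed

lemma det_trans_nodes: "det (trans_mat (nodes I)) \<noteq> 0"
  using nodes zero_roots by (intro det_trans_mat_nonzero) auto

text \<open>
  Each list of \<open>l\<close> distinct negated roots comes from a point, at which the determinants are alternants up
  to a common nonzero factor; at lists with repetitions all alternants vanish. So a relation between
  the Schubert classes is a relation between alternants on all lists of negated roots.
\<close>

lemma schubert_independent:
  assumes "\<And>I. I \<in> points k n \<Longrightarrow> (\<Sum>\<mu>\<in>young_diagrams k (n - k). c \<mu> * ev I (schubert_poly k \<mu>)) = 0"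
    and "\<mu> \<in> young_diagrams k (n - k)"
  shows "c \<mu> = 0"
proof -
  let ?Y = "young_diagrams k (n - k)" and ?b = "\<lambda>\<mu>. set (beta_list \<mu>)"
  let ?As = "{A. A \<subseteq> {..<n} \<and> card A = n - k}"
  have bij: "bij_betw ?b ?Y ?As" using bij_betw_beta_list[of k "n - k"] kn by simp
  define c' where "c' A = c (inv_into ?Y ?b A)" for A
  have c': "c' (?b \<nu>) = c \<nu>" if "\<nu> \<in> ?Y" for \<nu>
    using bij_betw_inv_into_left[OF bij that] by (simp add: c'_def)
  have "c' (?b \<mu>) = 0"
  proof (rule alternant_coeffs_zero[of "uminus ` roots k n" n "n - k" c'])
    show "finite (uminus ` roots k n)" using finite_roots by simp
    show "n \<le> card (uminus ` roots k n)" using card_roots by (simp add: card_image)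
    show "?b \<mu> \<subseteq> {..<n}" "card (?b \<mu>) = n - k" using assms(2) bij by (auto simp: bij_betw_def)
    fix ys :: "complex list" assume ys: "length ys = n - k" "set ys \<subseteq> uminus ` roots k n"
    show "(\<Sum>A\<in>?As. c' A * alternant ys A) = 0"
    proof (cases "distinct ys")
      case False
      thus ?thesis using ys finite_subset
        by (intro sum.neutral) (auto intro!: alternant_repeated simp: finite_subset[of _ "{..<n}"])
    next
      case True
      define zs where "zs = map uminus ys"
      have ys_zs: "ys = map uminus zs" by (simp add: zs_def o_def)
      have zs: "distinct zs" "set zs \<subseteq> roots k n" "length zs = n - k"
        using True ys by (auto simp: zs_def distinct_map)
      define I where "I = roots k n - set zs"
      have "card I = k"
        using zs card_roots finite_roots kn by (simp add: I_def card_Diff_subset distinct_card)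
      hence I: "I \<in> points k n" by (simp add: points_def I_def)
      have "set zs = roots k n - I" using zs by (auto simp: I_def)
      note ev = ev_schubert[OF I zs(1) this]
      have "(\<Sum>A\<in>?As. c' A * alternant ys A) = (\<Sum>\<nu>\<in>?Y. c' (?b \<nu>) * alternant ys (?b \<nu>))"
        by (rule sum.reindex_bij_betw[OF bij, symmetric])
      also have "\<dots> = (\<Sum>\<nu>\<in>?Y. c \<nu> * ev I (schubert_poly k \<nu>) * det (trans_mat zs))"
        by (intro sum.cong refl) (simp add: c' ev ys_zs mult.assoc)
      also have "\<dots> = (\<Sum>\<nu>\<in>?Y. c \<nu> * ev I (schubert_poly k \<nu>)) * det (trans_mat zs)"
        by (simp add: sum_distrib_right)
      finally show ?thesis using assms(1)[OF I] by simp
    qed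
  qed
  thus ?thesis using c'[OF assms(2)] by simp
qed

lemma roots_unit: "x \<in> roots k n \<Longrightarrow> cmod x = 1"
proof -
  assume "x \<in> roots k n"
  hence "cmod (x ^ n) = cmod ((-1) ^ (k + 1))" by (simp only: roots_def mem_Collect_eq)
  hence "cmod x ^ n = 1" by (simp add: norm_power)
  thus ?thesis using power_eq_imp_eq_base[of "cmod x" n 1] kn by simp
qed

lemma inverse_roots: "inverse x \<in> roots k n \<longleftrightarrow> x \<in> roots k n"
proof -
  have "inverse ((-1) ^ (k + 1)) = ((-1) ^ (k + 1) :: complex)" by (simp add: power_inverse[symmetric])
  thus ?thesis unfolding roots_def by (simp only: mem_Collect_eq power_inverse) (metis inverse_inverse_eq)
qed

lemma Im_inverse_roots: "x \<in> roots k n \<Longrightarrow> Im (inverse x) = - Im x"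
proof -
  assume "x \<in> roots k n"
  hence "(Re x)\<^sup>2 + (Im x)\<^sup>2 = 1" using roots_unit[of x] by (simp add: cmod_def)
  thus ?thesis by simp
qed

lemma real_roots: "x \<in> roots k n \<Longrightarrow> Im x = 0 \<Longrightarrow> x = 1 \<or> x = -1"
proof -
  assume x: "x \<in> roots k n" "Im x = 0"
  hence "\<bar>Re x\<bar> = 1" using roots_unit[of x] by (simp add: cmod_eq_Re)
  thus ?thesis using x(2) by (auto simp: complex_eq_iff abs_if split: if_splits)
qed

lemma one_root: "1 \<in> roots k n \<longleftrightarrow> odd k"
  by (cases "odd k") (auto simp: roots_def one_neq_neg_one)

lemma minus_one_root: "-1 \<in> roots k n \<longleftrightarrow> odd (n - k)"
  using kn by (cases "even k"; cases "even n") (auto simp: roots_def one_neq_neg_one one_neq_neg_one[symmetric])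

text \<open>
  On the unit circle inversion is complex conjugation, which exchanges the elements above and below
  the real axis.
\<close>

lemma card_inverse_closed:
  assumes "J \<subseteq> roots k n" "\<forall>x\<in>J. inverse x \<in> J"
  shows "card J = 2 * card {x \<in> J. Im x > 0} + of_bool (1 \<in> J) + of_bool (-1 \<in> J)"
proof -
  let ?P = "{x \<in> J. Im x > 0}" and ?N = "{x \<in> J. Im x < 0}" and ?R = "{x \<in> J. Im x = 0}"
  have fin: "finite J" using assms(1) finite_roots finite_subset by blast
  have Im: "Im (inverse x) = - Im x" if "x \<in> J" for x using that assms(1) Im_inverse_roots by blast
  have "bij_betw inverse ?P ?N"
    by (rule bij_betw_byWitness[where f' = inverse]) (use assms(2) Im in auto)
  hence PN: "card ?N = card ?P" by (simp add: bij_betw_same_card)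
  have "?R = (if 1 \<in> J then {1} else {}) \<union> (if -1 \<in> J then {-1} else {})"
    using assms(1) real_roots by auto
  hence R: "card ?R = of_bool (1 \<in> J) + of_bool (-1 \<in> J)" by (simp add: one_neq_neg_one)
  have "J = (?P \<union> ?N) \<union> ?R" by auto
  hence "card J = card ((?P \<union> ?N) \<union> ?R)" by simp
  also have "\<dots> = card (?P \<union> ?N) + card ?R" using fin by (intro card_Un_disjoint) auto
  also have "card (?P \<union> ?N) = card ?P + card ?N" using fin by (intro card_Un_disjoint) auto
  finally show ?thesis using PN R by simp
qed

definition sym_points :: "complex set set" where
  "sym_points = {I \<in> points k n. (\<forall>x\<in>I. inverse x \<in> I) \<and> -1 \<notin> I}"

definition schubert_sum_poly :: cpoly where
  "schubert_sum_poly = (\<Sum>\<mu>\<in>young_diagrams k (n - k). schubert_poly k \<mu>)"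

lemma ev_schubert_sum:
  assumes "I \<in> points k n"
  shows "ev I schubert_sum_poly * det (trans_mat (nodes I)) = alternant_sum n (map uminus (nodes I))"
proof -
  let ?Y = "young_diagrams k (n - k)" and ?b = "\<lambda>\<mu>. set (beta_list \<mu>)"
  let ?As = "{A. A \<subseteq> {..<n} \<and> card A = n - k}"
  have bij: "bij_betw ?b ?Y ?As" using bij_betw_beta_list[of k "n - k"] kn by simp
  have "ev I schubert_sum_poly * det (trans_mat (nodes I))
      = (\<Sum>\<mu>\<in>?Y. alternant (map uminus (nodes I)) (?b \<mu>))"
    unfolding schubert_sum_poly_def ev_sum sum_distrib_right
    by (intro sum.cong refl ev_schubert assms nodes)
  also have "\<dots> = (\<Sum>A\<in>?As. alternant (map uminus (nodes I)) A)"
    by (rule sum.reindex_bij_betw[OF bij])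
  finally show ?thesis using length_nodes[OF assms] by (simp add: alternant_sum_def)
qed

text \<open>
  The criterion for sums of alternants concerns the negated complement of \<open>I\<close>. Complement and negation
  preserve closure under inversion and turn the conditions at \<open>\<pm>1\<close> into conditions on the membership of \<open>\<mp>1\<close>
  in \<open>I\<close>. The condition that \<open>1\<close> belongs to \<open>I\<close> for odd \<open>k\<close> holds automatically by parity, since the
  elements other than \<open>\<pm>1\<close> come in pairs.
\<close>

lemma ev_schubert_sum_nonzero_iff:
  assumes I: "I \<in> points k n"
  shows "ev I schubert_sum_poly \<noteq> 0 \<longleftrightarrow> I \<in> sym_points"
proof -
  define ys where "ys = map uminus (nodes I)"
  let ?l = "n - k"
  note I' = pointsD[OF I]
  have ys: "distinct ys" "length ys = ?l" "set ys = uminus ` (roots k n - I)"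
    using nodes[of I] length_nodes[OF I] by (simp_all add: ys_def distinct_map)
  have mem: "y \<in> set ys \<longleftrightarrow> - y \<in> roots k n \<and> - y \<notin> I" for y
    unfolding ys(3) by (metis (no_types) DiffD1 DiffD2 DiffI add.inverse_inverse image_iff)
  have pow: "y ^ n = (-1) ^ (?l + 1)" if "y \<in> set ys" for y
  proof -
    have "(- y) ^ n = (-1) ^ (k + 1)" using that mem by (simp add: roots_def)
    hence "y ^ n = (-1) ^ n * (-1) ^ (k + 1)"
      using power_minus[of "- y" n] by simp
    also have "\<dots> = (-1) ^ (?l + 1)"
      using kn by (cases "even k"; cases "even n") auto
    finally show ?thesis .
  qed
  have closed: "(\<forall>y\<in>set ys. inverse y \<in> set ys) \<longleftrightarrow> (\<forall>x\<in>I. inverse x \<in> I)"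
  proof
    assume *: "\<forall>y\<in>set ys. inverse y \<in> set ys"
    show "\<forall>x\<in>I. inverse x \<in> I"
    proof (rule ballI, rule ccontr)
      fix x assume x: "x \<in> I" "inverse x \<notin> I"
      hence "- inverse x \<in> set ys" using I'(1) inverse_roots[of x] by (auto simp: mem)
      with * have "inverse (- inverse x) \<in> set ys" by blast
      thus False using x by (simp add: mem inverse_minus_eq)
    qed
  next
    assume *: "\<forall>x\<in>I. inverse x \<in> I"
    show "\<forall>y\<in>set ys. inverse y \<in> set ys"
    proof
      fix y assume y: "y \<in> set ys"
      hence "- inverse y \<in> roots k n" using inverse_roots[of "- y"] by (simp add: mem inverse_minus_eq)
      moreover have "- inverse y \<notin> I"
      proof
        assume "- inverse y \<in> I"
        hence "inverse (- inverse y) \<in> I" using * by blast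
        thus False using y by (simp add: mem inverse_minus_eq)
      qed
      ultimately show "inverse y \<in> set ys" by (simp add: mem)
    qed
  qed
  have parity: "k = 2 * card {x \<in> I. Im x > 0} + of_bool (1 \<in> I) + of_bool (-1 \<in> I)"
    if "\<forall>x\<in>I. inverse x \<in> I" using card_inverse_closed[OF I'(1) that] I'(2) by simp
  have odd_one: "1 \<in> I" if "\<forall>x\<in>I. inverse x \<in> I" "-1 \<notin> I" "odd k"
    using parity[OF that(1)] that(2,3) by (cases "1 \<in> I") auto
  have "ev I schubert_sum_poly \<noteq> 0 \<longleftrightarrow> alternant_sum n ys \<noteq> 0"
    using ev_schubert_sum[OF I] det_trans_nodes[of I] by (metis mult_eq_0_iff ys_def)
  also have "\<dots> \<longleftrightarrow> (\<forall>x\<in>I. inverse x \<in> I) \<and> -1 \<notin> I"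
  proof (cases "even ?l")
    case True
    have "y \<noteq> 1" if "y \<in> set ys" for y using pow[OF that] True by (auto simp: one_neq_neg_one)
    hence "alternant_sum n ys \<noteq> 0 \<longleftrightarrow> (\<forall>y\<in>set ys. inverse y \<in> set ys) \<and> -1 \<notin> set ys"
      using ys True pow kn by (intro alternant_sum_nonzero_even[where d = "-1"]) auto
    also have "\<dots> \<longleftrightarrow> (\<forall>x\<in>I. inverse x \<in> I) \<and> -1 \<notin> I"
    proof -
      have "-1 \<notin> I" using minus_one_root True I'(1) by auto
      moreover have "-1 \<notin> set ys \<longleftrightarrow> (odd k \<longrightarrow> 1 \<in> I)" using one_root by (auto simp: mem)
      ultimately show ?thesis using closed odd_one by blast
    qed
    finally show ?thesis .
  next
    case False
    hence "alternant_sum n ys \<noteq> 0 \<longleftrightarrow> (\<forall>y\<in>set ys. inverse y \<in> set ys) \<and> -1 \<notin> set ys \<and> 1 \<in> set ys"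
      using ys pow kn by (intro alternant_sum_nonzero_odd) auto
    also have "\<dots> \<longleftrightarrow> (\<forall>x\<in>I. inverse x \<in> I) \<and> -1 \<notin> I"
    proof -
      have "1 \<in> set ys \<longleftrightarrow> -1 \<notin> I" using minus_one_root False by (simp add: mem)
      moreover have "-1 \<notin> set ys \<longleftrightarrow> (odd k \<longrightarrow> 1 \<in> I)" using one_root by (auto simp: mem)
      ultimately show ?thesis using closed odd_one by blast
    qed
    finally show ?thesis .
  qed
  finally show ?thesis using I by (simp add: sym_points_def)
qed

lemma sym_points_iff:
  assumes I: "I \<in> points k n"
  shows "I \<in> sym_points \<longleftrightarrow> (\<forall>i\<le>k. esym I (k - i) = esym I i)"
  using palindromic_iff[of I] pointsD[OF I] I by (simp add: sym_points_def)

section \<open>Counting symmetric points and small diagrams\<close>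

text \<open>
  The number \<open>1\<close> is a root iff \<open>k\<close> is odd, and \<open>-1\<close> is one iff \<open>n - k\<close> is odd; the other roots come in conjugate
  pairs.
\<close>

lemma card_upper_roots: "card {x \<in> roots k n. Im x > 0} = k div 2 + (n - k) div 2"
proof -
  have "n = 2 * card {x \<in> roots k n. Im x > 0} + of_bool (odd k) + of_bool (odd (n - k))"
    using card_inverse_closed[of "roots k n"] card_roots inverse_roots one_root minus_one_root by simp
  thus ?thesis using kn by (cases "odd k"; cases "odd (n - k)") (auto elim!: oddE evenE)
qed

text \<open>
  A symmetric point is determined by its elements in the open upper half plane: their conjugates
  belong to it as well, \<open>-1\<close> does not, and \<open>1\<close> does iff \<open>k\<close> is odd.
\<close>

lemma card_sym_points: "card sym_points = (k div 2 + (n - k) div 2) choose (k div 2)"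
proof -
  let ?H = "{x \<in> roots k n. Im x > 0}"
  let ?f = "\<lambda>I. {x \<in> I. Im x > 0}"
  let ?g = "\<lambda>T. T \<union> inverse ` T \<union> (if odd k then {1} else {})"
  have "bij_betw ?f sym_points {T. T \<subseteq> ?H \<and> card T = k div 2}"
  proof (rule bij_betw_byWitness[where f' = ?g])
    show "\<forall>I\<in>sym_points. ?g (?f I) = I"
    proof
      fix I assume I: "I \<in> sym_points"
      hence sub: "I \<subseteq> roots k n" and closed: "\<forall>x\<in>I. inverse x \<in> I" and m1: "-1 \<notin> I" and card: "card I = k"
        using pointsD by (auto simp: sym_points_def)
      have Im: "Im (inverse x) = - Im x" if "x \<in> I" for x using that sub Im_inverse_roots by blast
      have k: "k = 2 * card (?f I) + of_bool (1 \<in> I)"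
        using card_inverse_closed[OF sub closed] m1 card by simp
      hence one: "1 \<in> I \<longleftrightarrow> odd k" by (cases "1 \<in> I") auto
      show "?g (?f I) = I"
      proof (intro equalityI subsetI)
        fix x assume "x \<in> ?g (?f I)"
        thus "x \<in> I" using closed one by (auto split: if_splits)
      next
        fix x assume x: "x \<in> I"
        consider "Im x > 0" | "Im x < 0" | "Im x = 0" by linarith
        thus "x \<in> ?g (?f I)"
        proof cases
          case 2
          hence "inverse x \<in> ?f I" using x closed Im by auto
          thus ?thesis by (auto intro!: image_eqI[of x inverse "inverse x"])
        next
          case 3
          hence "x = 1" using real_roots x sub m1 by blast
          thus ?thesis using x one by auto
        qed (use x in auto)
      qed
    qed
    show gprop: "\<forall>T\<in>{T. T \<subseteq> ?H \<and> card T = k div 2}. ?f (?g T) = T"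
    proof
      fix T assume T: "T \<in> {T. T \<subseteq> ?H \<and> card T = k div 2}"
      have "\<not> Im x > 0" if "x \<in> inverse ` T" for x
      proof -
        obtain y where y: "y \<in> T" "x = inverse y" using \<open>x \<in> inverse ` T\<close> by blast
        hence "y \<in> roots k n" "Im y > 0" using T by auto
        thus ?thesis using Im_inverse_roots[of y] y(2) by simp
      qed
      moreover have "Im x > 0" if "x \<in> T" for x using T \<open>x \<in> T\<close> by auto
      ultimately show "?f (?g T) = T" by (auto split: if_splits)
    qed
    show "?f ` sym_points \<subseteq> {T. T \<subseteq> ?H \<and> card T = k div 2}"
    proof (intro image_subsetI CollectI conjI)
      fix I assume I: "I \<in> sym_points"
      hence sub: "I \<subseteq> roots k n" and closed: "\<forall>x\<in>I. inverse x \<in> I" and m1: "-1 \<notin> I" and card: "card I = k"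
        using pointsD by (auto simp: sym_points_def)
      show "?f I \<subseteq> ?H" using sub by auto
      show "card (?f I) = k div 2"
        using card_inverse_closed[OF sub closed] m1 card by (cases "1 \<in> I") auto
    qed
    show "?g ` {T. T \<subseteq> ?H \<and> card T = k div 2} \<subseteq> sym_points"
    proof (intro image_subsetI)
      fix T assume T: "T \<in> {T. T \<subseteq> ?H \<and> card T = k div 2}"
      have sub: "?g T \<subseteq> roots k n" using T inverse_roots one_root by auto
      have closed: "\<forall>x\<in>?g T. inverse x \<in> ?g T" by auto
      have nz: "Im x \<noteq> 0" if x: "x \<in> T \<union> inverse ` T" for x
      proof -
        obtain y where y: "y \<in> T" "x = y \<or> x = inverse y" using x by blast
        hence "y \<in> roots k n" "Im y > 0" using T by auto
        thus ?thesis using Im_inverse_roots[of y] y(2) by auto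
      qed
      have "-1 \<notin> T \<union> inverse ` T" "1 \<notin> T \<union> inverse ` T" using nz[of "-1"] nz[of 1] by auto
      moreover have "(-1 :: complex) \<noteq> 1" by (simp add: one_neq_neg_one[symmetric])
      ultimately have m1: "-1 \<notin> ?g T" and one: "1 \<in> ?g T \<longleftrightarrow> odd k" by (simp_all only: Un_iff) auto
      have fg: "?f (?g T) = T" using gprop T by blast
      have cT: "card T = k div 2" using T by simp
      have "(-1 \<in> ?g T) = False" using m1 by blast
      hence "card (?g T) = 2 * (k div 2) + of_bool (odd k) + of_bool False"
        using card_inverse_closed[OF sub closed] unfolding fg cT one by (simp only:)
      hence "card (?g T) = k" by (cases "odd k") auto
      thus "?g T \<in> sym_points" using sub closed m1 by (simp add: sym_points_def points_def)
    qed
  qed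
  hence "card sym_points = card {T. T \<subseteq> ?H \<and> card T = k div 2}" by (rule bij_betw_same_card)
  also have "\<dots> = card ?H choose (k div 2)" using finite_roots by (intro n_subsets) auto
  finally show ?thesis using card_upper_roots by simp
qed

end

lemma small_diagrams_subset: "small_diagrams k l \<subseteq> young_diagrams k l"
  by (auto simp: small_diagrams_def)

text \<open>
  At most half of the rows are nonzero and the first row is the longest, so truncating the list of
  rows gives the diagrams in a rectangle of half the height and half the width.
\<close>

lemma card_small_diagrams:
  assumes "l > 0"
  shows "card (small_diagrams k l) = (k div 2 + l div 2) choose (l div 2)"
proof -
  let ?a = "l div 2"
  have "bij_betw (take ?a) (small_diagrams k l) (young_diagrams (k div 2) ?a)"
  proof (rule bij_betw_byWitness[where f' = "\<lambda>\<nu>. \<nu> @ replicate (l - ?a) 0"])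
    have zero: "\<mu> ! i = 0" if \<mu>: "\<mu> \<in> small_diagrams k l" and i: "?a \<le> i" "i < l" for \<mu> i
    proof (rule ccontr)
      assume nz: "\<mu> ! i \<noteq> 0"
      have "\<mu> ! j \<noteq> 0" if "j \<le> i" for j
      proof -
        have "\<mu> ! i \<le> \<mu> ! j"
          using \<mu> i that by (cases "j = i") (auto simp: small_diagrams_def young_diagrams_def sorted_wrt_iff_nth_less)
        thus ?thesis using nz by simp
      qed
      hence "{..i} \<subseteq> {i. i < l \<and> \<mu> ! i \<noteq> 0}" using i by auto
      hence "card {..i} \<le> card {i. i < l \<and> \<mu> ! i \<noteq> 0}" by (intro card_mono) auto
      thus False using \<mu> i by (simp add: small_diagrams_def)
    qed
    show "\<forall>\<mu>\<in>small_diagrams k l. take ?a \<mu> @ replicate (l - ?a) 0 = \<mu>"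
    proof
      fix \<mu> assume \<mu>: "\<mu> \<in> small_diagrams k l"
      hence len: "length \<mu> = l" by (simp add: small_diagrams_def young_diagrams_def)
      show "take ?a \<mu> @ replicate (l - ?a) 0 = \<mu>"
        using len zero[OF \<mu>] by (intro nth_equalityI) (auto simp: nth_append)
    qed
    show "\<forall>\<nu>\<in>young_diagrams (k div 2) ?a. take ?a (\<nu> @ replicate (l - ?a) 0) = \<nu>"
      by (simp add: young_diagrams_def)
    show "take ?a ` small_diagrams k l \<subseteq> young_diagrams (k div 2) ?a"
    proof (intro image_subsetI)
      fix \<mu> assume \<mu>: "\<mu> \<in> small_diagrams k l"
      hence len: "length \<mu> = l" and sorted: "sorted_wrt (\<ge>) \<mu>" and first: "\<mu> ! 0 \<le> k div 2"
        by (auto simp: small_diagrams_def young_diagrams_def)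
      have "x \<le> k div 2" if x: "x \<in> set \<mu>" for x
      proof -
        obtain i where "i < l" "x = \<mu> ! i" using x len by (auto simp: in_set_conv_nth)
        thus ?thesis using sorted first len by (cases "i = 0") (auto simp: sorted_wrt_iff_nth_less intro: order_trans)
      qed
      thus "take ?a \<mu> \<in> young_diagrams (k div 2) ?a"
        using len sorted by (auto simp: young_diagrams_def sorted_wrt_take dest: in_set_takeD)
    qed
    show "(\<lambda>\<nu>. \<nu> @ replicate (l - ?a) 0) ` young_diagrams (k div 2) ?a \<subseteq> small_diagrams k l"
    proof (intro image_subsetI)
      fix \<nu> assume \<nu>: "\<nu> \<in> young_diagrams (k div 2) ?a"
      let ?\<mu> = "\<nu> @ replicate (l - ?a) 0"
      have len: "length \<nu> = ?a" using \<nu> by (simp add: young_diagrams_def)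
      have "?\<mu> \<in> young_diagrams k l"
        unfolding young_diagrams_def
      proof (intro CollectI conjI ballI)
        show "length ?\<mu> = l" using len by simp
        show "sorted_wrt (\<ge>) ?\<mu>"
          using \<nu> len by (auto simp: young_diagrams_def sorted_wrt_iff_nth_less nth_append)
        fix x assume "x \<in> set ?\<mu>"
        hence "x \<le> k div 2" using \<nu> by (auto simp: young_diagrams_def)
        thus "x \<le> k" by linarith
      qed
      moreover have "{i. i < l \<and> ?\<mu> ! i \<noteq> 0} \<subseteq> {..<?a}"
        using len by (auto simp: nth_append split: if_splits)
      hence "card {i. i < l \<and> ?\<mu> ! i \<noteq> 0} \<le> ?a" using card_mono[of "{..<?a}"] by fastforce
      moreover have "?\<mu> ! 0 \<le> k div 2"
        using \<nu> len assms by (cases \<nu>) (auto simp: young_diagrams_def)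
      ultimately show "?\<mu> \<in> small_diagrams k l" by (simp add: small_diagrams_def)
    qed
  qed
  thus ?thesis using card_young_diagrams by (simp add: bij_betw_same_card)
qed

context grassmannian
begin

lemma card_sym_points_small: "card sym_points = card (small_diagrams k (n - k))"
  unfolding card_sym_points using card_small_diagrams[of "n - k" k] kn binomial_symmetric[of "k div 2" "k div 2 + (n - k) div 2"]
  by simp

end

section \<open>The annihilator as an ideal of the quantum cohomology ring\<close>

lemma scalar_space_sel [simp]:
  "carrier (scalar_space R \<iota>) = carrier R" "add (scalar_space R \<iota>) = add R"
  "zero (scalar_space R \<iota>) = zero R" "c \<odot>\<^bsub>scalar_space R \<iota>\<^esub> x = \<iota> c \<otimes>\<^bsub>R\<^esub> x"
  by (simp_all add: scalar_space_def)

lemma scalar_space_vectorspace: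
  assumes "cring R" "\<iota> \<in> Ring.ring_hom class_ring R"
  shows "vectorspace class_ring (scalar_space R \<iota>)"
proof -
  interpret R: cring R by fact
  note hom = ring_hom_closed[OF assms(2), simplified] ring_hom_mult[OF assms(2), simplified]
    ring_hom_add[OF assms(2), simplified] ring_hom_one[OF assms(2), simplified]
  have "Module.module class_ring (scalar_space R \<iota>)"
  proof (rule moduleI)
    show "cring (class_ring :: complex ring)" by (rule class_cring.is_cring)
    show "abelian_group (scalar_space R \<iota>)"
    proof (rule abelian_groupI)
      fix x assume "x \<in> carrier (scalar_space R \<iota>)"
      thus "\<exists>y\<in>carrier (scalar_space R \<iota>). y \<oplus>\<^bsub>scalar_space R \<iota>\<^esub> x = \<zero>\<^bsub>scalar_space R \<iota>\<^esub>"
        by (intro bexI[of _ "\<ominus>\<^bsub>R\<^esub> x"]) (simp_all add: R.l_neg)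
    qed (simp_all add: R.a_ac)
  qed (simp_all add: hom R.l_distr R.r_distr R.m_assoc)
  thus ?thesis by (intro vectorspace.intro class_field)
qed

lemma annihilator_ideal:
  fixes R :: "('a, 'b) ring_scheme" (structure)
  assumes "cring R" "x \<in> carrier R"
  shows "ideal (annihilator R x) R"
proof -
  interpret cring R by fact
  show ?thesis
  proof (rule idealI)
    show "ring R" by (rule ring_axioms)
    show "subgroup (annihilator R x) (add_monoid R)"
    proof (rule add.subgroupI)
      show "annihilator R x \<subseteq> carrier R" by (auto simp: annihilator_def)
      show "annihilator R x \<noteq> {}" using assms(2) by (auto simp: annihilator_def intro!: exI[of _ "\<zero>"])
    next
      fix a assume "a \<in> annihilator R x"
      thus "\<ominus> a \<in> annihilator R x" using assms(2) by (simp add: annihilator_def l_minus)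
    next
      fix a b assume "a \<in> annihilator R x" "b \<in> annihilator R x"
      thus "a \<oplus> b \<in> annihilator R x" using assms(2) by (simp add: annihilator_def l_distr)
    qed
  next
    fix a b assume "a \<in> annihilator R x" "b \<in> carrier R"
    thus "b \<otimes> a \<in> annihilator R x" "a \<otimes> b \<in> annihilator R x"
      using assms(2) by (simp_all add: annihilator_def m_assoc m_comm[of a b])
  qed
qed

context grassmannian
begin

abbreviation "cl \<equiv> qh_class k n"
abbreviation "R \<equiv> qh_ring k n"
abbreviation "Pol \<equiv> carrier (sigma_ring k)"

sublocale J: ideal "qh_ideal k n" "sigma_ring k" by (rule qh_ideal_ideal)

sublocale R: cring R
  unfolding qh_ring_def by (rule J.quotient_is_cring) (rule cring_sigma_ring)

lemma cl_hom: "cl \<in> Ring.ring_hom (sigma_ring k) R"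
proof -
  have "cl = (+>\<^bsub>sigma_ring k\<^esub>) (qh_ideal k n)" by (rule ext) (simp add: qh_class_def)
  thus ?thesis unfolding qh_ring_def using J.rcos_ring_hom by simp
qed

lemma cl_closed: "p \<in> Pol \<Longrightarrow> cl p \<in> carrier R"
  using ring_hom_closed[OF cl_hom] by simp

lemma cl_add: "p \<in> Pol \<Longrightarrow> q \<in> Pol \<Longrightarrow> cl (p + q) = cl p \<oplus>\<^bsub>R\<^esub> cl q"
  using ring_hom_add[OF cl_hom] by simp

lemma cl_mult: "p \<in> Pol \<Longrightarrow> q \<in> Pol \<Longrightarrow> cl (p * q) = cl p \<otimes>\<^bsub>R\<^esub> cl q"
  using ring_hom_mult[OF cl_hom] by simp

lemma cl_1: "cl 1 = \<one>\<^bsub>R\<^esub>"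
  using ring_hom_one[OF cl_hom] by simp

lemma cl_0: "cl 0 = \<zero>\<^bsub>R\<^esub>"
  using ring_hom_zero[OF cl_hom S.ring_axioms R.ring_axioms] by simp

lemma cl_diff: assumes "p \<in> Pol" "q \<in> Pol" shows "cl (p - q) = cl p \<ominus>\<^bsub>R\<^esub> cl q"
proof -
  have "cl p = cl (p - q) \<oplus>\<^bsub>R\<^esub> cl q"
    using cl_add[of "p - q" q] assms by (simp add: sigma_closed)
  thus ?thesis using assms by (simp add: a_minus_def cl_closed sigma_closed R.a_assoc R.r_neg)
qed

lemma cl_sum: "(\<And>x. x \<in> A \<Longrightarrow> f x \<in> Pol) \<Longrightarrow> cl (sum f A) = (\<Oplus>\<^bsub>R\<^esub>x\<in>A. cl (f x))"
proof (induction A rule: infinite_finite_induct)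
  case (insert x A)
  thus ?case by (subst R.finsum_insert) (auto simp: cl_add cl_closed sigma_closed)
qed (simp_all add: cl_0)

lemma carrier_R: "carrier R = cl ` Pol"
  by (auto simp: qh_ring_def FactRing_def A_RCOSETS_def' qh_class_def)

lemma cl_eq_iff:
  assumes "p \<in> Pol" "q \<in> Pol"
  shows "cl p = cl q \<longleftrightarrow> (\<forall>I\<in>points k n. ev I p = ev I q)"
proof -
  have "cl p = cl q \<longleftrightarrow> p - q \<in> qh_ideal k n"
    using S.quotient_eq_iff_same_a_r_cos[OF qh_ideal_ideal assms] assms
    by (simp add: qh_class_def sigma_a_minus)
  thus ?thesis using assms by (simp add: qh_ideal_mem_iff sigma_closed ev.hom_minus)
qed

lemma schubert_sum_poly_closed: "schubert_sum_poly \<in> Pol"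
  unfolding schubert_sum_poly_def by (intro sigma_sum_closed schubert_poly_closed)

lemma schubert_sum_eq: "schubert_sum k n = cl schubert_sum_poly"
  unfolding schubert_sum_def schubert_sum_poly_def schubert_class_def
  by (rule cl_sum[symmetric]) (rule schubert_poly_closed)

abbreviation "AnnP \<equiv> annihilator R (schubert_sum k n)"

lemma sym_points_subset: "sym_points \<subseteq> points k n"
  by (auto simp: sym_points_def)

text \<open>
  In a ring of functions on points, the annihilator of \<open>P\<close> is the ideal of the set where \<open>P\<close> is nonzero.
\<close>

lemma cl_mem_annihilator_iff:
  assumes "p \<in> Pol"
  shows "cl p \<in> AnnP \<longleftrightarrow> (\<forall>I\<in>sym_points. ev I p = 0)"
proof -
  have "cl p \<in> AnnP \<longleftrightarrow> cl (p * schubert_sum_poly) = cl 0"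
    using assms schubert_sum_poly_closed
    by (simp add: annihilator_def schubert_sum_eq cl_mult cl_closed cl_0)
  also have "\<dots> \<longleftrightarrow> (\<forall>I\<in>points k n. ev I p * ev I schubert_sum_poly = 0)"
    using assms schubert_sum_poly_closed by (subst cl_eq_iff) (simp_all add: sigma_closed ev.hom_mult)
  also have "\<dots> \<longleftrightarrow> (\<forall>I\<in>sym_points. ev I p = 0)"
    using ev_schubert_sum_nonzero_iff sym_points_subset by (auto simp: mult_eq_0_iff)
  finally show ?thesis .
qed

text \<open>
  The polynomial \<open>\<Prod> (1 - y t)\<close> of a point \<open>I'\<close>, evaluated at \<open>1 / x\<close> and multiplied over all \<open>x\<close> outside \<open>I\<close>,
  vanishes unless \<open>I'\<close> avoids all these \<open>x\<close>, that is, unless \<open>I' = I\<close>. Its coefficients are polynomials in the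
  special classes.
\<close>

lemma interpolation:
  assumes I: "I \<in> points k n"
  obtains d where "d \<in> Pol" "\<And>I'. I' \<in> points k n \<Longrightarrow> ev I' d = (if I' = I then 1 else 0)"
proof -
  define f where "f x = (\<Sum>i\<le>k. const_poly ((- inverse x) ^ i) * sigma_poly k (int i))" for x
  have ev_f: "ev I' (f x) = poly (rprod I') (inverse x)" if "I' \<in> points k n" for I' x
  proof -
    have "ev I' (f x) = (\<Sum>i\<le>k. (- inverse x) ^ i * esym I' i)"
      using pointsD[OF that] by (simp add: f_def ev_sum ev.hom_mult ev_sigma esym_int_def)
    also have "\<dots> = (\<Sum>i\<le>k. coeff (rprod I') i * inverse x ^ i)"
      by (intro sum.cong refl) (simp add: coeff_rprod power_minus[of "inverse x"])
    also have "\<dots> = (\<Sum>i\<le>degree (rprod I'). coeff (rprod I') i * inverse x ^ i)"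
      using degree_rprod_le[of I'] pointsD[OF that]
      by (intro sum.mono_neutral_right) (auto simp: coeff_eq_0)
    finally show ?thesis by (simp add: poly_altdef)
  qed
  define d where "d = (\<Prod>x\<in>roots k n - I. f x)"
  have d: "d \<in> Pol" unfolding d_def f_def by (intro sigma_closed)
  have zero_iff: "ev I' d = 0 \<longleftrightarrow> I' \<noteq> I" if I': "I' \<in> points k n" for I'
  proof -
    have "ev I' d = 0 \<longleftrightarrow> (\<exists>x\<in>roots k n - I. x \<in> I')"
      unfolding d_def ev.hom_prod using finite_roots pointsD[OF I'] rprod_zero_iff[of I'] ev_f[OF I'] by simp
    also have "\<dots> \<longleftrightarrow> \<not> I' \<subseteq> I" using pointsD[OF I'] by auto
    also have "\<dots> \<longleftrightarrow> I' \<noteq> I"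
      using pointsD[OF I'] pointsD[OF I] card_subset_eq[of I I'] by auto
    finally show ?thesis .
  qed
  show ?thesis
  proof (rule that)
    show "const_poly (inverse (ev I d)) * d \<in> Pol" using d by (intro sigma_closed)
    show "ev I' (const_poly (inverse (ev I d)) * d) = (if I' = I then 1 else 0)"
      if "I' \<in> points k n" for I' using zero_iff[OF that] zero_iff[OF I] by (auto simp: ev.hom_mult)
  qed
qed

definition idem :: "complex set \<Rightarrow> cpoly" where
  "idem I = (SOME d. d \<in> Pol \<and> (\<forall>I'\<in>points k n. ev I' d = (if I' = I then 1 else 0)))"

lemma idem:
  assumes "I \<in> points k n"
  shows "idem I \<in> Pol" "I' \<in> points k n \<Longrightarrow> ev I' (idem I) = (if I' = I then 1 else 0)"
proof -
  have "\<exists>d. d \<in> Pol \<and> (\<forall>I'\<in>points k n. ev I' d = (if I' = I then 1 else 0))"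
    using interpolation[OF assms] by metis
  from someI_ex[OF this] show "idem I \<in> Pol" "I' \<in> points k n \<Longrightarrow> ev I' (idem I) = (if I' = I then 1 else 0)"
    by (auto simp: idem_def)
qed

lemma ev_idem_sum:
  assumes "A \<subseteq> points k n" "I' \<in> points k n"
  shows "ev I' (\<Sum>I\<in>A. idem I * g I) = (if I' \<in> A then ev I' (g I') else 0)"
proof -
  have "finite A" using assms(1) finite_points finite_subset by blast
  have "ev I' (\<Sum>I\<in>A. idem I * g I) = (\<Sum>I\<in>A. if I' = I then ev I' (g I') else 0)"
    unfolding ev_sum
  proof (intro sum.cong refl)
    fix I assume "I \<in> A"
    hence "ev I' (idem I) = (if I' = I then 1 else 0)" using assms by (intro idem(2)) auto
    thus "ev I' (idem I * g I) = (if I' = I then ev I' (g I') else 0)" by (simp add: ev.hom_mult)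
  qed
  thus ?thesis using \<open>finite A\<close> by simp
qed

text \<open>
  At every point where \<open>P\<close> vanishes some difference \<open>\<sigma>\<^sub>k\<^sub>-\<^sub>i - \<sigma>\<^sub>i\<close> is nonzero. Scaling it there and multiplying by the
  indicator function of the point gives an element of the ideal; sums of these elements realise every
  function that vanishes on the symmetric points.
\<close>

lemma annihilator_eq:
  "AnnP = Idl\<^bsub>R\<^esub> ((\<lambda>i. sigma_class k n (k - i) \<ominus>\<^bsub>R\<^esub> sigma_class k n i) ` {0..k})"
proof -
  define g where "g i = sigma_poly k (int (k - i)) - sigma_poly k (int i)" for i
  have g: "g i \<in> Pol" for i unfolding g_def by (intro sigma_closed)
  have ev_g: "ev I (g i) = esym I (k - i) - esym I i" if "I \<in> points k n" for I i
    using pointsD[OF that] by (simp add: g_def ev.hom_minus ev_sigma esym_int_def)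
  have gens: "(\<lambda>i. sigma_class k n (k - i) \<ominus>\<^bsub>R\<^esub> sigma_class k n i) ` {0..k} = (\<lambda>i. cl (g i)) ` {0..k}"
    by (intro image_cong refl) (simp add: sigma_class_def g_def cl_diff sigma_poly_closed)
  let ?G = "(\<lambda>i. cl (g i)) ` {0..k}"
  have G: "?G \<subseteq> carrier R" using g cl_closed by auto
  have ann: "ideal AnnP R"
    using schubert_sum_poly_closed by (intro annihilator_ideal) (simp_all add: R.is_cring schubert_sum_eq cl_closed)
  interpret K: ideal "Idl\<^bsub>R\<^esub> ?G" R by (rule R.genideal_ideal[OF G])
  have "Idl\<^bsub>R\<^esub> ?G \<subseteq> AnnP"
  proof (rule R.genideal_minimal[OF ann])
    show "?G \<subseteq> AnnP"
    proof
      fix X assume "X \<in> ?G"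
      then obtain i where i: "i \<le> k" "X = cl (g i)" by auto
      have "ev I (g i) = 0" if "I \<in> sym_points" for I
        using that sym_points_iff[of I] sym_points_subset ev_g[of I i] i(1) by auto
      thus "X \<in> AnnP" using i(2) cl_mem_annihilator_iff[OF g] by blast
    qed
  qed
  moreover have "AnnP \<subseteq> Idl\<^bsub>R\<^esub> ?G"
  proof
    fix X assume X: "X \<in> AnnP"
    then obtain p where p: "p \<in> Pol" "X = cl p" by (auto simp: annihilator_def carrier_R)
    have p0: "ev I p = 0" if "I \<in> sym_points" for I
      using X p that cl_mem_annihilator_iff[OF p(1)] by blast
    let ?A = "points k n - sym_points"
    have "\<exists>i\<le>k. ev I (g i) \<noteq> 0" if "I \<in> ?A" for I
      using that sym_points_iff[of I] ev_g[of I] by auto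
    then obtain i where i: "\<And>I. I \<in> ?A \<Longrightarrow> i I \<le> k \<and> ev I (g (i I)) \<noteq> 0" by metis
    define r where "r I = const_poly (ev I p / ev I (g (i I)))" for I
    define q where "q = (\<Sum>I\<in>?A. idem I * (r I * g (i I)))"
    have "ev I' q = ev I' p" if "I' \<in> points k n" for I'
    proof -
      have "ev I' q = (if I' \<in> ?A then ev I' (r I' * g (i I')) else 0)"
        unfolding q_def using that by (intro ev_idem_sum) auto
      thus ?thesis using i[of I'] p0[of I'] that by (auto simp: r_def ev.hom_mult)
    qed
    moreover have qP: "q \<in> Pol" unfolding q_def r_def
      by (intro sigma_sum_closed sigma_mult_closed idem(1) sigma_const_closed g) auto
    ultimately have "cl q = X" using p by (simp add: cl_eq_iff)
    moreover have "cl q \<in> Idl\<^bsub>R\<^esub> ?G"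
    proof -
      have mem: "idem I * (r I * g (i I)) \<in> Pol \<and> cl (idem I * (r I * g (i I))) \<in> Idl\<^bsub>R\<^esub> ?G" if "I \<in> ?A" for I
      proof -
        have rP: "idem I * r I \<in> Pol" unfolding r_def using that by (intro sigma_closed idem(1)) auto
        have "cl (g (i I)) \<in> Idl\<^bsub>R\<^esub> ?G"
          using R.genideal_self[OF G] i[OF that] by auto
        hence "cl (idem I * r I) \<otimes>\<^bsub>R\<^esub> cl (g (i I)) \<in> Idl\<^bsub>R\<^esub> ?G"
          using K.I_l_closed cl_closed[OF rP] by blast
        moreover have "idem I * r I * g (i I) \<in> Pol" by (rule sigma_mult_closed[OF rP g])
        ultimately show ?thesis using cl_mult[OF rP g] by (simp add: mult.assoc)
      qed
      have "sum (\<lambda>I. idem I * (r I * g (i I))) B \<in> Pol \<and> cl (sum (\<lambda>I. idem I * (r I * g (i I))) B) \<in> Idl\<^bsub>R\<^esub> ?G"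
        if "B \<subseteq> ?A" for B
        using that
      proof (induction B rule: infinite_finite_induct)
        case (insert I B)
        thus ?case using mem[of I] K.a_closed by (simp add: cl_add sigma_closed)
      qed (use K.zero_closed in \<open>simp_all add: cl_0 sigma_closed\<close>)
      thus ?thesis unfolding q_def by blast
    qed
    ultimately show "X \<in> Idl\<^bsub>R\<^esub> ?G" by simp
  qed
  ultimately show ?thesis unfolding gens by auto
qed

section \<open>The quotient by the annihilator\<close>

lemma const_hom: "(\<lambda>c. cl (const_poly c)) \<in> Ring.ring_hom class_ring R"
proof -
  interpret cp: comm_ring_hom const_poly by (rule comm_ring_hom_const_poly)
  show ?thesis
    by (rule ring_hom_memI)
       (simp_all add: cl_closed sigma_const_closed cp.hom_mult cp.hom_add cl_mult cl_add cl_1)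
qed

sublocale Ann: ideal AnnP R
  using schubert_sum_poly_closed by (intro annihilator_ideal) (simp_all add: R.is_cring schubert_sum_eq cl_closed)

definition qcl :: "cpoly \<Rightarrow> cpoly set set" where "qcl p = AnnP +>\<^bsub>R\<^esub> cl p"

lemma qcl_hom: "qcl \<in> Ring.ring_hom (sigma_ring k) (R Quot AnnP)"
  using ring_hom_trans[OF cl_hom Ann.rcos_ring_hom] by (simp add: qcl_def[abs_def] o_def)

lemma qcl_simps:
  assumes "p \<in> Pol"
  shows "qcl p \<in> carrier (R Quot AnnP)"
    "q \<in> Pol \<Longrightarrow> qcl (p + q) = qcl p \<oplus>\<^bsub>R Quot AnnP\<^esub> qcl q"
    "q \<in> Pol \<Longrightarrow> qcl (p * q) = qcl p \<otimes>\<^bsub>R Quot AnnP\<^esub> qcl q"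
  using assms ring_hom_closed[OF qcl_hom] ring_hom_add[OF qcl_hom] ring_hom_mult[OF qcl_hom] by simp_all

lemma carrier_quot: "carrier (R Quot AnnP) = qcl ` Pol"
  by (auto simp: FactRing_def A_RCOSETS_def' carrier_R qcl_def)

lemma qcl_eq_iff:
  assumes "p \<in> Pol" "q \<in> Pol"
  shows "qcl p = qcl q \<longleftrightarrow> (\<forall>I\<in>sym_points. ev I p = ev I q)"
proof -
  have "qcl p = qcl q \<longleftrightarrow> cl (p - q) \<in> AnnP"
    unfolding qcl_def using R.quotient_eq_iff_same_a_r_cos[OF Ann.is_ideal cl_closed cl_closed] assms
    by (simp add: cl_diff)
  thus ?thesis using assms by (simp add: cl_mem_annihilator_iff sigma_closed ev.hom_minus)
qed

abbreviation "QuotSp \<equiv> qh_quot_space k n AnnP"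
abbreviation "SmallSp \<equiv> (qh_space k n)\<lparr>carrier := G_S k n\<rparr>"
abbreviation "Small \<equiv> small_diagrams k (n - k)"

lemma vectorspace_qh: "vectorspace class_ring (qh_space k n)"
  unfolding qh_space_def by (rule scalar_space_vectorspace[OF R.is_cring const_hom])

lemma vectorspace_V: "vectorspace class_ring QuotSp"
proof -
  have "cring (R Quot AnnP)" using Ann.quotient_is_cring R.is_cring by blast
  moreover have "(\<lambda>c. AnnP +>\<^bsub>R\<^esub> cl (const_poly c)) \<in> Ring.ring_hom class_ring (R Quot AnnP)"
    using ring_hom_trans[OF const_hom Ann.rcos_ring_hom] by (simp add: o_def)
  ultimately show ?thesis unfolding qh_quot_space_def by (rule scalar_space_vectorspace)
qed

lemma finite_B: "finite Small"
  using small_diagrams_subset finite_young_diagrams finite_subset by blast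

text \<open>
  Linear combinations of the small Schubert polynomials with a coefficient function, so that the space
  spanned by their classes has coordinates.
\<close>

definition comb :: "(nat list \<Rightarrow> complex) \<Rightarrow> cpoly" where
  "comb a = (\<Sum>\<mu>\<in>Small. const_poly (a \<mu>) * schubert_poly k \<mu>)"

lemma comb_closed: "comb a \<in> Pol"
  unfolding comb_def by (intro sigma_closed schubert_poly_closed)

lemma comb_add: "comb (\<lambda>\<mu>. a \<mu> + b \<mu>) = comb a + comb b"
proof -
  interpret cp: comm_ring_hom const_poly by (rule comm_ring_hom_const_poly)
  show ?thesis by (simp add: comb_def cp.hom_add distrib_right sum.distrib)
qed

lemma comb_scale: "comb (\<lambda>\<mu>. c * a \<mu>) = const_poly c * comb a"
proof -
  interpret cp: comm_ring_hom const_poly by (rule comm_ring_hom_const_poly)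
  show ?thesis by (simp add: comb_def cp.hom_mult sum_distrib_left mult.assoc)
qed

lemma cl_comb_inj:
  assumes "cl (comb a) = cl (comb b)" "\<mu> \<in> Small"
  shows "a \<mu> = b \<mu>"
proof -
  \<comment> \<open>Coefficients are extended by zero to all diagrams of the rectangle.\<close>
  let ?c = "\<lambda>\<mu>. if \<mu> \<in> Small then a \<mu> - b \<mu> else 0"
  have sub: "Small \<subseteq> young_diagrams k (n - k)" by (rule small_diagrams_subset)
  have "?c \<mu> = 0"
  proof (rule schubert_independent)
    show "\<mu> \<in> young_diagrams k (n - k)" using assms(2) sub by blast
    fix I assume I: "I \<in> points k n"
    have "(\<Sum>\<mu>\<in>young_diagrams k (n - k). ?c \<mu> * ev I (schubert_poly k \<mu>))
        = (\<Sum>\<mu>\<in>Small. (a \<mu> - b \<mu>) * ev I (schubert_poly k \<mu>))"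
      using sub finite_young_diagrams by (intro sum.mono_neutral_cong_right) auto
    also have "\<dots> = ev I (comb a) - ev I (comb b)"
      by (simp add: comb_def ev_sum ev.hom_mult left_diff_distrib sum_subtractf)
    also have "\<dots> = 0" using assms(1) I by (simp add: cl_eq_iff comb_closed)
    finally show "(\<Sum>\<mu>\<in>young_diagrams k (n - k). ?c \<mu> * ev I (schubert_poly k \<mu>)) = 0" .
  qed
  thus ?thesis using assms(2) by simp
qed

lemma comb_submodule: "LinearCombinations.submodule class_ring (range (\<lambda>a. cl (comb a))) (qh_space k n)"
proof -
  interpret vectorspace class_ring "qh_space k n" by (rule vectorspace_qh)
  show ?thesis
  proof (unfold_locales)
    show "range (\<lambda>a. cl (comb a)) \<subseteq> carrier (qh_space k n)"
      by (auto simp: qh_space_def cl_closed comb_closed)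
    show "v \<oplus>\<^bsub>qh_space k n\<^esub> w \<in> range (\<lambda>a. cl (comb a))"
      if vw: "v \<in> range (\<lambda>a. cl (comb a))" "w \<in> range (\<lambda>a. cl (comb a))" for v w
    proof -
      obtain a b where "v = cl (comb a)" "w = cl (comb b)" using vw by blast
      hence "v \<oplus>\<^bsub>qh_space k n\<^esub> w = cl (comb (\<lambda>\<mu>. a \<mu> + b \<mu>))"
        by (simp add: qh_space_def comb_add cl_add comb_closed)
      thus ?thesis by blast
    qed
    have "comb (\<lambda>_. 0) = 0" using comb_scale[of 0 "\<lambda>_. 0"] by (simp add: const_poly_def)
    hence "\<zero>\<^bsub>qh_space k n\<^esub> = cl (comb (\<lambda>_. 0))" by (simp add: qh_space_def cl_0)
    thus "\<zero>\<^bsub>qh_space k n\<^esub> \<in> range (\<lambda>a. cl (comb a))" by blast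
    show "c \<odot>\<^bsub>qh_space k n\<^esub> v \<in> range (\<lambda>a. cl (comb a))"
      if cv: "c \<in> carrier class_ring" "v \<in> range (\<lambda>a. cl (comb a))" for c v
    proof -
      obtain a where "v = cl (comb a)" using cv by blast
      hence "c \<odot>\<^bsub>qh_space k n\<^esub> v = cl (comb (\<lambda>\<mu>. c * a \<mu>))"
        by (simp add: qh_space_def comb_scale cl_mult comb_closed sigma_const_closed)
      thus ?thesis by blast
    qed
  qed
qed

lemma G_S_eq: "G_S k n = range (\<lambda>a. cl (comb a))"
proof -
  interpret vectorspace class_ring "qh_space k n" by (rule vectorspace_qh)
  let ?S = "schubert_class k n ` Small"
  have S: "?S \<subseteq> carrier (qh_space k n)"
    by (auto simp: qh_space_def schubert_class_def cl_closed schubert_poly_closed)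
  have G_S: "G_S k n = span ?S" by (simp add: G_S_def)
  have "G_S k n \<subseteq> range (\<lambda>a. cl (comb a))"
    unfolding G_S
  proof (rule span_is_subset[OF _ comb_submodule])
    show "?S \<subseteq> range (\<lambda>a. cl (comb a))"
    proof
      fix X assume "X \<in> ?S"
      then obtain \<mu> where \<mu>: "\<mu> \<in> Small" "X = cl (schubert_poly k \<mu>)" by (auto simp: schubert_class_def)
      have "comb (\<lambda>\<nu>. if \<nu> = \<mu> then 1 else 0) = (\<Sum>\<nu>\<in>Small. if \<nu> = \<mu> then schubert_poly k \<nu> else 0)"
        unfolding comb_def by (intro sum.cong refl) (auto simp: const_poly_def)
      also have "\<dots> = schubert_poly k \<mu>" using \<mu>(1) finite_B by simp
      finally show "X \<in> range (\<lambda>a. cl (comb a))" using \<mu>(2) by (metis rangeI)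
    qed
  qed
  moreover have "cl (comb a) \<in> G_S k n" for a
  proof -
    interpret N: LinearCombinations.submodule class_ring "G_S k n" "qh_space k n"
      unfolding G_S by (rule span_is_submodule[OF S])
    have N_add: "X \<oplus>\<^bsub>R\<^esub> Y \<in> G_S k n" if "X \<in> G_S k n" "Y \<in> G_S k n" for X Y
      using N.m_closed[OF that] by (simp add: qh_space_def)
    have mem: "cl (const_poly (a \<mu>) * schubert_poly k \<mu>) \<in> G_S k n" if "\<mu> \<in> Small" for \<mu>
    proof -
      have "schubert_class k n \<mu> \<in> G_S k n" using in_own_span[OF S] that unfolding G_S by blast
      hence "a \<mu> \<odot>\<^bsub>qh_space k n\<^esub> schubert_class k n \<mu> \<in> G_S k n" by (intro N.smult_closed) simp
      thus ?thesis by (simp add: qh_space_def schubert_class_def cl_mult sigma_const_closed schubert_poly_closed)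
    qed
    have "(\<Sum>\<mu>\<in>A. const_poly (a \<mu>) * schubert_poly k \<mu>) \<in> Pol \<and> cl (\<Sum>\<mu>\<in>A. const_poly (a \<mu>) * schubert_poly k \<mu>) \<in> G_S k n"
      if "A \<subseteq> Small" for A
      using that
    proof (induction A rule: infinite_finite_induct)
      case (insert \<mu> A)
      have "const_poly (a \<mu>) * schubert_poly k \<mu> \<in> Pol" by (intro sigma_closed schubert_poly_closed)
      thus ?case using insert mem[of \<mu>] N_add by (simp add: cl_add sigma_closed)
    qed (use N.zero_closed in \<open>simp_all add: cl_0 sigma_closed qh_space_def\<close>)
    thus ?thesis unfolding comb_def by blast
  qed
  ultimately show ?thesis by auto
qed

lemma vectorspace_W: "vectorspace class_ring SmallSp"
proof -
  interpret vectorspace class_ring "qh_space k n" by (rule vectorspace_qh)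
  have "Module.module class_ring SmallSp"
    using submodule_is_module[OF comb_submodule] by (simp add: G_S_eq)
  thus ?thesis by (intro vectorspace.intro class_field)
qed

text \<open>
  A bijection between small diagrams and symmetric points turns the values of a class at the symmetric
  points, which determine its coset, into coefficients of small Schubert classes, which are free by
  linear independence.
\<close>

theorem quotient_isomorphic: "vs_isomorphic class_ring QuotSp SmallSp"
proof -
  obtain g where g: "bij_betw g Small sym_points"
    using finite_same_card_bij[OF finite_B] card_sym_points_small finite_points sym_points_subset finite_subset by metis
  \<comment> \<open>The map is defined on cosets of cosets through polynomial representatives.\<close>
  define rep where "rep Y = (SOME p. p \<in> Pol \<and> qcl p = Y)" for Y
  define T where "T Y = cl (comb (\<lambda>\<mu>. ev (g \<mu>) (rep Y)))" for Y
  have gs: "g \<mu> \<in> sym_points" if "\<mu> \<in> Small" for \<mu> using g that by (auto simp: bij_betw_def)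
  have T: "T (qcl p) = cl (comb (\<lambda>\<mu>. ev (g \<mu>) p))" if p: "p \<in> Pol" for p
  proof -
    have "rep (qcl p) \<in> Pol \<and> qcl (rep (qcl p)) = qcl p"
      unfolding rep_def by (rule someI[of _ p]) (use p in simp)
    hence "ev I (rep (qcl p)) = ev I p" if "I \<in> sym_points" for I
      using qcl_eq_iff[of "rep (qcl p)" p] p that by auto
    hence "comb (\<lambda>\<mu>. ev (g \<mu>) (rep (qcl p))) = comb (\<lambda>\<mu>. ev (g \<mu>) p)"
      unfolding comb_def using gs by (intro sum.cong refl) auto
    thus ?thesis by (simp add: T_def)
  qed
  have carrV: "carrier QuotSp = qcl ` Pol" by (simp add: qh_quot_space_def carrier_quot)
  have carrW: "carrier SmallSp = range (\<lambda>a. cl (comb a))" by (simp add: G_S_eq)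
  have "T \<in> LinearCombinations.module_hom class_ring QuotSp SmallSp"
    unfolding LinearCombinations.module_hom_def
  proof (intro CollectI conjI allI impI)
    show "T \<in> carrier QuotSp \<rightarrow> carrier SmallSp" unfolding carrV carrW using T by auto
    fix X Y assume "X \<in> carrier QuotSp \<and> Y \<in> carrier QuotSp"
    then obtain p q where pq: "p \<in> Pol" "q \<in> Pol" "X = qcl p" "Y = qcl q" by (auto simp: carrV)
    hence "X \<oplus>\<^bsub>QuotSp\<^esub> Y = qcl (p + q)" by (simp add: qh_quot_space_def qcl_simps)
    hence "T (X \<oplus>\<^bsub>QuotSp\<^esub> Y) = cl (comb (\<lambda>\<mu>. ev (g \<mu>) p + ev (g \<mu>) q))"
      using pq by (simp add: T sigma_closed ev.hom_add)
    thus "T (X \<oplus>\<^bsub>QuotSp\<^esub> Y) = T X \<oplus>\<^bsub>SmallSp\<^esub> T Y"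
      using pq by (simp add: T comb_add cl_add comb_closed qh_space_def)
  next
    fix c :: complex and X assume "c \<in> carrier class_ring \<and> X \<in> carrier QuotSp"
    then obtain p where p: "p \<in> Pol" "X = qcl p" by (auto simp: carrV)
    have "c \<odot>\<^bsub>QuotSp\<^esub> X = qcl (const_poly c) \<otimes>\<^bsub>R Quot AnnP\<^esub> qcl p"
      by (simp add: qh_quot_space_def p qcl_def)
    also have "\<dots> = qcl (const_poly c * p)" using p by (simp add: qcl_simps sigma_closed)
    finally have "T (c \<odot>\<^bsub>QuotSp\<^esub> X) = cl (comb (\<lambda>\<mu>. c * ev (g \<mu>) p))"
      using p by (simp add: T sigma_closed ev.hom_mult)
    thus "T (c \<odot>\<^bsub>QuotSp\<^esub> X) = c \<odot>\<^bsub>SmallSp\<^esub> T X"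
      using p by (simp add: T comb_scale cl_mult comb_closed sigma_const_closed qh_space_def)
  qed
  moreover have "bij_betw T (carrier QuotSp) (carrier SmallSp)"
    unfolding bij_betw_def carrV carrW
  proof
    show "inj_on T (qcl ` Pol)"
    proof (rule inj_onI)
      fix X Y assume "X \<in> qcl ` Pol" "Y \<in> qcl ` Pol" and TXY: "T X = T Y"
      then obtain p q where pq: "p \<in> Pol" "q \<in> Pol" "X = qcl p" "Y = qcl q" by auto
      have eq: "ev (g \<mu>) p = ev (g \<mu>) q" if "\<mu> \<in> Small" for \<mu>
        using cl_comb_inj[of "\<lambda>\<mu>. ev (g \<mu>) p" "\<lambda>\<mu>. ev (g \<mu>) q" \<mu>] TXY pq that by (simp add: T)
      have "ev I p = ev I q" if I: "I \<in> sym_points" for I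
      proof -
        obtain \<mu> where "\<mu> \<in> Small" "I = g \<mu>" using g I by (auto simp: bij_betw_def)
        thus ?thesis using eq by simp
      qed
      thus "X = Y" using pq by (simp add: qcl_eq_iff)
    qed
    show "T ` qcl ` Pol = range (\<lambda>a. cl (comb a))"
    proof (intro equalityI subsetI)
      fix Y assume "Y \<in> range (\<lambda>a. cl (comb a))"
      then obtain a where a: "Y = cl (comb a)" by auto
      define p where "p = (\<Sum>I\<in>sym_points. idem I * const_poly (a (inv_into Small g I)))"
      have p: "p \<in> Pol" unfolding p_def
        using sym_points_subset by (intro sigma_sum_closed sigma_mult_closed idem(1) sigma_const_closed) auto
      have "ev (g \<mu>) p = a \<mu>" if "\<mu> \<in> Small" for \<mu>
      proof -
        have "ev (g \<mu>) p = a (inv_into Small g (g \<mu>))"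
          unfolding p_def using gs[OF that] sym_points_subset by (subst ev_idem_sum) auto
        thus ?thesis using bij_betw_inv_into_left[OF g that] by simp
      qed
      hence "comb (\<lambda>\<mu>. ev (g \<mu>) p) = comb a" unfolding comb_def by (intro sum.cong refl) auto
      hence "Y = T (qcl p)" using T[OF p] a by simp
      thus "Y \<in> T ` qcl ` Pol" using p by blast
    qed (use T in auto)
  qed
  moreover have "Module.module class_ring QuotSp" "Module.module class_ring SmallSp"
    using vectorspace_V vectorspace_W by (simp_all add: vectorspace_def)
  ultimately show ?thesis unfolding vs_isomorphic_def
    by (intro exI[of _ T] conjI linear_map.intro vectorspace_V vectorspace_W mod_hom.intro mod_hom_axioms.intro)
qed

end

theorem theorem4p8:
  fixes k n :: nat
  assumes "1 \<le> k" and "k < n"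
  shows "annihilator (qh_ring k n) (schubert_sum k n)
           = Idl\<^bsub>qh_ring k n\<^esub>
               ((\<lambda>i. sigma_class k n (k - i) \<ominus>\<^bsub>qh_ring k n\<^esub> sigma_class k n i) ` {0..k})
       \<and> vs_isomorphic class_ring
           (qh_quot_space k n (annihilator (qh_ring k n) (schubert_sum k n)))
           ((qh_space k n)\<lparr>carrier := G_S k n\<rparr>)"
proof -
  interpret grassmannian k n by unfold_locales (rule assms)+
  show ?thesis using annihilator_eq quotient_isomorphic by blast
qed

end
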